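(* For a matroid $\mathcal{M}=(U,\mathcal{I})$ with $|U|=n$ and rank $r$, equipped with distinct weights $w:U\to\mathbb{R}$ and accessed in the dynamic-rank-oracle model, there exists a data structure supporting: - $\textsc{Initialize}(X)$: given $X\subseteq U$, initialize and return the min-weight basis $S$ of $X$ in $\tilde O(n)$ time; - $\textsc{Delete}(x)$: given $x\in X$, remove $x$ from $X$ and return the new min-weight basis of $X$ in $\tilde O(\sqrt{r})$ time; the new basis contains at most one element (the replacement element of $x$) not in the old basis, and the procedure returns such an element if any.
   Context: A basis of $X\subseteq U$ is an independent subset of $X$ of size equal to the rank of $X$; with distinct weights the basis minimizing total weight (min-weight basis) is unique. Dynamic-rank-oracle model: starting from $S_0=\emptyset$, the algorithm may create a new set by inserting or deleting one element into/from any previously created set, and query the rank of any created set; "time" counts both running time and the number of such operations. $\tilde O$ hides polylogarithmic factors in $n$. *)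

theory Defs
  imports Complex_Main "HOL-Library.Log_Nat"
begin

locale matroid =
  fixes U :: "'a set" and indep :: "'a set \<Rightarrow> bool"
  assumes finite_ground: "finite U"
    and indep_subset_ground: "indep I \<Longrightarrow> I \<subseteq> U"
    and indep_empty: "indep {}"
    and indep_subset: "indep J \<Longrightarrow> I \<subseteq> J \<Longrightarrow> indep I"
    and indep_exchange:
      "indep I \<Longrightarrow> indep J \<Longrightarrow> card I < card J \<Longrightarrow> \<exists>x\<in>J - I. indep (insert x I)"

definition matroid_rank :: "('a set \<Rightarrow> bool) \<Rightarrow> 'a set \<Rightarrow> nat" where
  "matroid_rank indep X = Max (card ` {I. I \<subseteq> X \<and> indep I})"

definition is_basis :: "('a set \<Rightarrow> bool) \<Rightarrow> 'a set \<Rightarrow> 'a set \<Rightarrow> bool" where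
  "is_basis indep X B \<longleftrightarrow> B \<subseteq> X \<and> indep B \<and> card B = matroid_rank indep X"

definition is_min_weight_basis ::
    "('a set \<Rightarrow> bool) \<Rightarrow> ('a \<Rightarrow> real) \<Rightarrow> 'a set \<Rightarrow> 'a set \<Rightarrow> bool" where
  "is_min_weight_basis indep w X B \<longleftrightarrow>
     is_basis indep X B \<and> (\<forall>B'. is_basis indep X B' \<longrightarrow> sum w B \<le> sum w B')"

text \<open>
  The machine is a random access machine with a structured control flow, natural numbers as
  memory contents, and the logarithmic cost measure: evaluating a node of an expression costs one
  plus the number of binary digits of its value. Hence a cost bound also bounds the number of
  executed steps, and no information can be hidden in large numbers. Programs are finite syntactic
  objects that do not depend on the matroid or on its size.

  Matroid elements are named by their position \<open>i < n\<close> in a numbering \<open>el\<close> of the ground set.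
  Independence and weights are accessible only through the four commands at the end: creating a set
  from a previously created one by inserting or deleting one element (\<open>Insert x h e\<close> and
  \<open>Remove x h e\<close> store the handle of the new set in \<open>x\<close>), querying the rank of a created set,
  and comparing the weights of two elements.
\<close>

type_synonym vname = string

datatype aexp =
    Const nat
  | Var vname
  | Arr vname aexp
  | Add aexp aexp
  | Sub aexp aexp
  | Mul aexp aexp
  | Div aexp aexp
  | Less aexp aexp

datatype com =
    Skip
  | Assign vname aexp
  | Store vname aexp aexp
  | Seq com com
  | Cond aexp com com
  | While aexp com
  | Insert vname aexp aexp
  | Remove vname aexp aexp
  | Rank vname aexp
  | Lighter vname aexp aexp

text \<open>The handle of a created set is its position in the list \<open>created\<close>.\<close>

record 'a state =
  vars :: "vname \<Rightarrow> nat"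
  arrs :: "vname \<Rightarrow> nat \<Rightarrow> nat"
  created :: "'a set list"

abbreviation set_var :: "vname \<Rightarrow> nat \<Rightarrow> 'a state \<Rightarrow> 'a state" where
  "set_var x v s \<equiv> s\<lparr>vars := (vars s)(x := v)\<rparr>"

abbreviation set_arr :: "vname \<Rightarrow> nat \<Rightarrow> nat \<Rightarrow> 'a state \<Rightarrow> 'a state" where
  "set_arr a i v s \<equiv> s\<lparr>arrs := (arrs s)(a := (arrs s a)(i := v))\<rparr>"

abbreviation new_set :: "vname \<Rightarrow> 'a set \<Rightarrow> 'a state \<Rightarrow> 'a state" where
  "new_set x A s \<equiv>
     s\<lparr>vars := (vars s)(x := length (created s)), created := created s @ [A]\<rparr>"

abbreviation digits :: "nat \<Rightarrow> nat" where
  "digits v \<equiv> floorlog 2 v"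

primrec aval :: "aexp \<Rightarrow> 'a state \<Rightarrow> nat" where
  "aval (Const k) s = k"
| "aval (Var x) s = vars s x"
| "aval (Arr a e) s = arrs s a (aval e s)"
| "aval (Add e f) s = aval e s + aval f s"
| "aval (Sub e f) s = aval e s - aval f s"
| "aval (Mul e f) s = aval e s * aval f s"
| "aval (Div e f) s = aval e s div aval f s"
| "aval (Less e f) s = (if aval e s < aval f s then 1 else 0)"

primrec acost :: "aexp \<Rightarrow> 'a state \<Rightarrow> nat" where
  "acost (Const k) s = 1 + digits (aval (Const k) s)"
| "acost (Var x) s = 1 + digits (aval (Var x) s)"
| "acost (Arr a e) s = 1 + digits (aval (Arr a e) s) + acost e s"
| "acost (Add e f) s = 1 + digits (aval (Add e f) s) + acost e s + acost f s"
| "acost (Sub e f) s = 1 + digits (aval (Sub e f) s) + acost e s + acost f s"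
| "acost (Mul e f) s = 1 + digits (aval (Mul e f) s) + acost e s + acost f s"
| "acost (Div e f) s = 1 + digits (aval (Div e f) s) + acost e s + acost f s"
| "acost (Less e f) s = 1 + digits (aval (Less e f) s) + acost e s + acost f s"

text \<open>
  \<open>exec n el rk w c s t s'\<close>: started in \<open>s\<close>, the program \<open>c\<close> terminates in \<open>s'\<close> at cost \<open>t\<close>.
  Executions that use a handle of a set that was never created, or a number \<open>\<ge> n\<close> as an element,
  get stuck.
\<close>

inductive exec ::
    "nat \<Rightarrow> (nat \<Rightarrow> 'a) \<Rightarrow> ('a set \<Rightarrow> nat) \<Rightarrow> ('a \<Rightarrow> real) \<Rightarrow>
     com \<Rightarrow> 'a state \<Rightarrow> nat \<Rightarrow> 'a state \<Rightarrow> bool"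
  for n :: nat and el :: "nat \<Rightarrow> 'a" and rk :: "'a set \<Rightarrow> nat" and w :: "'a \<Rightarrow> real"
where
  Skip: "exec n el rk w Skip s 1 s"
| Assign: "exec n el rk w (Assign x e) s (1 + acost e s) (set_var x (aval e s) s)"
| Store: "exec n el rk w (Store a e f) s (1 + acost e s + acost f s)
            (set_arr a (aval e s) (aval f s) s)"
| Seq: "exec n el rk w c s t s' \<Longrightarrow> exec n el rk w d s' t' s'' \<Longrightarrow>
        exec n el rk w (Seq c d) s (t + t') s''"
| CondTrue: "aval b s \<noteq> 0 \<Longrightarrow> exec n el rk w c s t s' \<Longrightarrow>
        exec n el rk w (Cond b c d) s (1 + acost b s + t) s'"
| CondFalse: "aval b s = 0 \<Longrightarrow> exec n el rk w d s t s' \<Longrightarrow>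
        exec n el rk w (Cond b c d) s (1 + acost b s + t) s'"
| WhileFalse: "aval b s = 0 \<Longrightarrow> exec n el rk w (While b c) s (1 + acost b s) s"
| WhileTrue: "aval b s \<noteq> 0 \<Longrightarrow> exec n el rk w c s t s' \<Longrightarrow>
        exec n el rk w (While b c) s' t' s'' \<Longrightarrow>
        exec n el rk w (While b c) s (1 + acost b s + t + t') s''"
| Insert: "aval h s < length (created s) \<Longrightarrow> aval e s < n \<Longrightarrow>
        exec n el rk w (Insert x h e) s
          (1 + acost h s + acost e s + digits (length (created s)))
          (new_set x (insert (el (aval e s)) (created s ! aval h s)) s)"
| Remove: "aval h s < length (created s) \<Longrightarrow> aval e s < n \<Longrightarrow>
        exec n el rk w (Remove x h e) s
          (1 + acost h s + acost e s + digits (length (created s)))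
          (new_set x (created s ! aval h s - {el (aval e s)}) s)"
| Rank: "aval h s < length (created s) \<Longrightarrow>
        exec n el rk w (Rank x h) s
          (1 + acost h s + digits (rk (created s ! aval h s)))
          (set_var x (rk (created s ! aval h s)) s)"
| Lighter: "aval e s < n \<Longrightarrow> aval f s < n \<Longrightarrow>
        exec n el rk w (Lighter x e f) s (1 + acost e s + acost f s)
          (set_var x (if w (el (aval e s)) < w (el (aval f s)) then 1 else 0) s)"

inductive_cases exec_SkipE: "exec n el rk w Skip s t s'"
inductive_cases exec_AssignE: "exec n el rk w (Assign x e) s t s'"
inductive_cases exec_StoreE: "exec n el rk w (Store a e f) s t s'"
inductive_cases exec_SeqE: "exec n el rk w (Seq c d) s t s'"
inductive_cases exec_CondE: "exec n el rk w (Cond b c d) s t s'"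
inductive_cases exec_WhileE: "exec n el rk w (While b c) s t s'"
inductive_cases exec_InsertE: "exec n el rk w (Insert x h e) s t s'"
inductive_cases exec_RemoveE: "exec n el rk w (Remove x h e) s t s'"
inductive_cases exec_RankE: "exec n el rk w (Rank x h) s t s'"
inductive_cases exec_LighterE: "exec n el rk w (Lighter x e f) s t s'"

lemma exec_deterministic:
  "exec n el rk w c s t s' \<Longrightarrow> exec n el rk w c s u s'' \<Longrightarrow> u = t \<and> s'' = s'"
proof (induction arbitrary: u s'' rule: exec.induct)
  case Skip
  then show ?case by (elim exec_SkipE) simp
next
  case Assign
  then show ?case by (elim exec_AssignE) simp
next
  case Store
  then show ?case by (elim exec_StoreE) simp
next
  case (Seq c s t s1 d t' s2)
  from Seq.prems obtain t1 m t2
    where u: "u = t1 + t2" and c: "exec n el rk w c s t1 m" and d: "exec n el rk w d m t2 s''"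
    by (rule exec_SeqE)
  from Seq.IH(1)[OF c] have "t1 = t" "m = s1" by simp_all
  with Seq.IH(2) d u show ?case by simp
next
  case (CondTrue b s c t s1 d)
  from CondTrue.prems obtain t1
    where u: "u = 1 + acost b s + t1" and c: "exec n el rk w c s t1 s''"
    by (rule exec_CondE) (use CondTrue.hyps(1) in simp_all)
  from CondTrue.IH[OF c] u show ?case by simp
next
  case (CondFalse b s d t s1 c)
  from CondFalse.prems obtain t1
    where u: "u = 1 + acost b s + t1" and c: "exec n el rk w d s t1 s''"
    by (rule exec_CondE) (use CondFalse.hyps(1) in simp_all)
  from CondFalse.IH[OF c] u show ?case by simp
next
  case (WhileFalse b s c)
  from WhileFalse.prems show ?case by (rule exec_WhileE) (use WhileFalse.hyps in simp_all)
next
  case (WhileTrue b s c t s1 t' s2)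
  from WhileTrue.prems obtain t1 m t2
    where u: "u = 1 + acost b s + t1 + t2" and c: "exec n el rk w c s t1 m"
      and d: "exec n el rk w (While b c) m t2 s''"
    by (rule exec_WhileE) (use WhileTrue.hyps(1) in simp_all)
  from WhileTrue.IH(1)[OF c] have "t1 = t" "m = s1" by simp_all
  with WhileTrue.IH(2) d u show ?case by simp
next
  case Insert
  from Insert.prems show ?case by (rule exec_InsertE) simp
next
  case Remove
  from Remove.prems show ?case by (rule exec_RemoveE) simp
next
  case Rank
  from Rank.prems show ?case by (rule exec_RankE) simp
next
  case Lighter
  from Lighter.prems show ?case by (rule exec_LighterE) simp
qed

text \<open>
  Calling convention. The numbers of the elements of the given set are passed in some order in the
  array \<open>''in''\<close>; only the empty set has been created.
\<close>

definition initial_state :: "nat \<Rightarrow> nat list \<Rightarrow> 'a state" where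
  "initial_state n xs =
     \<lparr>vars = (\<lambda>_. 0)(''n'' := n, ''len'' := length xs),
      arrs = (\<lambda>_ _. 0)(''in'' := (\<lambda>i. if i < length xs then xs ! i else 0)),
      created = [{}]\<rparr>"

text \<open>
  The current basis is kept as a list without repetitions in the array \<open>''basis''\<close>, its length in
  \<open>''size''\<close>. A deletion has no time to write out a whole basis, so it returns the new basis by
  updating this list in place.
\<close>

definition holds_basis :: "nat \<Rightarrow> (nat \<Rightarrow> 'a) \<Rightarrow> 'a state \<Rightarrow> 'a set \<Rightarrow> bool" where
  "holds_basis n el s B \<longleftrightarrow>
     (let xs = map (arrs s ''basis'') [0..<vars s ''size'']
      in distinct xs \<and> set xs \<subseteq> {..<n} \<and> B = el ` set xs)"

text \<open>
  \<open>reachable n el rk w ini del xs X s\<close>: the call of \<open>ini\<close> on the elements numbered \<open>xs\<close>, followed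
  by some sequence of calls of \<open>del\<close>, each on an element of the current set, has led to the
  machine state \<open>s\<close> and the current set \<open>X\<close>. The element to be deleted is passed in \<open>''arg''\<close>.
\<close>

inductive reachable ::
    "nat \<Rightarrow> (nat \<Rightarrow> 'a) \<Rightarrow> ('a set \<Rightarrow> nat) \<Rightarrow> ('a \<Rightarrow> real) \<Rightarrow> com \<Rightarrow> com \<Rightarrow> nat list \<Rightarrow>
     'a set \<Rightarrow> 'a state \<Rightarrow> bool"
  for n el rk w ini del xs
where
  initialized: "exec n el rk w ini (initial_state n xs) t s \<Longrightarrow>
      reachable n el rk w ini del xs (el ` set xs) s"
| deleted: "reachable n el rk w ini del xs X s \<Longrightarrow> i < n \<Longrightarrow> el i \<in> X \<Longrightarrow>
      exec n el rk w del (set_var ''arg'' i s) t s' \<Longrightarrow>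
      reachable n el rk w ini del xs (X - {el i}) s'"

text \<open>
  The element returned by a deletion: \<open>''ret''\<close> is \<open>0\<close> for ``none'' and \<open>i + 1\<close> for the element
  numbered \<open>i\<close>.
\<close>

definition returned :: "nat \<Rightarrow> (nat \<Rightarrow> 'a) \<Rightarrow> 'a state \<Rightarrow> 'a option \<Rightarrow> bool" where
  "returned n el s y \<longleftrightarrow>
     (case y of None \<Rightarrow> vars s ''ret'' = 0
      | Some z \<Rightarrow> \<exists>i<n. vars s ''ret'' = i + 1 \<and> z = el i)"

end

theory Submission
  imports Defs
begin

text \<open>
  The numbers below \<open>n\<close> are the leaves of a balanced binary tree. Since the greedy basis of a union is
  the greedy basis of the union of the two greedy bases, every inner node only has to know the list
  \<open>L\<close> of the at most \<open>2 r\<close> elements in the greedy bases of its children, sorted by weight. It also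
  keeps, for every multiple \<open>b K\<close> of some \<open>K\<close> close to the square root of \<open>r\<close>, the prefix of length
  \<open>b K\<close> of \<open>L\<close> as a created set.

  When \<open>x\<close> is deleted, the nodes above its leaf are visited from the bottom to the top. In each of
  them \<open>x\<close> disappears from \<open>L\<close> and its replacement \<open>y\<close> from the child, if any, is inserted. As \<open>y\<close> is
  heavier than \<open>x\<close>, a prefix at a multiple of \<open>K\<close> changes by at most one insertion and one deletion.
  The replacement of \<open>x\<close> at the node is the last element of the shortest prefix of the new list that
  spans \<open>x\<close>: the stored prefixes locate it up to \<open>K\<close> candidates, which are then tried one by one.
  If that element is lighter than \<open>x\<close>, then \<open>x\<close> was not in the basis of the node, and nothing changes
  further up.
\<close>

section \<open>Cost of programs\<close>

text \<open>Replacing the set of a node by the two greedy bases of its children loses nothing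
  relevant: the span of every weight prefix survives, not only the total span. Hence prefixes of
  \<open>L\<close> may stand for prefixes of the whole set when a replacement is sought. Created
  sets are immutable, so a stored prefix is updated by at most two set operations on its old handle,
  and older handles stay valid. If the rank of the initial set is at most \<open>K * K\<close>, a
  node needs at most \<open>2 * K\<close> marks, while a block has \<open>K\<close> entries; this
  balance fixes \<open>K\<close>. Lists never grow, so the marks allocated at the start suffice for
  ever. The remaining obstacle is the logarithmic cost measure: handles become longer with every
  created set. As an element can be deleted only once, polynomially many sets are created over the
  whole lifetime, and a handle keeps logarithmically many digits. Of the two logarithms in the final
  bounds one is the depth of the tree and the other the length of the numbers.\<close>

primrec expr_digits :: "aexp \<Rightarrow> nat" where
  "expr_digits (Const k) = k"
| "expr_digits (Var x) = 1"
| "expr_digits (Arr a e) = 1"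
| "expr_digits (Add e f) = expr_digits e + expr_digits f + 1"
| "expr_digits (Sub e f) = expr_digits e"
| "expr_digits (Mul e f) = expr_digits e + expr_digits f"
| "expr_digits (Div e f) = expr_digits e"
| "expr_digits (Less e f) = 1"

text \<open>A coefficient of \<open>unit_cost\<close>, see \<open>acost_le\<close>. Constants are
  charged by their value instead of their length; the programs contain only 0, 1 and 2.\<close>

primrec expr_cost :: "aexp \<Rightarrow> nat" where
  "expr_cost (Const k) = 1 + expr_digits (Const k)"
| "expr_cost (Var x) = 1 + expr_digits (Var x)"
| "expr_cost (Arr a e) = 1 + expr_digits (Arr a e) + expr_cost e"
| "expr_cost (Add e f) = 1 + expr_digits (Add e f) + expr_cost e + expr_cost f"
| "expr_cost (Sub e f) = 1 + expr_digits (Sub e f) + expr_cost e + expr_cost f"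
| "expr_cost (Mul e f) = 1 + expr_digits (Mul e f) + expr_cost e + expr_cost f"
| "expr_cost (Div e f) = 1 + expr_digits (Div e f) + expr_cost e + expr_cost f"
| "expr_cost (Less e f) = 1 + expr_digits (Less e f) + expr_cost e + expr_cost f"

text \<open>Independent of the state, so both branches of a conditional are charged. The 0 for loops
  is a placeholder: \<open>wpl\<close> excludes them, and \<open>wpc_while\<close> supplies their
  cost.\<close>

primrec com_cost :: "com \<Rightarrow> nat" where
  "com_cost Skip = 1"
| "com_cost (Assign x e) = 1 + expr_cost e"
| "com_cost (Store a e f) = 1 + expr_cost e + expr_cost f"
| "com_cost (Seq c d) = com_cost c + com_cost d"
| "com_cost (Cond b c d) = 1 + expr_cost b + com_cost c + com_cost d"
| "com_cost (While b c) = 0"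
| "com_cost (Insert x h e) = 2 + expr_cost h + expr_cost e"
| "com_cost (Remove x h e) = 2 + expr_cost h + expr_cost e"
| "com_cost (Rank x h) = 2 + expr_cost h"
| "com_cost (Lighter x e f) = 1 + expr_cost e + expr_cost f"

lemma digits_mono: "a \<le> b \<Longrightarrow> digits a \<le> digits b"
  by (simp add: floorlog_mono)

lemma digits_le_self: "digits k \<le> k"
proof (cases "k = 0")
  case False
  have "k < 2 ^ k" by (rule less_exp)
  then show ?thesis
    by (simp add: floorlog_le_iff)
qed (simp add: floorlog_def)

lemma digits_bound: "x < 2 ^ digits x"
  using floorlog_bounds[of x 2] by (cases "x = 0") auto

lemma digits_leI: "x < 2 ^ k \<Longrightarrow> digits x \<le> k"
  by (simp add: floorlog_le_iff)

lemma digits_mult: "digits (a * b) \<le> digits a + digits b"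
proof (rule digits_leI)
  show "a * b < 2 ^ (digits a + digits b)"
    unfolding power_add by (rule mult_strict_mono') (simp_all add: digits_bound)
qed

lemma digits_add: "digits (a + b) \<le> digits a + digits b + 1"
proof (rule digits_leI)
  have "a + b < 2 ^ (digits a + digits b) + 2 ^ (digits a + digits b)"
    by (intro add_strict_mono less_le_trans[OF digits_bound] power_increasing) auto
  then show "a + b < 2 ^ (digits a + digits b + 1)" by simp
qed

text \<open>Expressions whose value never exceeds the values stored in the state, if these are allowed to be \<open>2\<close>.\<close>
primrec nonincreasing :: "aexp \<Rightarrow> bool" where
  "nonincreasing (Const k) = (k \<le> 2)"
| "nonincreasing (Var x) = True"
| "nonincreasing (Arr a e) = True"
| "nonincreasing (Add e f) = False"
| "nonincreasing (Sub e f) = nonincreasing e"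
| "nonincreasing (Mul e f) = False"
| "nonincreasing (Div e f) = nonincreasing e"
| "nonincreasing (Less e f) = True"

section \<open>Weakest preconditions with cost\<close>

locale machine =
  fixes n :: nat and el :: "nat \<Rightarrow> 'a" and rk :: "'a set \<Rightarrow> nat" and w :: "'a \<Rightarrow> real" and V :: nat
  assumes V2: "2 \<le> V" and rk_le_V: "rk A \<le> V"
begin

text \<open>\<open>V\<close> covers codes, ranks and array positions; the second summand covers
  handles, which are positions in \<open>created\<close>.\<close>

definition vmax :: "'a state \<Rightarrow> nat" where
  "vmax s = V + length (created s)"

definition bnd :: "'a state \<Rightarrow> bool" where
  "bnd s \<longleftrightarrow> (\<forall>x. vars s x \<le> vmax s) \<and> (\<forall>a i. arrs s a i \<le> vmax s)"

definition unit_cost :: "'a state \<Rightarrow> nat" where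
  "unit_cost s = 1 + digits (vmax s)"

lemma unit_cost_pos: "1 \<le> unit_cost s"
  by (simp add: unit_cost_def)

lemma unit_cost_mono: "length (created s) \<le> length (created s') \<Longrightarrow> unit_cost s \<le> unit_cost s'"
  unfolding unit_cost_def vmax_def by (intro add_left_mono digits_mono) simp

text \<open>
  The cost is counted in units of the number of digits of the largest value that can occur. The
  maximum is taken relative to the number of created sets at the end, so that handles are bounded
  without knowing in advance how many sets are created.
\<close>
definition wpc :: "com \<Rightarrow> nat \<Rightarrow> ('a state \<Rightarrow> bool) \<Rightarrow> 'a state \<Rightarrow> bool" where
  "wpc c N Q s \<longleftrightarrow> (bnd s \<longrightarrow>
     (\<exists>t s' ys. exec n el rk w c s t s' \<and> t \<le> N * unit_cost s' \<and>
        created s' = created s @ ys \<and> length ys \<le> N \<and> bnd s' \<and> Q s'))"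

text \<open>A cost-free precondition for loop-free code that the simplifier can unfold;
  \<open>wpc_wpl\<close> adds the cost afterwards. The side conditions keep stored values below
  \<open>vmax\<close> and disappear by computation for \<open>nonincreasing\<close>
  expressions.\<close>

primrec wpl :: "com \<Rightarrow> ('a state \<Rightarrow> bool) \<Rightarrow> 'a state \<Rightarrow> bool" where
  "wpl Skip Q s = Q s"
| "wpl (Assign x e) Q s =
     ((nonincreasing e \<or> aval e s \<le> vmax s) \<and> Q (set_var x (aval e s) s))"
| "wpl (Store a e f) Q s =
     ((nonincreasing f \<or> aval f s \<le> vmax s) \<and> Q (set_arr a (aval e s) (aval f s) s))"
| "wpl (Seq c d) Q s = wpl c (wpl d Q) s"
| "wpl (Cond b c d) Q s = (if aval b s = 0 then wpl d Q s else wpl c Q s)"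
| "wpl (While b c) Q s = False"
| "wpl (Insert x h e) Q s = (aval h s < length (created s) \<and> aval e s < n \<and>
     Q (new_set x (insert (el (aval e s)) (created s ! aval h s)) s))"
| "wpl (Remove x h e) Q s = (aval h s < length (created s) \<and> aval e s < n \<and>
     Q (new_set x (created s ! aval h s - {el (aval e s)}) s))"
| "wpl (Rank x h) Q s = (aval h s < length (created s) \<and>
     Q (set_var x (rk (created s ! aval h s)) s))"
| "wpl (Lighter x e f) Q s = (aval e s < n \<and> aval f s < n \<and>
     Q (set_var x (if w (el (aval e s)) < w (el (aval f s)) then 1 else 0) s))"

lemma wpl_mono: "wpl c Q s \<Longrightarrow> (\<And>s. Q s \<Longrightarrow> Q' s) \<Longrightarrow> wpl c Q' s"
proof (induction c arbitrary: Q Q' s)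
  case (Seq c d)
  from Seq.prems(1) have "wpl c (wpl d Q) s" by simp
  then have "wpl c (wpl d Q') s"
    by (rule Seq.IH(1)) (rule Seq.IH(2)[OF _ Seq.prems(2)])
  then show ?case by simp
qed (auto split: if_splits)

lemma nonincreasing_le: "nonincreasing e \<Longrightarrow> bnd s \<Longrightarrow> aval e s \<le> vmax s"
proof (induction e)
  case (Const x)
  then show ?case using V2 by (simp add: vmax_def)
next
  case (Less e f)
  then show ?case using V2 by (simp add: vmax_def)
next
  case (Sub e f)
  then show ?case by (simp add: le_diff_conv trans_le_add1)
next
  case (Div e f)
  then have "aval e s \<le> vmax s" by simp
  then show ?case using div_le_dividend[of "aval e s" "aval f s"] by (simp del: div_le_dividend)
qed (auto simp: bnd_def)

text \<open>Only stored values are bounded by \<open>vmax\<close>; intermediate results, for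
  instance products, may exceed it. But an operation at most adds up the lengths of its operands and
  one digit, so a fixed expression stays within a constant number of units.\<close>

lemma digits_aval:
  assumes "bnd s" shows "digits (aval e s) \<le> expr_digits e * unit_cost s"
proof (induction e)
  case (Const k)
  have "digits k \<le> k * 1" using digits_le_self by simp
  also have "\<dots> \<le> k * unit_cost s" by (rule mult_le_mono2) (rule unit_cost_pos)
  finally show ?case by simp
next
  case (Var x)
  have "digits (vars s x) \<le> digits (vmax s)" using assms by (intro digits_mono) (simp add: bnd_def)
  then show ?case by (simp add: unit_cost_def)
next
  case (Arr a e)
  have "digits (arrs s a (aval e s)) \<le> digits (vmax s)"
    using assms by (intro digits_mono) (simp add: bnd_def)
  then show ?case by (simp add: unit_cost_def)
next
  case (Add e f)
  have "digits (aval e s + aval f s) \<le> digits (aval e s) + digits (aval f s) + 1"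
    by (rule digits_add)
  with Add show ?case by (simp add: algebra_simps unit_cost_def)
next
  case (Sub e f)
  have "digits (aval e s - aval f s) \<le> digits (aval e s)" by (rule digits_mono) simp
  with Sub show ?case by simp
next
  case (Mul e f)
  have "digits (aval e s * aval f s) \<le> digits (aval e s) + digits (aval f s)"
    by (rule digits_mult)
  with Mul show ?case by (simp add: algebra_simps unit_cost_def)
next
  case (Div e f)
  have "digits (aval e s div aval f s) \<le> digits (aval e s)" by (rule digits_mono) simp
  with Div show ?case by simp
next
  case (Less e f)
  have "digits (if aval e s < aval f s then 1 else 0) \<le> 1"
    by (rule digits_leI) simp
  then show ?case by (simp add: unit_cost_def)
qed

lemma acost_le:
  assumes "bnd s" shows "acost e s \<le> expr_cost e * unit_cost s"
proof (induction e)
  case (Const k)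
  show ?case using digits_aval[OF assms, of "Const k"] unit_cost_pos[of s] by simp
next
  case (Var x)
  show ?case using digits_aval[OF assms, of "Var x"] unit_cost_pos[of s] by simp
next
  case (Arr a e)
  with digits_aval[OF assms, of "Arr a e"] show ?case using unit_cost_pos[of s] by (simp add: algebra_simps)
next
  case (Add e f)
  with digits_aval[OF assms, of "Add e f"] show ?case using unit_cost_pos[of s] by (simp add: algebra_simps)
next
  case (Sub e f)
  with digits_aval[OF assms, of "Sub e f"] show ?case using unit_cost_pos[of s] by (simp add: algebra_simps)
next
  case (Mul e f)
  with digits_aval[OF assms, of "Mul e f"] show ?case using unit_cost_pos[of s] by (simp add: algebra_simps)
next
  case (Div e f)
  with digits_aval[OF assms, of "Div e f"] show ?case using unit_cost_pos[of s] by (simp add: algebra_simps)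
next
  case (Less e f)
  with digits_aval[OF assms, of "Less e f"] show ?case using unit_cost_pos[of s] by (simp add: algebra_simps)
qed

lemma wpc_weaken:
  assumes "wpc c N Q s" "N \<le> N'" "\<And>s'. Q s' \<Longrightarrow> Q' s'"
  shows "wpc c N' Q' s"
  unfolding wpc_def
proof
  assume "bnd s"
  with assms(1) obtain t s' ys where
    e: "exec n el rk w c s t s'" and t: "t \<le> N * unit_cost s'"
    and r: "created s' = created s @ ys" "length ys \<le> N" "bnd s'" "Q s'"
    unfolding wpc_def by blast
  have "t \<le> N' * unit_cost s'"
    using t mult_le_mono1[OF assms(2), of "unit_cost s'"] by linarith
  then show "\<exists>t s' ys. exec n el rk w c s t s' \<and> t \<le> N' * unit_cost s' \<and>
        created s' = created s @ ys \<and> length ys \<le> N' \<and> bnd s' \<and> Q' s'"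
    using e r assms by (intro exI[of _ t] exI[of _ s'] exI[of _ ys]) auto
qed

lemma wpc_seq:
  assumes "wpc c N1 (wpc d N2 Q) s" shows "wpc (Seq c d) (N1 + N2) Q s"
  unfolding wpc_def
proof
  assume "bnd s"
  with assms obtain t s' ys where
    e: "exec n el rk w c s t s'" and t: "t \<le> N1 * unit_cost s'"
    and r: "created s' = created s @ ys" "length ys \<le> N1" "bnd s'" and wd: "wpc d N2 Q s'"
    unfolding wpc_def by blast
  from wd r obtain t' s'' ys' where
    e': "exec n el rk w d s' t' s''" and t': "t' \<le> N2 * unit_cost s''"
    and r': "created s'' = created s' @ ys'" "length ys' \<le> N2" "bnd s''" "Q s''"
    unfolding wpc_def by blast
  \<comment> \<open>The first program is charged in units of the intermediate state. They are at
    most the final units because \<open>created\<close> only grows.\<close>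
  have "N1 * unit_cost s' \<le> N1 * unit_cost s''"
    by (intro mult_le_mono2 unit_cost_mono) (simp add: r')
  then have "t + t' \<le> (N1 + N2) * unit_cost s''"
    using t t' unfolding add_mult_distrib by linarith
  then show "\<exists>t s' ys. exec n el rk w (Seq c d) s t s' \<and> t \<le> (N1 + N2) * unit_cost s' \<and>
        created s' = created s @ ys \<and> length ys \<le> N1 + N2 \<and> bnd s' \<and> Q s'"
    using exec.Seq[OF e e'] r r'
    by (intro exI[of _ "t + t'"] exI[of _ s''] exI[of _ "ys @ ys'"]) auto
qed

lemma wpc_seqI:
  assumes "wpc c N1 P s" "\<And>s'. P s' \<Longrightarrow> wpc d N2 Q s'" "N1 + N2 \<le> N"
  shows "wpc (Seq c d) N Q s"
  using wpc_weaken[OF wpc_seq[OF wpc_weaken[OF assms(1) order_refl assms(2)]] assms(3)] by blast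

lemma wpc_cond:
  assumes "aval b s \<noteq> 0 \<Longrightarrow> wpc c N Q s" "aval b s = 0 \<Longrightarrow> wpc d N Q s"
  shows "wpc (Cond b c d) (1 + expr_cost b + N) Q s"
  unfolding wpc_def
proof
  assume b: "bnd s"
  define c' where "c' = (if aval b s = 0 then d else c)"
  have "wpc c' N Q s" using assms by (simp add: c'_def)
  with b obtain t s' ys where
    e: "exec n el rk w c' s t s'" and t: "t \<le> N * unit_cost s'"
    and r: "created s' = created s @ ys" "length ys \<le> N" "bnd s'" "Q s'"
    unfolding wpc_def by blast
  have e': "exec n el rk w (Cond b c d) s (1 + acost b s + t) s'"
    using e CondTrue[of b s n el rk w c t s' d] CondFalse[of b s n el rk w d t s' c]
    by (auto simp: c'_def split: if_splits)
  have "expr_cost b * unit_cost s \<le> expr_cost b * unit_cost s'"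
    by (intro mult_le_mono2 unit_cost_mono) (simp add: r)
  with acost_le[OF b, of b] t unit_cost_pos[of s']
  have "1 + acost b s + t \<le> (1 + expr_cost b + N) * unit_cost s'"
    unfolding add_mult_distrib by linarith
  then show "\<exists>t s' ys. exec n el rk w (Cond b c d) s t s' \<and>
        t \<le> (1 + expr_cost b + N) * unit_cost s' \<and>
        created s' = created s @ ys \<and> length ys \<le> 1 + expr_cost b + N \<and> bnd s' \<and> Q s'"
    using e' r by (intro exI[of _ "1 + acost b s + t"] exI[of _ s'] exI[of _ ys]) auto
qed

lemma wpc_condI:
  assumes "aval b s \<noteq> 0 \<Longrightarrow> wpc c N Q s" "aval b s = 0 \<Longrightarrow> wpc d N Q s" "1 + expr_cost b + N \<le> N'"
  shows "wpc (Cond b c d) N' Q s"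
  using wpc_weaken[OF wpc_cond[OF assms(1,2)] assms(3)] by blast

lemma wpc_wpl: "wpl c Q s \<Longrightarrow> wpc c (com_cost c) Q s"
proof (induction c arbitrary: Q s)
  case Skip
  then show ?case
    unfolding wpc_def using exec.Skip[of n el rk w s] unit_cost_pos[of s]
    by (intro impI exI[of _ "1::nat"] exI[of _ s] exI[of _ "[]"]) auto
next
  case (Assign x e)
  show ?case unfolding wpc_def
  proof
    assume b: "bnd s"
    let ?s = "set_var x (aval e s) s"
    have "bnd ?s" using b Assign nonincreasing_le[OF _ b, of e] by (auto simp: bnd_def vmax_def)
    then show "\<exists>t s' ys. exec n el rk w (Assign x e) s t s' \<and>
      t \<le> com_cost (Assign x e) * unit_cost s' \<and>
      created s' = created s @ ys \<and> length ys \<le> com_cost (Assign x e) \<and> bnd s' \<and> Q s'"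
      using exec.Assign[of n el rk w x e s] acost_le[OF b, of e] Assign unit_cost_pos[of s]
      by (intro exI[of _ "1 + acost e s"] exI[of _ ?s] exI[of _ "[]"]) (auto simp: vmax_def unit_cost_def)
  qed
next
  case (Store a e f)
  show ?case unfolding wpc_def
  proof
    assume b: "bnd s"
    let ?s = "set_arr a (aval e s) (aval f s) s"
    have "bnd ?s" using b Store nonincreasing_le[OF _ b, of f] by (auto simp: bnd_def vmax_def)
    then show "\<exists>t s' ys. exec n el rk w (Store a e f) s t s' \<and>
      t \<le> com_cost (Store a e f) * unit_cost s' \<and>
      created s' = created s @ ys \<and> length ys \<le> com_cost (Store a e f) \<and> bnd s' \<and> Q s'"
      using exec.Store[of n el rk w a e f s] acost_le[OF b, of e] acost_le[OF b, of f] Store unit_cost_pos[of s]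
      by (intro exI[of _ "1 + acost e s + acost f s"] exI[of _ ?s] exI[of _ "[]"])
        (auto simp: vmax_def unit_cost_def algebra_simps)
  qed
next
  case (Seq c d)
  then have "wpl c (wpl d Q) s" by simp
  then have "wpl c (wpc d (com_cost d) Q) s" by (rule wpl_mono) (rule Seq.IH(2))
  from wpc_seq[OF Seq.IH(1)[OF this]] show ?case by simp
next
  case (Cond b c d)
  have "wpc (Cond b c d) (1 + expr_cost b + (com_cost c + com_cost d)) Q s"
    by (rule wpc_cond; rule wpc_weaken[OF _ _ _])
      (use Cond in \<open>auto intro: Cond.IH\<close>)
  then show ?case by (simp add: algebra_simps)
next
  case (While b c)
  then show ?case by simp
next
  case (Insert x h e)
  show ?case unfolding wpc_def
  proof
    assume b: "bnd s"
    let ?s = "new_set x (insert (el (aval e s)) (created s ! aval h s)) s"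
    \<comment> \<open>The new handle is the old length of \<open>created\<close>, and
      \<open>vmax\<close> has just grown by one.\<close>
    have bs: "bnd ?s" using b by (auto simp: bnd_def vmax_def intro: le_SucI trans_le_add2)
    have "digits (length (created s)) \<le> digits (vmax ?s)"
      by (auto intro!: digits_mono simp: vmax_def)
    then have "1 + digits (length (created s)) \<le> unit_cost ?s" by (simp add: unit_cost_def)
    moreover have "expr_cost h * unit_cost s \<le> expr_cost h * unit_cost ?s"
      "expr_cost e * unit_cost s \<le> expr_cost e * unit_cost ?s"
      by (intro mult_le_mono2 unit_cost_mono; simp)+
    ultimately have "1 + acost h s + acost e s + digits (length (created s)) \<le>
        com_cost (Insert x h e) * unit_cost ?s"
      using acost_le[OF b, of h] acost_le[OF b, of e] unfolding com_cost.simps add_mult_distrib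
      by linarith
    then show "\<exists>t s' ys. exec n el rk w (Insert x h e) s t s' \<and>
      t \<le> com_cost (Insert x h e) * unit_cost s' \<and>
      created s' = created s @ ys \<and> length ys \<le> com_cost (Insert x h e) \<and> bnd s' \<and> Q s'"
      using exec.Insert[of h s e n el rk w x] Insert bs
      by (intro exI[of _ "1 + acost h s + acost e s + digits (length (created s))"]
          exI[of _ ?s] exI[of _ "[insert (el (aval e s)) (created s ! aval h s)]"]) auto
  qed
next
  case (Remove x h e)
  show ?case unfolding wpc_def
  proof
    assume b: "bnd s"
    let ?s = "new_set x (created s ! aval h s - {el (aval e s)}) s"
    have bs: "bnd ?s" using b by (auto simp: bnd_def vmax_def intro: le_SucI trans_le_add2)
    have "digits (length (created s)) \<le> digits (vmax ?s)"
      by (auto intro!: digits_mono simp: vmax_def)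
    then have "1 + digits (length (created s)) \<le> unit_cost ?s" by (simp add: unit_cost_def)
    moreover have "expr_cost h * unit_cost s \<le> expr_cost h * unit_cost ?s"
      "expr_cost e * unit_cost s \<le> expr_cost e * unit_cost ?s"
      by (intro mult_le_mono2 unit_cost_mono; simp)+
    ultimately have "1 + acost h s + acost e s + digits (length (created s)) \<le>
        com_cost (Remove x h e) * unit_cost ?s"
      using acost_le[OF b, of h] acost_le[OF b, of e] unfolding com_cost.simps add_mult_distrib
      by linarith
    then show "\<exists>t s' ys. exec n el rk w (Remove x h e) s t s' \<and>
      t \<le> com_cost (Remove x h e) * unit_cost s' \<and>
      created s' = created s @ ys \<and> length ys \<le> com_cost (Remove x h e) \<and> bnd s' \<and> Q s'"
      using exec.Remove[of h s e n el rk w x] Remove bs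
      by (intro exI[of _ "1 + acost h s + acost e s + digits (length (created s))"]
          exI[of _ ?s] exI[of _ "[created s ! aval h s - {el (aval e s)}]"]) auto
  qed
next
  case (Rank x h)
  show ?case unfolding wpc_def
  proof
    assume b: "bnd s"
    let ?s = "set_var x (rk (created s ! aval h s)) s"
    have v: "rk (created s ! aval h s) \<le> vmax s"
      using rk_le_V[of "created s ! aval h s"] by (simp add: vmax_def)
    then have bs: "bnd ?s" using b by (auto simp: bnd_def vmax_def)
    have "1 + acost h s + digits (rk (created s ! aval h s)) \<le>
        com_cost (Rank x h) * unit_cost ?s"
      using acost_le[OF b, of h] digits_mono[OF v] by (simp add: vmax_def unit_cost_def algebra_simps)
    then show "\<exists>t s' ys. exec n el rk w (Rank x h) s t s' \<and>
      t \<le> com_cost (Rank x h) * unit_cost s' \<and>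
      created s' = created s @ ys \<and> length ys \<le> com_cost (Rank x h) \<and> bnd s' \<and> Q s'"
      using exec.Rank[of h s n el rk w x] Rank bs
      by (intro exI[of _ "1 + acost h s + digits (rk (created s ! aval h s))"]
          exI[of _ ?s] exI[of _ "[]"]) auto
  qed
next
  case (Lighter x e f)
  show ?case unfolding wpc_def
  proof
    assume b: "bnd s"
    let ?s = "set_var x (if w (el (aval e s)) < w (el (aval f s)) then 1 else 0) s"
    have "1 \<le> vmax s" using V2 by (simp add: vmax_def)
    then have bs: "bnd ?s" using b by (auto simp: bnd_def vmax_def)
    have "1 + acost e s + acost f s \<le> com_cost (Lighter x e f) * unit_cost ?s"
      using acost_le[OF b, of e] acost_le[OF b, of f] by (simp add: vmax_def unit_cost_def algebra_simps)
    then show "\<exists>t s' ys. exec n el rk w (Lighter x e f) s t s' \<and>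
      t \<le> com_cost (Lighter x e f) * unit_cost s' \<and>
      created s' = created s @ ys \<and> length ys \<le> com_cost (Lighter x e f) \<and> bnd s' \<and> Q s'"
      using exec.Lighter[of e s n f el rk w x] Lighter bs
      by (intro exI[of _ "1 + acost e s + acost f s"] exI[of _ ?s] exI[of _ "[]"]) auto
  qed
qed

lemma wpc_straight: "wpl c Q s \<Longrightarrow> com_cost c \<le> N \<Longrightarrow> wpc c N Q s"
  using wpc_weaken[OF wpc_wpl] by blast

text \<open>The number \<open>m\<close> is a variant that may drop by more than one, hence the
  strong induction. It bounds the remaining iterations, and the failing last test accounts for the
  \<open>+ 1\<close>.\<close>

lemma wpc_while:
  assumes body: "\<And>m s. I m s \<Longrightarrow> aval b s \<noteq> 0 \<Longrightarrow> wpc c N (\<lambda>s'. \<exists>m'<m. I m' s') s"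
    and exit: "\<And>m s. I m s \<Longrightarrow> aval b s = 0 \<Longrightarrow> Q s"
    and inv: "I m s"
  shows "wpc (While b c) ((m + 1) * (N + 1 + expr_cost b)) Q s"
  using inv
proof (induction m arbitrary: s rule: less_induct)
  case (less m)
  show ?case unfolding wpc_def
  proof
    assume bs: "bnd s"
    let ?N = "N + 1 + expr_cost b"
    show "\<exists>t s' ys. exec n el rk w (While b c) s t s' \<and> t \<le> (m + 1) * ?N * unit_cost s' \<and>
        created s' = created s @ ys \<and> length ys \<le> (m + 1) * ?N \<and> bnd s' \<and> Q s'"
    proof (cases "aval b s = 0")
      case True
      have "?N \<le> (m + 1) * ?N" by simp
      then have le: "?N * unit_cost s \<le> (m + 1) * ?N * unit_cost s"
        by (rule mult_le_mono1)
      have "1 + acost b s \<le> ?N * unit_cost s"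
        using acost_le[OF bs, of b] unit_cost_pos[of s] unfolding add_mult_distrib by linarith
      with le have "1 + acost b s \<le> (m + 1) * ?N * unit_cost s" by linarith
      then show ?thesis
        using WhileFalse[OF True, of n el rk w c] bs exit[OF less.prems True]
        by (intro exI[of _ "1 + acost b s"] exI[of _ s] exI[of _ "[]"]) auto
    next
      case False
      from body[OF less.prems False] bs obtain t s' ys m' where
        e: "exec n el rk w c s t s'" and t: "t \<le> N * unit_cost s'"
        and r: "created s' = created s @ ys" "length ys \<le> N" "bnd s'" and m': "m' < m" "I m' s'"
        unfolding wpc_def by blast
      from less.IH[OF m'] r(3) obtain t' s'' ys' where
        e': "exec n el rk w (While b c) s' t' s''"
        and t': "t' \<le> (m' + 1) * ?N * unit_cost s''"
        and r': "created s'' = created s' @ ys'" "length ys' \<le> (m' + 1) * ?N" "bnd s''" "Q s''"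
        unfolding wpc_def by blast
      have d: "expr_cost b * unit_cost s \<le> expr_cost b * unit_cost s''"
        "N * unit_cost s' \<le> N * unit_cost s''"
        by (intro mult_le_mono2 unit_cost_mono; simp add: r r')+
      have mm: "?N + (m' + 1) * ?N \<le> (m + 1) * ?N"
      proof -
        have "(1 + (m' + 1)) * ?N \<le> (m + 1) * ?N" using m' by (intro mult_le_mono1) simp
        then show ?thesis by (simp add: algebra_simps)
      qed
      have "1 + acost b s + t + t' \<le> (?N + (m' + 1) * ?N) * unit_cost s''"
        using acost_le[OF bs, of b] t t' d unit_cost_pos[of s''] unfolding add_mult_distrib by linarith
      also have "\<dots> \<le> (m + 1) * ?N * unit_cost s''"
        using mm by (rule mult_le_mono1)
      finally have tt: "1 + acost b s + t + t' \<le> (m + 1) * ?N * unit_cost s''" .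
      have "length (ys @ ys') \<le> (m + 1) * ?N" using r(2) r'(2) mm by simp
      then show ?thesis
        using WhileTrue[OF False e e'] tt r r'
        by (intro exI[of _ "1 + acost b s + t + t'"] exI[of _ s''] exI[of _ "ys @ ys'"]) auto
    qed
  qed
qed

lemma wpc_whileI:
  assumes "I m s" "\<And>m s. I m s \<Longrightarrow> aval b s \<noteq> 0 \<Longrightarrow> wpc c N (\<lambda>s'. \<exists>m'<m. I m' s') s"
    "\<And>m s. I m s \<Longrightarrow> aval b s = 0 \<Longrightarrow> Q s" "(m + 1) * (N + 1 + expr_cost b) \<le> N'"
  shows "wpc (While b c) N' Q s"
  using wpc_weaken[OF wpc_while[of I b c N Q m s] assms(4)] assms(1-3) by blast

end

section \<open>Greedy bases\<close>

text \<open>These are the local rank axioms of a matroid. A rank function is closer to the oracle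
  than independent sets, and the whole closure theory follows from single-element steps.\<close>

locale ranked =
  fixes G :: "'b set" and r :: "'b set \<Rightarrow> nat" and wt :: "'b \<Rightarrow> real"
  assumes finite_G: "finite G"
    and r_empty: "r {} = 0"
    and r_insert_ge: "Y \<subseteq> G \<Longrightarrow> x \<in> G \<Longrightarrow> r Y \<le> r (insert x Y)"
    and r_insert_le: "Y \<subseteq> G \<Longrightarrow> x \<in> G \<Longrightarrow> r (insert x Y) \<le> r Y + 1"
    and r_local: "Y \<subseteq> G \<Longrightarrow> x \<in> G \<Longrightarrow> y \<in> G \<Longrightarrow> r (insert x Y) = r Y \<Longrightarrow> r (insert y Y) = r Y \<Longrightarrow>
      r (insert x (insert y Y)) = r Y"
    and wt_inj: "inj_on wt G"
begin

definition cl :: "'b set \<Rightarrow> 'b set" where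
  "cl Y = {x \<in> G. r (insert x Y) = r Y}"

definition below :: "'b set \<Rightarrow> 'b \<Rightarrow> 'b set" where
  "below R t = {a \<in> R. wt a < wt t}"

text \<open>The output of the greedy algorithm described without running it: an element is kept iff
  the lighter ones do not span it. Unions and deletions thereby become questions about closures of
  weight prefixes.\<close>

definition greedy :: "'b set \<Rightarrow> 'b set" where
  "greedy R = {a \<in> R. a \<notin> cl (below R a)}"

lemma below_subset: "below R t \<subseteq> R"
  by (auto simp: below_def)

lemma greedy_subset: "greedy R \<subseteq> R"
  by (auto simp: greedy_def)

text \<open>If \<open>y\<close> is spanned as well, \<open>r_local\<close> applies; otherwise
  \<open>y\<close> alone uses up the only possible increase over \<open>r Y\<close>, and nothing is
  left for \<open>x\<close>.\<close>

lemma cl_insert_mono: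
  assumes Y: "Y \<subseteq> G" and y: "y \<in> G" and x: "x \<in> cl Y" shows "x \<in> cl (insert y Y)"
proof -
  from x have xG: "x \<in> G" and rx: "r (insert x Y) = r Y" by (auto simp: cl_def)
  have xy: "insert x (insert y Y) = insert y (insert x Y)" by auto
  have "r (insert x (insert y Y)) = r (insert y Y)"
  proof (cases "r (insert y Y) = r Y")
    case True
    then show ?thesis using r_local[OF Y xG y rx True] by simp
  next
    case False
    then have "r (insert y Y) = r Y + 1" using r_insert_ge[OF Y y] r_insert_le[OF Y y] by simp
    moreover have "r (insert y (insert x Y)) \<le> r Y + 1"
      using r_insert_le[of "insert x Y" y] Y xG y rx by simp
    moreover have "r (insert y Y) \<le> r (insert x (insert y Y))"
      using r_insert_ge[of "insert y Y" x] Y xG y by simp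
    ultimately show ?thesis using xy by simp
  qed
  with xG show ?thesis by (simp add: cl_def)
qed

lemma cl_mono:
  assumes "Y \<subseteq> Z" "Z \<subseteq> G" shows "cl Y \<subseteq> cl Z"
proof -
  have fin: "finite (Z - Y)" using assms finite_G by (meson finite_Diff finite_subset)
  have "cl Y \<subseteq> cl (Y \<union> A)" if "finite A" "A \<subseteq> G" for A
    using that
  proof (induction A rule: finite_induct)
    case (insert a A)
    have "cl (Y \<union> A) \<subseteq> cl (insert a (Y \<union> A))"
      using cl_insert_mono[of "Y \<union> A" a] assms insert by auto
    with insert show ?case by auto
  qed simp
  from this[OF fin] assms show ?thesis by (simp add: Un_absorb1 subset_iff)
qed

lemma subset_cl: "Y \<subseteq> G \<Longrightarrow> Y \<subseteq> cl Y"
  by (auto simp: cl_def insert_absorb)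

lemma r_union_cl:
  assumes "Y \<subseteq> G" "A \<subseteq> cl Y" shows "r (Y \<union> A) = r Y"
proof -
  have AG: "A \<subseteq> G" using assms by (auto simp: cl_def)
  have "finite A" using AG finite_G finite_subset by blast
  then show ?thesis using assms(2) AG
  proof (induction A rule: finite_induct)
    case (insert a A)
    have "a \<in> cl (Y \<union> A)" using cl_mono[of Y "Y \<union> A"] assms insert by auto
    then have "r (insert a (Y \<union> A)) = r (Y \<union> A)" by (simp add: cl_def)
    with insert show ?case by simp
  qed simp
qed

text \<open>By monotonicity \<open>A\<close> is also spanned by \<open>insert x Y\<close>, so
  \<open>r_union_cl\<close> removes \<open>A\<close> from both ranks in the test for
  \<open>x\<close>.\<close>

lemma cl_idem:
  assumes Y: "Y \<subseteq> G" and A: "A \<subseteq> cl Y" shows "cl (Y \<union> A) = cl Y"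
proof
  have AG: "A \<subseteq> G" using A by (auto simp: cl_def)
  show "cl Y \<subseteq> cl (Y \<union> A)" using Y AG by (intro cl_mono) auto
  show "cl (Y \<union> A) \<subseteq> cl Y"
  proof
    fix x assume x: "x \<in> cl (Y \<union> A)"
    then have xG: "x \<in> G" by (simp add: cl_def)
    have "r (insert x (Y \<union> A)) = r Y" using x r_union_cl[OF Y A] by (simp add: cl_def)
    moreover have "r (insert x (Y \<union> A)) \<ge> r (insert x Y)"
    proof -
      have "A \<subseteq> cl (insert x Y)" using A cl_mono[of Y "insert x Y"] Y xG by auto
      from r_union_cl[OF _ this] Y xG show ?thesis by simp
    qed
    ultimately have "r (insert x Y) = r Y" using r_insert_ge[OF Y xG] by simp
    with xG show "x \<in> cl Y" by (simp add: cl_def)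
  qed
qed

lemma cl_subset_cl:
  assumes "Y \<subseteq> G" "Z \<subseteq> cl Y" shows "cl Z \<subseteq> cl Y"
proof -
  have "Z \<subseteq> G" using assms by (auto simp: cl_def)
  then have "cl Z \<subseteq> cl (Y \<union> Z)" using assms by (intro cl_mono) auto
  with cl_idem[OF assms] show ?thesis by simp
qed

text \<open>Mac Lane-Steinitz exchange: \<open>x\<close> and \<open>z\<close> together raise the
  rank of \<open>Y\<close> by at most one, and \<open>x\<close> alone already does so.\<close>

lemma cl_exchange:
  assumes Y: "Y \<subseteq> G" and z: "z \<in> G" and x: "x \<in> cl (insert z Y)" "x \<notin> cl Y"
  shows "z \<in> cl (insert x Y)"
proof -
  have xG: "x \<in> G" using x by (simp add: cl_def)
  have e: "insert x (insert z Y) = insert z (insert x Y)" by auto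
  have "r (insert x Y) = r Y + 1"
    using x(2) xG r_insert_ge[OF Y xG] r_insert_le[OF Y xG] by (auto simp: cl_def)
  moreover have "r (insert z (insert x Y)) \<le> r Y + 1"
    using x(1) r_insert_le[OF Y z] by (simp add: cl_def e)
  moreover have "r (insert x Y) \<le> r (insert z (insert x Y))"
    using r_insert_ge[of "insert x Y" z] Y xG z by simp
  ultimately show ?thesis using z by (simp add: cl_def)
qed

lemma r_mono:
  assumes "Y \<subseteq> Z" "Z \<subseteq> G" shows "r Y \<le> r Z"
proof -
  have fin: "finite (Z - Y)" using assms finite_G by (meson finite_Diff finite_subset)
  have "r Y \<le> r (Y \<union> A)" if "finite A" "A \<subseteq> G" for A
    using that
  proof (induction A rule: finite_induct)
    case (insert a A)
    have "r (Y \<union> A) \<le> r (insert a (Y \<union> A))"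
      using r_insert_ge[of "Y \<union> A" a] assms insert by auto
    with insert show ?case by auto
  qed simp
  from this[OF fin] assms show ?thesis by (simp add: Un_absorb1 subset_iff)
qed

lemma r_le_card:
  assumes "Y \<subseteq> G" shows "r Y \<le> card Y"
proof -
  have "finite Y" using assms finite_G finite_subset by blast
  then show ?thesis using assms
  proof (induction Y rule: finite_induct)
    case (insert a A)
    with r_insert_le[of A a] show ?case by simp
  qed (simp add: r_empty)
qed

text \<open>Induction along the weights: a rejected element is spanned by lighter ones, which are
  spanned by the kept elements already.\<close>

lemma subset_cl_greedy:
  assumes "R \<subseteq> G" shows "R \<subseteq> cl (greedy R)"
proof -
  have fin: "finite R" using assms finite_G finite_subset by blast
  have gG: "greedy R \<subseteq> G" using assms greedy_subset by blast
  have "a \<in> R \<Longrightarrow> a \<in> cl (greedy R)" for a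
  proof (induction "card (below R a)" arbitrary: a rule: less_induct)
    case less
    show ?case
    proof (cases "a \<in> greedy R")
      case True
      then show ?thesis using subset_cl[OF gG] by blast
    next
      case False
      then have a: "a \<in> cl (below R a)" using less by (simp add: greedy_def)
      have "below R a \<subseteq> cl (greedy R)"
      proof
        fix b assume b: "b \<in> below R a"
        then have "below R b \<subset> below R a" by (auto simp: below_def)
        then have "card (below R b) < card (below R a)"
          using fin by (intro psubset_card_mono) (auto simp: below_def)
        with less b show "b \<in> cl (greedy R)" by (auto simp: below_def)
      qed
      with a cl_subset_cl[OF gG] show ?thesis by blast
    qed
  qed
  then show ?thesis by blast
qed

lemma r_greedy: "R \<subseteq> G \<Longrightarrow> r (greedy R) = r R"
  using r_union_cl[OF order_trans[OF greedy_subset] subset_cl_greedy, of R]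
  by (simp add: Un_absorb1[OF greedy_subset])

text \<open>The decision about an element never looks at heavier ones.\<close>

lemma greedy_below: "greedy (below R t) = below (greedy R) t"
proof -
  have "below (below R t) a = below R a" if "wt a < wt t" for a
    using that by (auto simp: below_def)
  then have "a \<in> greedy (below R t) \<longleftrightarrow> a \<in> below (greedy R) t" for a
    unfolding greedy_def below_def[of _ t] by (cases "wt a < wt t") (auto simp: below_def)
  then show ?thesis by blast
qed

text \<open>Truncation commutes with \<open>greedy\<close>, so \<open>subset_cl_greedy\<close> can
  be applied to the truncated set.\<close>

lemma cl_below_greedy:
  assumes "R \<subseteq> G" shows "cl (below (greedy R) t) = cl (below R t)"
proof
  have b: "below R t \<subseteq> G" using assms below_subset by blast
  show "cl (below (greedy R) t) \<subseteq> cl (below R t)"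
    using greedy_subset[of R] b by (intro cl_mono) (auto simp: below_def)
  have "greedy (below R t) \<subseteq> G" using b greedy_subset by blast
  then show "cl (below R t) \<subseteq> cl (below (greedy R) t)"
    using cl_subset_cl[OF _ subset_cl_greedy[OF b]] by (simp add: greedy_below)
qed

section \<open>Sparsification: greedy bases of unions\<close>

lemma cl_cong_union:
  assumes "A \<subseteq> G" "B \<subseteq> G" "A' \<subseteq> G" "B' \<subseteq> G" "cl A = cl A'" "cl B = cl B'"
  shows "cl (A \<union> B) = cl (A' \<union> B')"
proof -
  have *: "cl (A \<union> B) \<subseteq> cl (A' \<union> B')"
    if "A \<subseteq> G" "B \<subseteq> G" "A' \<subseteq> G" "B' \<subseteq> G" "cl A = cl A'" "cl B = cl B'" for A B A' B'
  proof (rule cl_subset_cl)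
    have "A \<subseteq> cl A'" "B \<subseteq> cl B'" using subset_cl[of A] subset_cl[of B] that by auto
    moreover have "cl A' \<subseteq> cl (A' \<union> B')" "cl B' \<subseteq> cl (A' \<union> B')" using that by (intro cl_mono; blast)+
    ultimately show "A \<union> B \<subseteq> cl (A' \<union> B')" by blast
  qed (use that in auto)
  show ?thesis using *[of A B A' B'] *[of A' B' A B] assms by auto
qed

text \<open>The decisive property of the node lists. Agreement of total spans would not be enough,
  as both membership in \<open>greedy\<close> and the search for a replacement test
  prefixes.\<close>

lemma cl_below_sparse:
  assumes "R1 \<subseteq> G" "R2 \<subseteq> G"
  shows "cl (below (greedy R1 \<union> greedy R2) t) = cl (below (R1 \<union> R2) t)"
proof -
  have "below (greedy R1 \<union> greedy R2) t = below (greedy R1) t \<union> below (greedy R2) t"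
    "below (R1 \<union> R2) t = below R1 t \<union> below R2 t" by (auto simp: below_def)
  then show ?thesis
    using assms greedy_subset below_subset
    by (simp only:) (intro cl_cong_union cl_below_greedy; blast)
qed

lemma cl_sparse:
  assumes "R1 \<subseteq> G" "R2 \<subseteq> G"
  shows "cl (greedy R1 \<union> greedy R2) = cl (R1 \<union> R2)"
proof (rule cl_cong_union)
  have *: "cl (greedy R) = cl R" if "R \<subseteq> G" for R
    using cl_subset_cl[OF _ subset_cl_greedy[OF that]] cl_mono[OF greedy_subset that]
      greedy_subset[of R] that by blast
  show "cl (greedy R1) = cl R1" "cl (greedy R2) = cl R2" using * assms by auto
qed (use assms greedy_subset in blast)+

text \<open>Fewer lighter elements span less, so an element that survives in a large set survives in
  each subset containing it.\<close>

lemma greedy_antimono: "a \<in> greedy R \<Longrightarrow> R' \<subseteq> R \<Longrightarrow> R \<subseteq> G \<Longrightarrow> a \<in> R' \<Longrightarrow> a \<in> greedy R'"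
  using cl_mono[of "below R' a" "below R a"] by (auto simp: greedy_def below_def)

text \<open>What a half rejects is rejected in the union by \<open>greedy_antimono\<close>; for the
  rest both sides apply the same test by \<open>cl_below_sparse\<close>.\<close>

lemma greedy_sparse:
  assumes "R1 \<subseteq> G" "R2 \<subseteq> G"
  shows "greedy (greedy R1 \<union> greedy R2) = greedy (R1 \<union> R2)"
proof -
  have "greedy (R1 \<union> R2) \<subseteq> greedy R1 \<union> greedy R2"
    using greedy_antimono[of _ "R1 \<union> R2"] assms greedy_subset[of "R1 \<union> R2"] by auto
  moreover have "greedy R1 \<union> greedy R2 \<subseteq> R1 \<union> R2" using greedy_subset by blast
  ultimately show ?thesis
    unfolding greedy_def[of "greedy R1 \<union> greedy R2"] greedy_def[of "R1 \<union> R2"]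
      cl_below_sparse[OF assms] by blast
qed

text \<open>A rejected \<open>x\<close> is spanned by elements lighter than itself, so every prefix
  that contains \<open>x\<close> has the same closure without it.\<close>

lemma greedy_delete_irrelevant:
  assumes R: "R \<subseteq> G" and x: "x \<in> R" "x \<notin> greedy R"
  shows "greedy (R - {x}) = greedy R"
proof -
  have xc: "x \<in> cl (below R x)" using x by (simp add: greedy_def)
  have "cl (below (R - {x}) a) = cl (below R a)" for a
  proof (cases "wt x < wt a")
    case True
    have e: "below R a = below (R - {x}) a \<union> {x}" using x True by (auto simp: below_def)
    have "below R x \<subseteq> below (R - {x}) a" using True by (auto simp: below_def)
    then have "x \<in> cl (below (R - {x}) a)" using xc cl_mono R by (auto simp: below_def)
    then show ?thesis unfolding e using R by (intro cl_idem[symmetric]) (auto simp: below_def)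
  next
    case False
    then have "below (R - {x}) a = below R a" by (auto simp: below_def)
    then show ?thesis by simp
  qed
  with x(2) show ?thesis by (auto simp: greedy_def)
qed

text \<open>
  As long as the elements up to \<open>a\<close> do not span the deleted \<open>x\<close>, the element \<open>a\<close> keeps its status:
  by the exchange property, \<open>x\<close> could only have been needed to span \<open>a\<close> if it were spanned with
  the help of \<open>a\<close>.
\<close>
lemma greedy_delete_before:
  assumes R: "R \<subseteq> G" and a: "a \<in> R" "a \<noteq> x" and x: "x \<in> R"
    and nx: "x \<notin> cl (insert a (below (R - {x}) a))"
  shows "a \<in> greedy (R - {x}) \<longleftrightarrow> a \<in> greedy R"
proof -
  let ?B = "below (R - {x}) a"
  have B: "?B \<subseteq> G" using R by (auto simp: below_def)
  have "a \<in> cl ?B \<longleftrightarrow> a \<in> cl (below R a)"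
  proof (cases "wt x < wt a")
    case True
    have e: "below R a = insert x ?B" using x True by (auto simp: below_def)
    have "a \<in> cl ?B" if "a \<in> cl (insert x ?B)"
    proof (rule ccontr)
      assume "a \<notin> cl ?B"
      then have "x \<in> cl (insert a ?B)" using cl_exchange[OF B _ that] x R by blast
      with nx show False by simp
    qed
    moreover have "cl ?B \<subseteq> cl (insert x ?B)" using B x R by (intro cl_mono) auto
    ultimately show ?thesis unfolding e by blast
  next
    case False
    then have "?B = below R a" by (auto simp: below_def)
    then show ?thesis by simp
  qed
  with a show ?thesis by (auto simp: greedy_def)
qed

text \<open>Here \<open>x\<close> is a coloop of the restriction to \<open>R\<close>: no prefix of
  the rest spans it, so \<open>greedy_delete_before\<close> applies to every other element.\<close>

lemma greedy_delete_unreplaced: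
  assumes R: "R \<subseteq> G" and x: "x \<in> R" "x \<notin> cl (R - {x})"
  shows "greedy (R - {x}) = greedy R - {x}"
proof -
  have "a \<in> greedy (R - {x}) \<longleftrightarrow> a \<in> greedy R" if "a \<in> R" "a \<noteq> x" for a
  proof (rule greedy_delete_before[OF R that x(1)])
    have "insert a (below (R - {x}) a) \<subseteq> R - {x}" using that by (auto simp: below_def)
    then show "x \<notin> cl (insert a (below (R - {x}) a))" using x(2) cl_mono R by blast
  qed
  then show ?thesis using greedy_subset[of "R - {x}"] greedy_subset[of R] by blast
qed

text \<open>Elements lighter than \<open>z\<close> keep their status because their prefixes do not
  yet span \<open>x\<close>. For elements heavier than \<open>z\<close> the rest already spans
  \<open>x\<close>, so its removal changes no closure. At \<open>z\<close> itself the status flips: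
  by exchange \<open>z\<close> is spanned with the help of \<open>x\<close>, but not without
  it.\<close>

lemma greedy_delete_replaced:
  assumes R: "R \<subseteq> G" and x: "x \<in> R" and z: "z \<in> R" "z \<noteq> x" "wt x < wt z"
    and nz: "x \<notin> cl (below (R - {x}) z)"
    and zc: "x \<in> cl (insert z (below (R - {x}) z))"
  shows "greedy (R - {x}) = insert z (greedy R - {x})" "z \<notin> greedy R"
proof -
  let ?B = "below (R - {x}) z"
  have B: "?B \<subseteq> G" using R by (auto simp: below_def)
  have eq: "below R z = insert x ?B" using x z by (auto simp: below_def)
  have zR: "z \<in> cl (below R z)" unfolding eq using cl_exchange[OF B _ zc nz] z R by blast
  then show "z \<notin> greedy R" by (simp add: greedy_def)
  have "z \<notin> cl ?B"
  proof
    assume "z \<in> cl ?B"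
    then have "cl (?B \<union> {z}) = cl ?B" by (intro cl_idem[OF B]) simp
    with zc nz show False by simp
  qed
  then have zin: "z \<in> greedy (R - {x})" using z by (simp add: greedy_def)
  have "a \<in> greedy (R - {x}) \<longleftrightarrow> a \<in> greedy R" if a: "a \<in> R" "a \<noteq> x" "a \<noteq> z" for a
  proof (cases "wt a < wt z")
    case True
    show ?thesis
    proof (rule greedy_delete_before[OF R a(1,2) x])
      have "insert a (below (R - {x}) a) \<subseteq> ?B" using a True by (auto simp: below_def)
      then show "x \<notin> cl (insert a (below (R - {x}) a))" using nz cl_mono B by blast
    qed
  next
    case False
    moreover have "wt a \<noteq> wt z" using a z R wt_inj by (auto dest: inj_onD)
    ultimately have lt: "wt z < wt a" by simp
    have Ba: "below (R - {x}) a \<subseteq> G" using R by (auto simp: below_def)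
    have "insert z ?B \<subseteq> below (R - {x}) a" using z lt by (auto simp: below_def)
    then have "x \<in> cl (below (R - {x}) a)" using zc cl_mono Ba by blast
    then have "cl (below (R - {x}) a \<union> {x}) = cl (below (R - {x}) a)" by (intro cl_idem[OF Ba]) simp
    moreover have "below R a = below (R - {x}) a \<union> {x}" using x z lt by (auto simp: below_def)
    ultimately show ?thesis using a by (auto simp: greedy_def)
  qed
  with zin show "greedy (R - {x}) = insert z (greedy R - {x})"
    using greedy_subset[of "R - {x}"] greedy_subset[of R] by blast
qed

section \<open>Cardinality and minimality of the greedy basis\<close>

lemma greedy_insert_max:
  assumes "\<And>a. a \<in> R \<Longrightarrow> wt a < wt m"
  shows "greedy (insert m R) = (if m \<in> cl R then greedy R else insert m (greedy R))"
proof -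
  have "below (insert m R) m = R" "\<And>a. a \<in> R \<Longrightarrow> below (insert m R) a = below R a"
    using assms by (auto simp: below_def) (meson less_asym)
  moreover have "m \<notin> R" using assms by blast
  ultimately show ?thesis by (auto simp: greedy_def)
qed

text \<open>Replays the greedy algorithm: the heaviest element is added last, so each induction step
  is one greedy decision.\<close>

lemma max_induct [consumes 1, case_names empty insert]:
  assumes R: "R \<subseteq> G" and empty: "P {}"
    and step: "\<And>m R. m \<in> G \<Longrightarrow> R \<subseteq> G \<Longrightarrow> m \<notin> R \<Longrightarrow> (\<And>a. a \<in> R \<Longrightarrow> wt a < wt m) \<Longrightarrow> P R \<Longrightarrow> P (insert m R)"
  shows "P R"
proof -
  have "finite R" using R finite_G finite_subset by blast
  then show ?thesis using R
  proof (induction "card R" arbitrary: R)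
    case 0
    then show ?case using empty by simp
  next
    case (Suc k)
    then have ne: "R \<noteq> {}" by auto
    have "Max (wt ` R) \<in> wt ` R" using ne Suc by (intro Max_in) auto
    then obtain m where m: "m \<in> R" "wt m = Max (wt ` R)" by force
    have "wt a < wt m" if "a \<in> R - {m}" for a
    proof -
      have "wt a \<le> wt m" using m that Suc.prems by (simp add: Max_ge)
      moreover have "wt a \<noteq> wt m"
        using that m(1) Suc.prems inj_onD[OF wt_inj, of a m] by blast
      ultimately show ?thesis by simp
    qed
    moreover have "P (R - {m})" using Suc m by (intro Suc.hyps(1)) auto
    ultimately have "P (insert m (R - {m}))" using m Suc.prems by (intro step) auto
    with m show ?case by (simp add: insert_absorb)
  qed
qed

lemma card_greedy: "R \<subseteq> G \<Longrightarrow> card (greedy R) = r R"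
proof (induction rule: max_induct)
  case empty
  then show ?case by (simp add: greedy_def r_empty)
next
  case (insert m R)
  have fin: "finite (greedy R)" using insert greedy_subset finite_G by (meson finite_subset)
  have "m \<notin> greedy R" using insert greedy_subset by blast
  moreover have "r (insert m R) = (if m \<in> cl R then r R else r R + 1)"
    using r_insert_le[of R m] r_insert_ge[of R m] insert by (auto simp: cl_def)
  ultimately show ?case using insert greedy_insert_max[of R m] fin by simp
qed

text \<open>If \<open>R\<close> does not span the heaviest element \<open>m\<close>, every basis of
  \<open>insert m R\<close> must contain \<open>m\<close>. If it does, a competing basis that
  contains \<open>m\<close> becomes no heavier when \<open>m\<close> is swapped for some
  \<open>b\<close> from \<open>R\<close>, and then the induction hypothesis applies.\<close>

lemma greedy_minimal:
  assumes "R \<subseteq> G" "B \<subseteq> R" "r B = card B" "card B = r R"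
  shows "sum wt (greedy R) \<le> sum wt B"
  using assms
proof (induction arbitrary: B rule: max_induct)
  case empty
  then show ?case by (simp add: greedy_def)
next
  case (insert m R)
  have finB: "finite B" using insert finite_G by (meson finite_insert finite_subset)
  have fg: "finite (greedy R)" using insert greedy_subset finite_G by (meson finite_subset)
  have mg: "m \<notin> greedy R" using insert greedy_subset by blast
  have BmR: "B - {m} \<subseteq> R" using insert by auto
  have Bm: "m \<in> B \<Longrightarrow> r (B - {m}) = card (B - {m})"
  proof -
    assume m: "m \<in> B"
    have "r B \<le> r (B - {m}) + 1"
      using r_insert_le[of "B - {m}" m] m BmR insert by (simp add: insert_absorb)
    moreover have "r (B - {m}) \<le> card (B - {m})" using BmR insert by (intro r_le_card) auto
    ultimately show ?thesis using insert m finB by (simp add: card_Diff_singleton)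
  qed
  show ?case
  proof (cases "m \<in> cl R")
    case False
    then have rR: "r (insert m R) = r R + 1"
      using r_insert_le[of R m] r_insert_ge[of R m] insert by (auto simp: cl_def)
    have mB: "m \<in> B"
    proof (rule ccontr)
      assume "m \<notin> B"
      then have "r B \<le> r R" using insert by (intro r_mono) auto
      with insert rR show False by simp
    qed
    have "card (B - {m}) = r R" using mB insert rR finB by (simp add: card_Diff_singleton)
    then have "sum wt (greedy R) \<le> sum wt (B - {m})"
      using insert.IH[OF BmR Bm[OF mB]] by simp
    then show ?thesis
      using mB finB fg mg False greedy_insert_max[of R m] insert
      by (simp add: sum.remove[of B m])
  next
    case True
    then have rR: "r (insert m R) = r R" by (simp add: cl_def)
    have gr: "greedy (insert m R) = greedy R" using True greedy_insert_max[of R m] insert by simp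
    show ?thesis
    proof (cases "m \<in> B")
      case False
      then have "B \<subseteq> R" using insert.prems by blast
      from insert.IH[OF this] insert.prems gr rR show ?thesis by simp
    next
      case mB: True
      let ?C = "B - {m}"
      have C: "?C \<subseteq> G" using BmR insert by auto
      have cC: "card ?C + 1 = r R" using mB insert rR finB
        by (metis Suc_eq_plus1 card.remove)
      \<comment> \<open>Without \<open>m\<close> the basis is one short of the rank of
        \<open>R\<close>, so it leaves some element of \<open>R\<close> unspanned; that element
        takes the place of \<open>m\<close>.\<close>
      have "\<not> R \<subseteq> cl ?C"
      proof
        assume "R \<subseteq> cl ?C"
        then have "r (?C \<union> R) = r ?C" by (rule r_union_cl[OF C])
        moreover have "?C \<union> R = R" using BmR by auto
        ultimately show False using Bm[OF mB] cC by simp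
      qed
      then obtain b where b: "b \<in> R" "b \<notin> cl ?C" by blast
      have bC: "b \<notin> ?C" using b subset_cl[OF C] by blast
      have "r (insert b ?C) = r ?C + 1"
        using b r_insert_le[OF C, of b] r_insert_ge[OF C, of b] insert by (auto simp: cl_def)
      then have 1: "r (insert b ?C) = card (insert b ?C)" "card (insert b ?C) = r R"
        using Bm[OF mB] bC finB cC by auto
      have "sum wt (greedy R) \<le> sum wt (insert b ?C)"
        using insert.IH[OF _ 1] b BmR by simp
      also have "\<dots> = wt b + sum wt ?C" using bC finB by simp
      also have "\<dots> \<le> wt m + sum wt ?C" using insert b by (simp add: less_imp_le)
      also have "\<dots> = sum wt B" using mB finB by (simp add: sum.remove)
      finally show ?thesis using gr by simp
    qed
  qed
qed

end

section \<open>The rank function of a matroid\<close>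

context matroid
begin

lemma finite_indep_below: "finite {I. I \<subseteq> X \<and> indep I}"
  by (rule finite_subset[of _ "Pow U"]) (use indep_subset_ground finite_ground in blast)+

lemma indep_le_rank: "I \<subseteq> X \<Longrightarrow> indep I \<Longrightarrow> card I \<le> matroid_rank indep X"
  unfolding matroid_rank_def using finite_indep_below by (intro Max_ge) auto

lemma rank_attained: obtains I where "I \<subseteq> X" "indep I" "card I = matroid_rank indep X"
proof -
  have "matroid_rank indep X \<in> card ` {I. I \<subseteq> X \<and> indep I}"
    unfolding matroid_rank_def using finite_indep_below indep_empty by (intro Max_in) auto
  then show ?thesis using that by auto
qed

lemma rank_mono: "X \<subseteq> Y \<Longrightarrow> matroid_rank indep X \<le> matroid_rank indep Y"
proof -
  assume "X \<subseteq> Y"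
  obtain I where "I \<subseteq> X" "indep I" "card I = matroid_rank indep X" by (rule rank_attained)
  with \<open>X \<subseteq> Y\<close> indep_le_rank[of I Y] show ?thesis by auto
qed

lemma rank_le_card_ground: "matroid_rank indep X \<le> card U"
proof -
  obtain I where "I \<subseteq> X" "indep I" "card I = matroid_rank indep X" by (rule rank_attained)
  with card_mono[OF finite_ground indep_subset_ground[of I]] show ?thesis by simp
qed

lemma rank_empty: "matroid_rank indep {} = 0"
proof -
  obtain I where "I \<subseteq> {}" "indep I" "card I = matroid_rank indep {}" by (rule rank_attained)
  then show ?thesis by simp
qed

lemma finite_indep: "indep I \<Longrightarrow> finite I"
  using indep_subset_ground finite_ground finite_subset by blast

lemma rank_insert_le: "matroid_rank indep (insert x X) \<le> matroid_rank indep X + 1"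
proof -
  obtain I where I: "I \<subseteq> insert x X" "indep I" "card I = matroid_rank indep (insert x X)"
    by (rule rank_attained)
  have "card (I - {x}) \<le> matroid_rank indep X"
    using I indep_subset by (intro indep_le_rank) auto
  then show ?thesis using I(3) card_Diff1_le[of I x] card_Diff_singleton_if[of I x] by (auto split: if_splits)
qed

text \<open>If the rank rose, the exchange axiom would extend a basis of \<open>X\<close> by a
  single element, which is \<open>x\<close>, \<open>y\<close> or from \<open>X\<close>. Neither
  assumption nor the maximality of the basis leaves room for that.\<close>

lemma rank_local:
  assumes "matroid_rank indep (insert x X) = matroid_rank indep X"
    "matroid_rank indep (insert y X) = matroid_rank indep X"
  shows "matroid_rank indep (insert x (insert y X)) = matroid_rank indep X"
proof (rule ccontr)
  assume "\<not> ?thesis"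
  moreover have "matroid_rank indep X \<le> matroid_rank indep (insert x (insert y X))"
    by (rule rank_mono) auto
  ultimately have lt: "matroid_rank indep X < matroid_rank indep (insert x (insert y X))" by simp
  obtain I where I: "I \<subseteq> X" "indep I" "card I = matroid_rank indep X" by (rule rank_attained)
  obtain J where J: "J \<subseteq> insert x (insert y X)" "indep J"
    "card J = matroid_rank indep (insert x (insert y X))" by (rule rank_attained)
  obtain b where b: "b \<in> J - I" "indep (insert b I)" using indep_exchange[of I J] I J lt by auto
  have cb: "card (insert b I) = matroid_rank indep X + 1" using b I finite_indep by simp
  have "insert b I \<subseteq> X \<or> insert b I \<subseteq> insert x X \<or> insert b I \<subseteq> insert y X" using b J I by auto
  then show False
    using indep_le_rank[OF _ b(2), of X] indep_le_rank[OF _ b(2), of "insert x X"]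
      indep_le_rank[OF _ b(2), of "insert y X"] cb assms by linarith
qed

lemma indep_if_rank_card:
  assumes "finite Y" "matroid_rank indep Y = card Y" shows "indep Y"
proof -
  obtain I where "I \<subseteq> Y" "indep I" "card I = matroid_rank indep Y" by (rule rank_attained)
  with assms card_subset_eq[of Y I] show ?thesis by simp
qed

lemma rank_indep: "indep Y \<Longrightarrow> matroid_rank indep Y = card Y"
proof -
  assume Y: "indep Y"
  obtain I where I: "I \<subseteq> Y" "indep I" "card I = matroid_rank indep Y" by (rule rank_attained)
  with card_mono[OF finite_indep[OF Y] I(1)] indep_le_rank[OF subset_refl Y] show ?thesis by simp
qed

end

section \<open>Sorted lists of elements\<close>

text \<open>Reading past the end yields the code for "none". Thus the end of a linked list, a mark
  behind the end and a missing replacement all look alike.\<close>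

definition nth0 :: "nat list \<Rightarrow> nat \<Rightarrow> nat" where
  "nth0 L m = (if m < length L then L ! m else 0)"

text \<open>Chosen to dominate all positions \<open>k * W + p\<close> of the tree layout, where
  \<open>d + 1 \<le> 2 * n + 2\<close> and \<open>W \<le> 2 * n + 3\<close>, see
  \<open>idx_bound\<close>. Only polynomial growth matters.\<close>

definition value_bound :: "nat \<Rightarrow> nat" where
  "value_bound n = (2 * n + 4)\<^sup>2"

locale numbered_matroid = matroid U indep for U :: "'a set" and indep :: "'a set \<Rightarrow> bool" +
  fixes n :: nat and el :: "nat \<Rightarrow> 'a" and w :: "'a \<Rightarrow> real"
  assumes card_U: "card U = n" and el_bij: "bij_betw el {..<n} U" and w_inj: "inj_on w U"
begin

definition elem :: "nat \<Rightarrow> 'a" where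
  "elem e = el (e - 1)"

definition codes :: "nat set" where
  "codes = {1..n}"

definition wt :: "nat \<Rightarrow> real" where
  "wt e = w (elem e)"

definition rnk :: "nat set \<Rightarrow> nat" where
  "rnk Y = matroid_rank indep (elem ` Y)"

lemma elem_inj: "inj_on elem codes"
proof (rule inj_onI)
  fix a b assume "a \<in> codes" "b \<in> codes" "elem a = elem b"
  then have "a - 1 = b - 1" using bij_betw_imp_inj_on[OF el_bij]
    by (auto simp: elem_def codes_def dest!: inj_onD)
  with \<open>a \<in> codes\<close> \<open>b \<in> codes\<close> show "a = b" by (auto simp: codes_def)
qed

lemma elem_in_U: "e \<in> codes \<Longrightarrow> elem e \<in> U"
  using bij_betw_apply[OF el_bij] by (auto simp: elem_def codes_def)

lemma wt_inj_codes: "inj_on wt codes"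
  unfolding wt_def using comp_inj_on[OF elem_inj inj_on_subset[OF w_inj]] elem_in_U
  by (auto simp: comp_def)

sublocale ranked codes rnk wt
proof
  show "finite codes" by (simp add: codes_def)
  show "rnk {} = 0" by (simp add: rnk_def rank_empty)
  show "inj_on wt codes" by (rule wt_inj_codes)
qed (use rank_insert_le in \<open>auto simp: rnk_def intro!: rank_mono rank_local\<close>)

sublocale machine n el "matroid_rank indep" w "value_bound n"
proof
  show "2 \<le> value_bound n" by (simp add: value_bound_def power2_eq_square algebra_simps)
  have "n \<le> value_bound n" by (simp add: value_bound_def power2_eq_square algebra_simps)
  then show "matroid_rank indep A \<le> value_bound n" for A
    using rank_le_card_ground[of A] card_U by simp
qed

definition lt :: "nat \<Rightarrow> nat \<Rightarrow> bool" where
  "lt a b \<longleftrightarrow> a \<noteq> 0 \<and> (b = 0 \<or> wt a < wt b)"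

definition slist :: "nat list \<Rightarrow> bool" where
  "slist L \<longleftrightarrow> set L \<subseteq> codes \<and> sorted_wrt (\<lambda>a b. wt a < wt b) L"

text \<open>In a sorted list this is the index of \<open>t\<close>, or the index at which
  \<open>t\<close> would be inserted. As the code 0 is heavier than everything, a missing
  replacement behaves like an insertion at the end.\<close>

definition pos :: "nat list \<Rightarrow> nat \<Rightarrow> nat" where
  "pos L t = length (filter (\<lambda>a. lt a t) L)"

lemma pos_le: "pos L t \<le> length L"
  by (simp add: pos_def)

lemma slist_nth_less: "slist L \<Longrightarrow> i < j \<Longrightarrow> j < length L \<Longrightarrow> wt (L ! i) < wt (L ! j)"
  by (simp add: slist_def sorted_wrt_iff_nth_less)

lemma slist_distinct: "slist L \<Longrightarrow> distinct L"
  unfolding distinct_conv_nth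
  by (metis slist_nth_less less_irrefl linorder_neqE_nat)

lemma slist_codes: "slist L \<Longrightarrow> m < length L \<Longrightarrow> L ! m \<in> codes"
  by (auto simp: slist_def)

lemma codes_pos: "e \<in> codes \<Longrightarrow> 0 < e"
  by (simp add: codes_def)

lemma codes_le: "e \<in> codes \<Longrightarrow> e \<le> n"
  by (simp add: codes_def)

lemma nth0_le: "slist L \<Longrightarrow> nth0 L m \<le> n"
  using codes_le slist_codes by (simp add: nth0_def)

lemma slist_append:
  "slist (A @ B) \<longleftrightarrow> slist A \<and> slist B \<and> (\<forall>a\<in>set A. \<forall>b\<in>set B. wt a < wt b)"
  by (auto simp: slist_def sorted_wrt_append)

lemma slist_Cons: "slist (a # B) \<longleftrightarrow> a \<in> codes \<and> slist B \<and> (\<forall>b\<in>set B. wt a < wt b)"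
  by (auto simp: slist_def)

lemma pos_split:
  assumes "slist L"
  shows "\<forall>a \<in> set (take (pos L t) L). lt a t" "\<forall>a \<in> set (drop (pos L t) L). \<not> lt a t"
proof -
  have "(\<forall>a \<in> set (take (pos L t) L). lt a t) \<and> (\<forall>a \<in> set (drop (pos L t) L). \<not> lt a t)"
    using assms
  proof (induction L)
    case (Cons a L)
    then have L: "slist L" "a \<in> codes" and lt: "\<forall>b\<in>set L. wt a < wt b" by (auto simp: slist_Cons)
    show ?case
    proof (cases "lt a t")
      case True
      then have "pos (a # L) t = Suc (pos L t)" by (simp add: pos_def)
      with Cons.IH[OF L(1)] True show ?thesis by simp
    next
      case False
      then have nl: "\<forall>b\<in>set L. \<not> lt b t" using lt L(2) codes_pos[of a] unfolding lt_def by fastforce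
      then have "filter (\<lambda>a. lt a t) L = []" by (simp add: filter_empty_conv)
      then show ?thesis using False nl by (simp add: pos_def)
    qed
  qed simp
  then show "\<forall>a \<in> set (take (pos L t) L). lt a t" "\<forall>a \<in> set (drop (pos L t) L). \<not> lt a t" by auto
qed

text \<open>Turns the comparisons made by the programs into index arithmetic. It also holds behind
  the end, where the entry is 0 and never light.\<close>

lemma lt_nth0:
  assumes "slist L" shows "lt (nth0 L m) t \<longleftrightarrow> m < pos L t"
proof (cases "m < length L")
  case True
  show ?thesis
  proof
    assume l: "lt (nth0 L m) t"
    show "m < pos L t"
    proof (rule ccontr)
      assume "\<not> m < pos L t"
      then have "L ! m \<in> set (drop (pos L t) L)" using True
        by (metis (no_types, lifting) Cons_nth_drop_Suc list.set_intros(1) not_less set_drop_subset_set_drop subsetD)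
      with pos_split(2)[OF assms] l True show False by (auto simp: nth0_def)
    qed
  next
    assume "m < pos L t"
    then have "L ! m \<in> set (take (pos L t) L)" using True by (auto simp: in_set_conv_nth)
    with pos_split(1)[OF assms] True show "lt (nth0 L m) t" by (auto simp: nth0_def)
  qed
next
  case False
  then show ?thesis using pos_le[of L t] by (auto simp: nth0_def lt_def)
qed

lemma pos_nth:
  assumes L: "slist L" and m: "m < length L" shows "pos L (L ! m) = m"
proof (rule ccontr)
  assume ne: "pos L (L ! m) \<noteq> m"
  have c: "0 < L ! m" using slist_codes[OF assms] codes_pos by blast
  show False
  proof (cases "pos L (L ! m) < m")
    case True
    have "lt (nth0 L (pos L (L ! m))) (L ! m)"
      using slist_nth_less[OF L True m] slist_codes[OF L, of "pos L (L ! m)"] codes_pos True m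
      by (force simp: nth0_def lt_def)
    then show False using lt_nth0[OF L] by simp
  next
    case False
    then have "m < pos L (L ! m)" using ne by simp
    then have "lt (nth0 L m) (L ! m)" using lt_nth0[OF L] by simp
    then show False using m c by (simp add: nth0_def lt_def)
  qed
qed

lemma pos_0: "slist L \<Longrightarrow> pos L 0 = length L"
  unfolding pos_def by (subst filter_True) (auto simp: lt_def slist_def dest: codes_pos)

text \<open>Identifies the stored prefix sets with the weight prefixes in the definition of
  \<open>greedy\<close>.\<close>

lemma set_take_below:
  assumes "slist L" "m < length L" shows "set (take m L) = below (set L) (L ! m)"
proof
  show "set (take m L) \<subseteq> below (set L) (L ! m)"
  proof
    fix a assume "a \<in> set (take m L)"
    then obtain i where "i < m" "a = L ! i" by (auto simp: in_set_conv_nth)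
    with slist_nth_less[OF assms(1)] assms(2) show "a \<in> below (set L) (L ! m)"
      by (simp add: below_def)
  qed
  show "below (set L) (L ! m) \<subseteq> set (take m L)"
  proof
    fix a assume "a \<in> below (set L) (L ! m)"
    then obtain i where i: "i < length L" "L ! i = a" "wt (L ! i) < wt (L ! m)"
      by (auto simp: below_def in_set_conv_nth)
    have "i < m" using i slist_nth_less[OF assms(1), of m i] assms(2)
      by (metis less_asym linorder_neqE_nat less_irrefl)
    with i assms(2) show "a \<in> set (take m L)" by (auto simp: in_set_conv_nth intro!: exI[of _ i])
  qed
qed

text \<open>Replaces \<open>x\<close> by the heavier element \<open>y\<close>; \<open>y = 0\<close> stands for the absence of a replacement.\<close>
definition upd :: "nat list \<Rightarrow> nat \<Rightarrow> nat \<Rightarrow> nat list" where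
  "upd L x y = take (pos L x) L @ drop (pos L x + 1) (take (pos L y) L) @
     (if y = 0 then [] else [y]) @ drop (pos L y) L"

section \<open>Replacing one entry of a sorted list\<close>

context
  fixes L x y
  assumes L: "slist L" and xL: "x \<in> set L" and y: "y = 0 \<or> y \<in> codes \<and> y \<notin> set L \<and> wt x < wt y"
begin

lemma upd_pos: "pos L x < length L" "L ! pos L x = x" "pos L x < pos L y"
proof -
  obtain m where m: "m < length L" "L ! m = x" using xL by (auto simp: in_set_conv_nth)
  then have p: "pos L x = m" using pos_nth[OF L] by blast
  then show "pos L x < length L" "L ! pos L x = x" using m by auto
  have "x \<in> codes" using xL L by (auto simp: slist_def)
  then have "lt (nth0 L m) y" using m y codes_pos[of x] by (auto simp: lt_def nth0_def)
  then show "pos L x < pos L y" using lt_nth0[OF L] p by simp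
qed

text \<open>All facts about \<open>upd\<close> are read off from this split: \<open>B\<close> is the
  window between the gap left by \<open>x\<close> and the place of \<open>y\<close>.\<close>

lemma upd_decompose:
  obtains A B C where "L = A @ x # B @ C" "pos L x = length A" "pos L y = length A + 1 + length B"
    "upd L x y = A @ B @ (if y = 0 then [] else [y]) @ C"
proof
  let ?i = "pos L x" and ?j = "pos L y"
  have j: "?j \<le> length L" by (rule pos_le)
  have "L = take ?i L @ x # drop (Suc ?i) L" using upd_pos id_take_nth_drop[of ?i L] by simp
  moreover have "drop (Suc ?i) L = drop (Suc ?i) (take ?j L) @ drop ?j L"
    using upd_pos j by (metis Suc_leI append_take_drop_id drop_append diff_is_0_eq drop_0
      length_take min.absorb2)
  ultimately show "L = take ?i L @ x # drop (?i + 1) (take ?j L) @ drop ?j L" by simp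
  show "?i = length (take ?i L)" using upd_pos by simp
  show "?j = length (take ?i L) + 1 + length (drop (?i + 1) (take ?j L))" using upd_pos j by simp
  show "upd L x y = take ?i L @ drop (?i + 1) (take ?j L) @ (if y = 0 then [] else [y]) @ drop ?j L"
    by (simp add: upd_def)
qed

text \<open>Only the window moves, by one place to the left; \<open>y\<close> fills the last gap, so
  everything behind it keeps its index. For \<open>y = 0\<close> the window reaches to the end and
  the gap is filled by the end marker.\<close>

lemma nth0_upd:
  "nth0 (upd L x y) m = (if m < pos L x then nth0 L m else if m + 1 < pos L y then nth0 L (m + 1)
     else if m + 1 = pos L y then y else nth0 L m)"
proof -
  obtain A B C where *: "L = A @ x # B @ C" "pos L x = length A" "pos L y = length A + 1 + length B"
    "upd L x y = A @ B @ (if y = 0 then [] else [y]) @ C" by (rule upd_decompose)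
  \<comment> \<open>Nothing may follow the window here: without an inserted \<open>y\<close> it
    would be shifted too.\<close>
  have C: "y = 0 \<Longrightarrow> C = []" using pos_0[OF L] *(1,3) by simp
  show ?thesis unfolding *(2,3,4)
    using C unfolding *(1) by (auto simp: nth0_def nth_append nth_Cons' split: if_splits)
qed

text \<open>The reason why the number of marks of a node can stay fixed during all
  deletions.\<close>

lemma length_upd: "length (upd L x y) \<le> length L"
proof -
  obtain A B C where *: "L = A @ x # B @ C" "pos L x = length A" "pos L y = length A + 1 + length B"
    "upd L x y = A @ B @ (if y = 0 then [] else [y]) @ C" by (rule upd_decompose)
  show ?thesis unfolding *(4) by (subst *(1)) simp
qed

lemma set_upd: "set (upd L x y) = set L - {x} \<union> (if y = 0 then {} else {y})"
proof -
  obtain A B C where *: "L = A @ x # B @ C" "pos L x = length A" "pos L y = length A + 1 + length B"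
    "upd L x y = A @ B @ (if y = 0 then [] else [y]) @ C" by (rule upd_decompose)
  have "distinct (A @ x # B @ C)" using slist_distinct[OF L] *(1) by simp
  then show ?thesis unfolding *(4) by (subst *(1)) auto
qed

lemma slist_upd: "slist (upd L x y)"
proof -
  obtain A B C where *: "L = A @ x # B @ C" "pos L x = length A" "pos L y = length A + 1 + length B"
    "upd L x y = A @ B @ (if y = 0 then [] else [y]) @ C" by (rule upd_decompose)
  have d: "drop (pos L y) L = C" "take (pos L y) L = A @ x # B" unfolding *(3) by (subst *(1), simp)+
  have sl: "slist (A @ x # B @ C)" using L *(1) by simp
  show ?thesis
  proof (cases "y = 0")
    case True
    then show ?thesis using sl unfolding *(4) by (auto simp: slist_append slist_Cons)
  next
    case False
    then have yc: "y \<in> codes" "y \<notin> set L" using y by auto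
    have "\<forall>a\<in>set (A @ B). wt a < wt y"
      using pos_split(1)[OF L, of y] False unfolding d by (auto simp: lt_def)
    moreover have "\<forall>a\<in>set C. wt y < wt a"
    proof
      fix a assume a: "a \<in> set C"
      then have aL: "a \<in> set L" using *(1) by simp
      have aly: "\<not> lt a y" using pos_split(2)[OF L, of y] a unfolding d by blast
      from aL have ac: "a \<in> codes" using L by (auto simp: slist_def)
      then have "wt y \<le> wt a" using aly False codes_pos[OF ac] by (auto simp: lt_def)
      moreover have "wt y \<noteq> wt a" using inj_onD[OF wt_inj _ yc(1) ac] aL yc by auto
      ultimately show "wt y < wt a" by simp
    qed
    ultimately show ?thesis using sl False yc unfolding *(4)
      by (auto simp: slist_append slist_Cons)
  qed
qed

lemma take_upd_before: "m \<le> pos L x \<Longrightarrow> take m (upd L x y) = take m L"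
proof -
  assume m: "m \<le> pos L x"
  obtain A B C where *: "L = A @ x # B @ C" "pos L x = length A" "pos L y = length A + 1 + length B"
    "upd L x y = A @ B @ (if y = 0 then [] else [y]) @ C" by (rule upd_decompose)
  show ?thesis using m unfolding *(2,4) by (subst *(1)) simp
qed

text \<open>A prefix that ends inside the window gains the entry that used to follow it, a longer
  one gains \<open>y\<close>. Removing \<open>x\<close> last also covers \<open>m = pos L x\<close>:
  there the entry that follows is \<open>x\<close> itself and is taken out again.\<close>

lemma set_take_upd:
  assumes m: "pos L x \<le> m"
  shows "set (take m (upd L x y)) =
    (set (take m L) \<union> (if m < pos L y then {nth0 L m} else if y = 0 then {} else {y})) - {x}"
proof -
  obtain A B C where *: "L = A @ x # B @ C" "pos L x = length A" "pos L y = length A + 1 + length B"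
    "upd L x y = A @ B @ (if y = 0 then [] else [y]) @ C" by (rule upd_decompose)
  have dist: "distinct (A @ x # B @ C)" using slist_distinct[OF L] *(1) by simp
  have yx: "y \<noteq> x" "y \<noteq> 0 \<Longrightarrow> y \<notin> set (A @ x # B @ C)"
    using y xL L *(1) codes_pos by (auto simp: slist_def)
  obtain k where k: "m = length A + k" using m *(2) le_Suc_ex by auto
  show ?thesis
  proof (cases "k \<le> length B")
    case True
    then have t1: "set (take m (upd L x y)) = set A \<union> set (take k B)"
      unfolding *(4) k by simp
    have "set (take (Suc m) L) = set A \<union> insert x (set (take k B))"
      unfolding k by (subst *(1)) (use True in simp)
    moreover have "set (take (Suc m) L) = insert (L ! m) (set (take m L))"
    proof -
      have "m < length L" unfolding k by (subst *(1)) (use True in simp)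
      then show ?thesis by (simp add: take_Suc_conv_app_nth)
    qed
    moreover have "nth0 L m = L ! m"
    proof -
      have "m < length L" unfolding k by (subst *(1)) (use True in simp)
      then show ?thesis by (simp add: nth0_def)
    qed
    moreover have "m < pos L y" unfolding *(3) k using True by simp
    moreover have "x \<notin> set A \<union> set (take k B)" using dist by (auto dest: in_set_takeD)
    ultimately show ?thesis unfolding t1 by auto
  next
    case False
    then obtain j where j: "k = length B + 1 + j" using less_imp_Suc_add by fastforce
    have "\<not> m < pos L y" unfolding *(3) k j by simp
    moreover have "set (take m L) = set A \<union> insert x (set B) \<union> set (take j C)"
      unfolding k j by (subst *(1)) auto
    moreover have "set (take m (upd L x y)) = set A \<union> set B \<union> (if y = 0 then {} else {y}) \<union> set (take j C)"
    proof (cases "y = 0")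
      case True
      then have "C = []" using pos_0[OF L] *(1,3) by simp
      then show ?thesis unfolding *(4) k j using True by auto
    next
      case False
      then show ?thesis unfolding *(4) k j by auto
    qed
    moreover have "x \<notin> set A \<union> set B \<union> set (take j C)" using dist by (auto dest: in_set_takeD)
    ultimately show ?thesis using yx by auto
  qed
qed

end

end

section \<open>Deletion\<close>

notation Seq (infixr ";;" 60)

text \<open>Implements \<open>lt\<close>. The tests for zero come first because truncated
  subtraction would turn the code 0 into the element numbered 0.\<close>

definition lighter_com :: "vname \<Rightarrow> aexp \<Rightarrow> aexp \<Rightarrow> com" where
  "lighter_com r a b = Cond a
     (Cond b (Lighter r (Sub a (Const 1)) (Sub b (Const 1))) (Assign r (Const 1)))
     (Assign r (Const 0))"

text \<open>
  The element numbered \<open>i\<close> is coded as \<open>i + 1\<close>; the code \<open>0\<close> means ``none'' and counts as infinitely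
  heavy. A node of the tree on level \<open>k\<close> that covers the codes \<open>p + 1, \<dots>, p + 2 ^ k\<close> owns the array
  cells from \<open>k * W + p\<close> on, where \<open>W\<close> exceeds the number of leaves. Its list \<open>L\<close> of codes, sorted by
  weight, is linked by \<open>''N''\<close>; every \<open>K\<close>-th entry is stored in \<open>''B''\<close>, the handle of the set of all
  earlier entries in \<open>''H''\<close>, and the number of these marks in \<open>''T''\<close>. The arrays \<open>''C''\<close> and \<open>''S''\<close>
  hold the greedy basis of a node and its size during the initialization, and \<open>''L''\<close> the position of
  a code in \<open>''basis''\<close>.
\<close>

definition scan_body :: com where
  "scan_body =
     lighter_com ''g'' (Arr ''B'' (Add (Var ''o'') (Var ''b''))) (Var ''t'') ;;
     Cond (Var ''g'') (Assign ''p'' (Arr ''B'' (Add (Var ''o'') (Var ''b'')))) Skip ;;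
     Assign ''b'' (Add (Var ''b'') (Const 1))"

definition walk_body :: com where
  "walk_body =
     Assign ''p'' (Arr ''N'' (Add (Var ''l'') (Var ''p''))) ;;
     lighter_com ''g'' (Arr ''N'' (Add (Var ''l'') (Var ''p''))) (Var ''t'')"

text \<open>Leaves in \<open>p\<close> the last entry lighter than \<open>t\<close>, or 0. Every
  lighter mark overwrites \<open>p\<close>; the links then have to be followed inside one block
  only.\<close>

definition find_pred :: com where
  "find_pred =
     (Assign ''p'' (Const 0) ;; Assign ''b'' (Const 0)) ;;
     While (Less (Var ''b'') (Var ''c'')) scan_body ;;
     Cond (Var ''p'')
       (lighter_com ''g'' (Arr ''N'' (Add (Var ''l'') (Var ''p''))) (Var ''t'') ;;
        While (Var ''g'') walk_body)
       Skip"

text \<open>Comparing the old mark with \<open>x\<close> and \<open>y\<close> decides between the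
  cases of \<open>nth0_upd\<close>, and \<open>e\<close> is the entry that joins the prefix as in
  \<open>set_take_upd\<close>. The successor of a mark is read from the old links, so the marks must
  be shifted before the links change.\<close>

definition shift_body :: com where
  "shift_body =
     Assign ''v'' (Arr ''B'' (Add (Var ''o'') (Var ''b''))) ;;
     lighter_com ''g'' (Var ''v'') (Var ''x'') ;;
     Cond (Var ''g'') Skip (
       lighter_com ''g'' (Var ''v'') (Var ''y'') ;;
       Cond (Var ''g'')
         (Assign ''e'' (Var ''v'') ;;
          Assign ''u'' (Arr ''N'' (Add (Var ''l'') (Var ''v''))) ;;
          lighter_com ''g'' (Var ''u'') (Var ''y'') ;;
          Cond (Var ''g'')
            (Store ''B'' (Add (Var ''o'') (Var ''b'')) (Var ''u''))
            (Store ''B'' (Add (Var ''o'') (Var ''b'')) (Var ''y'')))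
         (Assign ''e'' (Var ''y'')) ;;
       Assign ''h'' (Arr ''H'' (Add (Var ''o'') (Var ''b''))) ;;
       Cond (Var ''e'') (Insert ''h'' (Var ''h'') (Sub (Var ''e'') (Const 1))) Skip ;;
       Remove ''h'' (Var ''h'') (Sub (Var ''x'') (Const 1)) ;;
       Store ''H'' (Add (Var ''o'') (Var ''b'')) (Var ''h'')) ;;
     Assign ''b'' (Add (Var ''b'') (Const 1))"

definition shift_com :: com where
  "shift_com = Assign ''b'' (Const 0) ;; While (Less (Var ''b'') (Var ''c'')) shift_body"

text \<open>\<open>p\<close> and \<open>r\<close> are the predecessors of \<open>y\<close> and
  \<open>x\<close>. As \<open>y\<close> is linked in first, the case \<open>p = x\<close> works too:
  the link of \<open>x\<close> then already leads to \<open>y\<close>. If \<open>x\<close> heads the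
  list, no link has to change for it, because the head is mark 0.\<close>

definition link_com :: com where
  "link_com =
     Cond (Var ''y'')
       (Store ''N'' (Add (Var ''l'') (Var ''y'')) (Arr ''N'' (Add (Var ''l'') (Var ''p''))) ;;
        Store ''N'' (Add (Var ''l'') (Var ''p'')) (Var ''y''))
       Skip ;;
     Cond (Var ''r'')
       (Store ''N'' (Add (Var ''l'') (Var ''r'')) (Arr ''N'' (Add (Var ''l'') (Var ''x''))))
       Skip"

definition probe_body :: com where
  "probe_body =
     Rank ''u'' (Arr ''H'' (Add (Var ''o'') (Var ''b''))) ;;
     Insert ''h'' (Arr ''H'' (Add (Var ''o'') (Var ''b''))) (Sub (Var ''x'') (Const 1)) ;;
     Rank ''v'' (Var ''h'') ;;
     Cond (Less (Var ''u'') (Var ''v'')) (Assign ''b'' (Add (Var ''b'') (Const 1)))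
       (Assign ''g'' (Const 0))"

definition advance_body :: com where
  "advance_body =
     Insert ''h'' (Var ''h'') (Sub (Var ''e'') (Const 1)) ;;
     Rank ''u'' (Var ''h'') ;;
     Insert ''f'' (Var ''h'') (Sub (Var ''x'') (Const 1)) ;;
     Rank ''v'' (Var ''f'') ;;
     Cond (Less (Var ''u'') (Var ''v'')) (Assign ''e'' (Arr ''N'' (Add (Var ''l'') (Var ''e''))))
       (Assign ''g'' (Const 0))"

text \<open>The products in the loop tests act as conjunctions. \<open>b\<close> starts at 1 because
  the prefix of mark 0 is empty and cannot span an \<open>x\<close> that is no loop; afterwards the
  walk starts at mark \<open>b - 1\<close>, the last one whose prefix is known not to span
  \<open>x\<close>.\<close>

definition search_com :: com where
  "search_com =
     (Assign ''b'' (Const 1) ;; Assign ''g'' (Const 1)) ;;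
     While (Mul (Var ''g'') (Less (Var ''b'') (Var ''c''))) probe_body ;;
     (Assign ''e'' (Arr ''B'' (Add (Var ''o'') (Sub (Var ''b'') (Const 1)))) ;;
      Assign ''h'' (Arr ''H'' (Add (Var ''o'') (Sub (Var ''b'') (Const 1)))) ;;
      Assign ''g'' (Const 1)) ;;
     While (Mul (Var ''g'') (Var ''e'')) advance_body"

section \<open>Comparisons and rank queries on codes\<close>

context numbered_matroid
begin

lemma wpl_lighter [simp]:
  "aval a s \<le> n \<Longrightarrow> aval b s \<le> n \<Longrightarrow>
   wpl (lighter_com r a b) Q s = Q (set_var r (if lt (aval a s) (aval b s) then 1 else 0) s)"
  by (auto simp: lighter_com_def lt_def wt_def elem_def)

lemma com_cost_lighter [simp]:
  "com_cost (lighter_com r a b) = 14 + 2 * expr_cost a + 2 * expr_cost b + expr_digits a + expr_digits b"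
  by (simp add: lighter_com_def)

text \<open>The left summand of the expansion \<open>4 * n\<^sup>2 + 16 * n + 16\<close> of
  \<open>value_bound n\<close> is dropped.\<close>

lemma le_vmax: "m \<le> 16 * n + 16 \<Longrightarrow> m \<le> vmax s"
  unfolding vmax_def by (simp add: value_bound_def power2_eq_square algebra_simps)

definition agree :: "vname set \<Rightarrow> 'a state \<Rightarrow> 'a state \<Rightarrow> bool" where
  "agree Z s s' \<longleftrightarrow> (\<forall>z. z \<notin> Z \<longrightarrow> vars s' z = vars s z)"

lemma elem_minus: "Y \<subseteq> codes \<Longrightarrow> x \<in> codes \<Longrightarrow> elem ` Y - {elem x} = elem ` (Y - {x})"
  using inj_on_image_set_diff[OF elem_inj, of Y "{x}"] by (simp add: subset_insertI2 Diff_subset[THEN order_trans])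

lemma el_elem: "el (e - Suc 0) = elem e"
  by (simp add: elem_def)

lemma rank_elem:
  "matroid_rank indep (elem ` Y) = rnk Y"
  "matroid_rank indep (insert (elem x) (elem ` Y)) = rnk (insert x Y)"
  "matroid_rank indep (insert (elem x) (insert (elem y) (elem ` Y))) = rnk (insert x (insert y Y))"
  by (simp_all add: rnk_def)

text \<open>This is how the programs decide spanning: two rank queries and one comparison.\<close>

lemma rnk_less_iff: "Y \<subseteq> codes \<Longrightarrow> x \<in> codes \<Longrightarrow> rnk Y < rnk (insert x Y) \<longleftrightarrow> x \<notin> cl Y"
  using r_insert_ge[of Y x] by (auto simp: cl_def)

end

section \<open>Procedures on the list of one node\<close>

locale blocked = numbered_matroid U indep n el w
  for U :: "'a set" and indep n el w + fixes K :: nat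
begin

definition chained :: "'a state \<Rightarrow> nat \<Rightarrow> nat list \<Rightarrow> bool" where
  "chained s l L \<longleftrightarrow> (\<forall>m<length L. arrs s ''N'' (l + L ! m) = nth0 L (m + 1))"

text \<open>The marks cover the list but may outnumber its blocks: once deletions have shortened the
  list, surplus marks read 0.\<close>

definition marked :: "'a state \<Rightarrow> nat \<Rightarrow> nat \<Rightarrow> nat list \<Rightarrow> bool" where
  "marked s q c L \<longleftrightarrow> length L \<le> c * K \<and> (\<forall>b<c. arrs s ''B'' (q + b) = nth0 L (b * K))"

definition handle :: "'a state \<Rightarrow> nat \<Rightarrow> nat set \<Rightarrow> bool" where
  "handle s h Y \<longleftrightarrow> h < length (created s) \<and> created s ! h = elem ` Y"

definition prefixes :: "'a state \<Rightarrow> nat \<Rightarrow> nat \<Rightarrow> nat list \<Rightarrow> bool" where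
  "prefixes s q c L \<longleftrightarrow> (\<forall>b<c. handle s (arrs s ''H'' (q + b)) (set (take (b * K) L)))"

lemma handle_mono: "handle s h Y \<Longrightarrow> created s' = created s @ ys \<Longrightarrow> handle s' h Y"
  by (auto simp: handle_def nth_append)

lemma find_pred_correct:
  assumes L: "slist L" and ch: "chained s0 (vars s0 ''l'') L"
    and bl: "marked s0 (vars s0 ''o'') (vars s0 ''c'') L"
    and t: "vars s0 ''t'' \<le> n" and c: "vars s0 ''c'' \<le> 2 * n + 2"
  shows "wpc find_pred (100 * (vars s0 ''c'' + K + 3)) (\<lambda>s.
    vars s ''p'' = (if pos L (vars s0 ''t'') = 0 then 0 else L ! (pos L (vars s0 ''t'') - 1)) \<and>
    agree {''p'', ''b'', ''g''} s0 s \<and> arrs s = arrs s0 \<and> created s = created s0) s0"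
    (is "wpc _ _ ?Q s0")
proof -
  define i where "i = pos L (vars s0 ''t'')"
  have iL: "i \<le> length L" unfolding i_def by (rule pos_le)
  let ?c = "vars s0 ''c''"
  define fr where "fr s \<longleftrightarrow> agree {''p'', ''b'', ''g''} s0 s \<and> arrs s = arrs s0 \<and> created s = created s0" for s
  have frD: "arrs s = arrs s0" "vars s ''o'' = vars s0 ''o''" "vars s ''l'' = vars s0 ''l''"
    "vars s ''c'' = ?c" "vars s ''t'' = vars s0 ''t''" if "fr s" for s
    using that by (auto simp: fr_def agree_def)
  \<comment> \<open>With \<open>b\<close> marks scanned, \<open>p\<close> is the last one at an
    index below the target \<open>i\<close>: either it is the newest mark, or the mark after it is
    no longer below \<open>i\<close>.\<close>
  define P where "P b p \<longleftrightarrow> (i = 0 \<longrightarrow> p = 0) \<and> (0 < i \<and> 0 < b \<longrightarrow>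
      (\<exists>k. k < b \<and> p = L ! (k * K) \<and> k * K < i \<and> (k + 1 = b \<or> i \<le> (k + 1) * K)))" for b p
  define I1 where "I1 m s \<longleftrightarrow> fr s \<and> vars s ''b'' \<le> ?c \<and> m = ?c - vars s ''b'' \<and>
    P (vars s ''b'') (vars s ''p'')" for m s
  \<comment> \<open>\<open>g\<close> holds the outcome of the test on the successor, so it is 0
    exactly when \<open>j\<close> is the last index below \<open>i\<close>.\<close>
  define I2 where "I2 m s \<longleftrightarrow> fr s \<and> (\<exists>j<i. vars s ''p'' = L ! j \<and> m = i - 1 - j \<and>
    vars s ''g'' = (if j + 1 < i then 1 else 0))" for m s
  have B: "arrs s0 ''B'' (vars s0 ''o'' + b) = nth0 L (b * K)" if "b < ?c" for b
    using bl that by (simp add: marked_def)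
  have lti: "lt (nth0 L m) (vars s0 ''t'') \<longleftrightarrow> m < i" for m
    using lt_nth0[OF L] by (simp add: i_def)
  have N: "arrs s0 ''N'' (vars s0 ''l'' + L ! m) = nth0 L (m + 1)" if "m < length L" for m
    using ch that by (simp add: chained_def)
  have step1: "wpc scan_body 90 (\<lambda>s'. \<exists>m'<m. I1 m' s') s"
    if I: "I1 m s" and b: "aval (Less (Var ''b'') (Var ''c'')) s \<noteq> 0" for m s
  proof (rule wpc_straight)
    have fr: "fr s" using I by (simp add: I1_def)
    note [simp] = frD[OF fr]
    let ?b = "vars s ''b''"
    have bc: "?b < ?c" using b by (simp split: if_splits)
    have P: "P ?b (vars s ''p'')" using I by (simp add: I1_def)
    have P': "P (?b + 1) (if ?b * K < i then nth0 L (?b * K) else vars s ''p'')"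
    proof (cases "?b * K < i")
      case True
      then show ?thesis using iL by (auto simp: P_def nth0_def intro!: exI[of _ ?b])
    next
      case False
      have "\<exists>k<?b + 1. vars s ''p'' = L ! (k * K) \<and> k * K < i \<and> (k + 1 = ?b + 1 \<or> i \<le> (k + 1) * K)"
        if "0 < i"
      proof -
        have "0 < ?b" using False that by (cases "?b = 0") auto
        with P that obtain k where k: "k < ?b" "vars s ''p'' = L ! (k * K)" "k * K < i"
          "k + 1 = ?b \<or> i \<le> (k + 1) * K" by (auto simp: P_def)
        then have "i \<le> (k + 1) * K" using False by (metis not_less)
        with k show ?thesis by (intro exI[of _ k]) auto
      qed
      with P False show ?thesis by (auto simp: P_def)
    qed
    have bv: "Suc ?b \<le> vmax s'" for s' using bc c by (intro le_vmax) simp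
    have "wpl scan_body (I1 (m - 1)) s"
    proof (cases "?b * K < i")
      case True
      then show ?thesis using fr P' I bc bv
        by (simp add: scan_body_def B nth0_le[OF L] t lti I1_def fr_def agree_def)
    next
      case False
      then show ?thesis using fr P' I bc bv
        by (simp add: scan_body_def B nth0_le[OF L] t lti I1_def fr_def agree_def)
    qed
    then show "wpl scan_body (\<lambda>s'. \<exists>m'<m. I1 m' s') s"
      by (rule wpl_mono) (use I bc in \<open>auto simp: I1_def intro!: exI[of _ "m - 1"]\<close>)
    show "com_cost scan_body \<le> 90" by (simp add: scan_body_def)
  qed
  have step2: "wpc walk_body 90 (\<lambda>s'. \<exists>m'<m. I2 m' s') s"
    if I: "I2 m s" and b: "aval (Var ''g'') s \<noteq> 0" for m s
  proof (rule wpc_straight)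
    have fr: "fr s" using I by (simp add: I2_def)
    note [simp] = frD[OF fr]
    from I obtain j where j: "j < i" "vars s ''p'' = L ! j" "m = i - 1 - j"
      "vars s ''g'' = (if j + 1 < i then 1 else 0)" by (auto simp: I2_def)
    with b have ji: "Suc j < i" by (auto split: if_splits)
    then have jL: "j < length L" "Suc j < length L" using iL by auto
    have "nth0 L (Suc j) = L ! Suc j" using jL by (simp add: nth0_def)
    then have "wpl walk_body (I2 (m - 1)) s"
      using fr j ji jL N[of j] N[of "Suc j"] lti[of "Suc (Suc j)"] nth0_le[OF L, of "Suc (Suc j)"] t
      by (auto simp: walk_body_def I2_def fr_def agree_def)
    then show "wpl walk_body (\<lambda>s'. \<exists>m'<m. I2 m' s') s"
      using j ji by (elim wpl_mono) (auto intro!: exI[of _ "m - 1"])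
    show "com_cost walk_body \<le> 90" by (simp add: walk_body_def)
  qed
  have init: "wpc (Assign ''p'' (Const 0) ;; Assign ''b'' (Const 0)) 10 (I1 ?c) s0"
    by (rule wpc_straight) (auto simp: I1_def fr_def agree_def P_def)
  have scan: "wpc (While (Less (Var ''b'') (Var ''c'')) scan_body) (100 * (?c + 1)) (I1 0) s"
    if "I1 ?c s" for s
    by (rule wpc_whileI[OF that step1]) (auto simp: I1_def dest: frD(4) split: if_splits)
  have walk: "wpc (Cond (Var ''p'')
      (lighter_com ''g'' (Arr ''N'' (Add (Var ''l'') (Var ''p''))) (Var ''t'') ;;
        While (Var ''g'') walk_body) Skip) (100 * (K + 1)) ?Q s" if s: "I1 0 s" for s
  proof -
    have fr: "fr s" using s by (simp add: I1_def)
    note [simp] = frD[OF fr]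
    show ?thesis
    proof (cases "i = 0")
      case True
      then have "vars s ''p'' = 0" using s by (simp add: I1_def P_def)
      then show ?thesis using fr True unfolding i_def
        by (intro wpc_condI[where N = 1]) (auto simp: fr_def intro!: wpc_straight)
    next
      case False
      then have "length L > 0" using iL by linarith
      then have c0: "0 < ?c" using bl by (auto simp: marked_def intro: ccontr)
      have b: "vars s ''b'' = ?c" using s by (auto simp: I1_def)
      obtain k where k: "k < ?c" "vars s ''p'' = L ! (k * K)" "k * K < i"
        "k + 1 = ?c \<or> i \<le> (k + 1) * K"
      proof -
        have "P ?c (vars s ''p'')" "0 < i" using s b False by (auto simp: I1_def)
        with c0 that show thesis unfolding P_def by blast
      qed
      \<comment> \<open>If \<open>k\<close> is the last mark, the bound comes from the fact that the
        marks cover the whole list.\<close>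
      have iK: "i \<le> k * K + K"
      proof (cases "i \<le> (k + 1) * K")
        case False
        then have "i \<le> (k + 1) * K" using k bl iL by (auto simp: marked_def)
        with False show ?thesis by simp
      qed (simp add: algebra_simps)
      have kL: "k * K < length L" using k iL by simp
      have l0: "wpc (lighter_com ''g'' (Arr ''N'' (Add (Var ''l'') (Var ''p''))) (Var ''t'')) 60 (I2 (i - 1 - k * K)) s"
        using k fr kL N[of "k * K"] lti[of "Suc (k * K)"] nth0_le[OF L, of "Suc (k * K)"] t
        by (intro wpc_straight) (auto simp: I2_def fr_def agree_def intro!: exI[of _ "k * K"])
      have l1: "wpc (While (Var ''g'') walk_body) (100 * K) ?Q s'" if "I2 (i - 1 - k * K) s'" for s'
      proof (rule wpc_whileI[OF that step2])
        fix m s assume "I2 m s" "aval (Var ''g'') s = 0"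
        then show "?Q s" using False by (auto simp: I2_def fr_def i_def split: if_splits dest: less_antisym)
      next
        have "(i - 1 - k * K + 1) * (90 + 1 + expr_cost (Var ''g'')) \<le> K * 100"
          using iK k(3) by (intro mult_le_mono) auto
        then show "(i - 1 - k * K + 1) * (90 + 1 + expr_cost (Var ''g'')) \<le> 100 * K" by simp
      qed
      have p0: "vars s ''p'' \<noteq> 0" using k slist_codes[OF L kL] codes_pos by fastforce
      have "wpc (lighter_com ''g'' (Arr ''N'' (Add (Var ''l'') (Var ''p''))) (Var ''t'') ;;
        While (Var ''g'') walk_body) (60 + 100 * K) ?Q s"
        by (rule wpc_seqI[OF l0 l1 order_refl])
      then show ?thesis using p0 by (intro wpc_condI[where N = "60 + 100 * K"]) auto
    qed
  qed
  show ?thesis unfolding find_pred_def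
    by (rule wpc_seqI[OF init wpc_seqI[OF scan walk]]) auto
qed

end

lemma nth0_nth: "m < length L \<Longrightarrow> nth0 L m = L ! m"
  by (simp add: nth0_def)

context blocked
begin

context
  fixes L x y
  assumes L: "slist L" and xL: "x \<in> set L" and y: "y = 0 \<or> y \<in> codes \<and> y \<notin> set L \<and> wt x < wt y"
begin

lemma upd_bounds: "x \<in> codes" "0 < x" "x \<le> n" "y \<le> n"
  using L xL y codes_pos codes_le by (auto simp: slist_def)

lemma shift_correct:
  assumes xv: "vars s0 ''x'' = x" and yv: "vars s0 ''y'' = y"
    and ch: "chained s0 (vars s0 ''l'') L"
    and bl: "marked s0 (vars s0 ''o'') (vars s0 ''c'') L"
    and hd: "prefixes s0 (vars s0 ''o'') (vars s0 ''c'') L"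
    and c: "vars s0 ''c'' \<le> 2 * n + 2"
  shows "wpc shift_com (320 * (vars s0 ''c'' + 2)) (\<lambda>s.
      agree {''v'', ''g'', ''e'', ''u'', ''h'', ''b''} s0 s \<and>
      marked s (vars s0 ''o'') (vars s0 ''c'') (upd L x y) \<and>
      prefixes s (vars s0 ''o'') (vars s0 ''c'') (upd L x y) \<and>
      (\<forall>a. a \<notin> {''B'', ''H''} \<longrightarrow> arrs s a = arrs s0 a) \<and>
      (\<forall>a i. i \<notin> {vars s0 ''o''..<vars s0 ''o'' + vars s0 ''c''} \<longrightarrow> arrs s a i = arrs s0 a i) \<and>
      (\<exists>ys. created s = created s0 @ ys)) s0" (is "wpc _ _ ?Q s0")
proof -
  let ?c = "vars s0 ''c''" and ?o = "vars s0 ''o''" and ?l = "vars s0 ''l''"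
  define L' where "L' = upd L x y"
  define i where "i = pos L x"
  define j where "j = pos L y"
  note xb = upd_bounds
  have L': "slist L'" unfolding L'_def by (rule slist_upd[OF L xL y])
  have ij: "i < j" "i < length L" using upd_pos[OF L xL y] by (auto simp: i_def j_def)
  have jL: "j \<le> length L" unfolding j_def by (rule pos_le)
  define fr where "fr s \<longleftrightarrow> agree {''v'', ''g'', ''e'', ''u'', ''h'', ''b''} s0 s \<and>
      (\<forall>a. a \<notin> {''B'', ''H''} \<longrightarrow> arrs s a = arrs s0 a) \<and>
      (\<exists>ys. created s = created s0 @ ys)" for s
  have frD: "arrs s ''N'' = arrs s0 ''N''" "vars s ''o'' = ?o" "vars s ''l'' = ?l"
    "vars s ''c'' = ?c" "vars s ''x'' = x" "vars s ''y'' = y" if "fr s" for s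
    using that xv yv by (auto simp: fr_def agree_def)
  define I where "I m s \<longleftrightarrow> fr s \<and> vars s ''b'' \<le> ?c \<and> m = ?c - vars s ''b'' \<and>
      (\<forall>k<vars s ''b''. arrs s ''B'' (?o + k) = nth0 L' (k * K) \<and>
          handle s (arrs s ''H'' (?o + k)) (set (take (k * K) L'))) \<and>
      (\<forall>a t. t \<notin> {?o..<?o + vars s ''b''} \<longrightarrow> arrs s a t = arrs s0 a t)" for m s
  have B: "arrs s0 ''B'' (?o + b) = nth0 L (b * K)" if "b < ?c" for b
    using bl that by (simp add: marked_def)
  have H: "handle s0 (arrs s0 ''H'' (?o + b)) (set (take (b * K) L))" if "b < ?c" for b
    using hd that by (simp add: prefixes_def)
  have ltx: "lt (nth0 L m) x \<longleftrightarrow> m < i" for m using lt_nth0[OF L] by (simp add: i_def)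
  have lty: "lt (nth0 L m) y \<longleftrightarrow> m < j" for m using lt_nth0[OF L] by (simp add: j_def)
  have N: "arrs s0 ''N'' (?l + L ! m) = nth0 L (m + 1)" if "m < length L" for m
    using ch that by (simp add: chained_def)
  have n0: "nth0 L' m = (if m < i then nth0 L m else if m + 1 < j then nth0 L (m + 1)
     else if m + 1 = j then y else nth0 L m)" for m
    unfolding L'_def i_def j_def by (rule nth0_upd[OF L xL y])
  have step: "wpc shift_body 310 (\<lambda>s'. \<exists>m'<m. I m' s') s"
    if I: "I m s" and b: "aval (Less (Var ''b'') (Var ''c'')) s \<noteq> 0" for m s
  proof (rule wpc_straight)
    have fr: "fr s" using I by (simp add: I_def)
    note [simp] = frD[OF fr]
    define b where "b = vars s ''b''"
    have bc: "b < ?c" using that(2) by (simp add: b_def split: if_splits)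
    have bv: "Suc b \<le> vmax s'" for s' using bc c by (intro le_vmax) simp
    have Bs: "arrs s ''B'' (?o + b) = nth0 L (b * K)" "arrs s ''H'' (?o + b) = arrs s0 ''H'' (?o + b)"
      using I B[OF bc] by (auto simp: I_def b_def)
    define h where "h = arrs s0 ''H'' (?o + b)"
    obtain ys where ys: "created s = created s0 @ ys" using fr by (auto simp: fr_def)
    have hs: "h < length (created s)" "created s ! h = elem ` set (take (b * K) L)"
      using handle_mono[OF H[OF bc] ys] by (auto simp: handle_def h_def)
    have tL: "set (take (b * K) L) \<subseteq> codes" using L by (auto simp: slist_def dest: in_set_takeD)
    \<comment> \<open>Earlier marks stay correct because created sets never change and keep their
      positions.\<close>
    have old: "handle s' (arrs s ''H'' (?o + k)) (set (take (k * K) L'))"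
      if "k < b" "created s' = created s @ zs" for k s' zs
      using I handle_mono[OF _ that(2)] that(1) by (auto simp: I_def b_def)
    have oldB: "arrs s ''B'' (?o + k) = nth0 L' (k * K)" if "k < b" for k
      using I that by (auto simp: I_def b_def)
    have out: "arrs s a t = arrs s0 a t" if "t \<notin> {?o..<?o + b}" for a t
      using I that by (auto simp: I_def b_def)
    have m: "m = ?c - b" using I by (simp add: I_def b_def)
    have Ii: "\<exists>m'<m. I m' s'"
      if "fr s'" "vars s' ''b'' = Suc b" "arrs s' ''B'' (?o + b) = nth0 L' (b * K)"
        "handle s' (arrs s' ''H'' (?o + b)) (set (take (b * K) L'))"
        "\<And>a t. t \<noteq> ?o + b \<Longrightarrow> arrs s' a t = arrs s a t"
        "\<exists>zs. created s' = created s @ zs" for s'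
    proof -
      have "handle s' (arrs s' ''H'' (?o + k)) (set (take (k * K) L'))" if "k < Suc b" for k
      proof (cases "k = b")
        case False
        then have "k < b" using that by simp
        then show ?thesis using old[of k s'] \<open>\<exists>zs. created s' = created s @ zs\<close>
          \<open>\<And>a t. t \<noteq> ?o + b \<Longrightarrow> arrs s' a t = arrs s a t\<close> by auto
      qed (use that in \<open>simp add: \<open>handle s' (arrs s' ''H'' (?o + b)) (set (take (b * K) L'))\<close>\<close>)
      moreover have "arrs s' ''B'' (?o + k) = nth0 L' (k * K)" if "k < Suc b" for k
        using oldB[of k] that \<open>\<And>a t. t \<noteq> ?o + b \<Longrightarrow> arrs s' a t = arrs s a t\<close>
          \<open>arrs s' ''B'' (?o + b) = nth0 L' (b * K)\<close> by (cases "k = b") auto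
      moreover have "arrs s' a t = arrs s0 a t" if "t \<notin> {?o..<?o + Suc b}" for a t
        using out[of t a] that \<open>\<And>a t. t \<noteq> ?o + b \<Longrightarrow> arrs s' a t = arrs s a t\<close> by auto
      ultimately have "I (?c - Suc b) s'"
        unfolding I_def using that(1,2) bc by auto
      then show ?thesis using m bc by (intro exI[of _ "?c - Suc b"]) auto
    qed
    have fr': "agree {''v'', ''g'', ''e'', ''u'', ''h'', ''b''} s0 s"
      "\<And>a. a \<noteq> ''B'' \<Longrightarrow> a \<noteq> ''H'' \<Longrightarrow> arrs s a = arrs s0 a"
      using fr by (auto simp: fr_def)
    have frx: "\<exists>ya. created s @ zs = created s0 @ ya" "\<exists>ya. created s = created s0 @ ya" for zs
      using ys by auto
    have xn: "x - Suc 0 < n" using xb by linarith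
    note simps = xn shift_body_def el_elem Bs h_def[symmetric] hs nth0_le[OF L] ltx lty xb bv b_def[symmetric]
    show "wpl shift_body (\<lambda>s'. \<exists>m'<m. I m' s') s"
    proof (cases "b * K < i")
      case True
      then have "take (b * K) L' = take (b * K) L" unfolding L'_def i_def
        by (intro take_upd_before[OF L xL y]) simp
      then show ?thesis using True fr' hs n0[of "b * K"]
        by (simp add: simps, intro Ii; simp add: frx Bs h_def[symmetric] agree_def fr_def handle_def nth_append)
    next
      case ge: False
      have sT: "set (take (b * K) L') =
        (set (take (b * K) L) \<union> (if b * K < j then {nth0 L (b * K)} else if y = 0 then {} else {y})) - {x}"
        unfolding L'_def j_def using ge by (intro set_take_upd[OF L xL y]) (simp add: i_def)
      show ?thesis
      proof (cases "b * K < j")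
        case True
        then have bL: "b * K < length L" using jL by simp
        define v where "v = L ! (b * K)"
        have v: "nth0 L (b * K) = v" "v \<in> codes" "0 < v" "v \<le> n" "v - Suc 0 < n"
          using bL slist_codes[OF L bL] codes_pos[of v] codes_le[of v] by (auto simp: v_def nth0_def)
        have lv: "\<not> lt v x" "lt v y" using ltx[of "b * K"] lty[of "b * K"] v ge True by auto
        have Nv: "arrs s0 ''N'' (?l + v) = nth0 L (Suc (b * K))" using N[OF bL] by (simp add: v_def)
        \<comment> \<open>For \<open>b * K = i\<close> the entry \<open>v\<close> is
          \<open>x\<close> itself: the program inserts it and removes it again.\<close>
        have T1: "elem ` set (take (b * K) L') = insert (elem v) (elem ` set (take (b * K) L)) - {elem x}"
          using elem_minus[of "insert v (set (take (b * K) L))" x] tL v xb True sT by simp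
        show ?thesis
        proof (cases "Suc (b * K) < j")
          case True
          then have nn: "nth0 L' (b * K) = nth0 L (Suc (b * K))" using n0[of "b * K"] ge by simp
          show ?thesis using True fr' hs v Nv T1 lv nn lty[of "Suc (b * K)"] nth0_le[OF L, of "Suc (b * K)"]
            by (simp add: simps nth_append, intro Ii; simp add: frx Bs h_def[symmetric] agree_def fr_def handle_def nth_append)
        next
          case False
          then have nn: "nth0 L' (b * K) = y" using n0[of "b * K"] ge \<open>b * K < j\<close> by simp
          show ?thesis using False fr' hs v Nv T1 lv nn lty[of "Suc (b * K)"] nth0_le[OF L, of "Suc (b * K)"]
            by (simp add: simps nth_append, intro Ii; simp add: frx Bs h_def[symmetric] agree_def fr_def handle_def nth_append)
        qed
      next
        case False
        then have nn: "nth0 L' (b * K) = nth0 L (b * K)" using n0[of "b * K"] ge by simp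
        have lv: "\<not> lt (nth0 L (b * K)) x" "\<not> lt (nth0 L (b * K)) y"
          using ltx[of "b * K"] lty[of "b * K"] ge False by auto
        show ?thesis
        proof (cases "y = 0")
          case True
          have T1: "elem ` set (take (b * K) L') = elem ` set (take (b * K) L) - {elem x}"
            using elem_minus[of "set (take (b * K) L)" x] tL xb False True sT by simp
          show ?thesis using True fr' hs T1 lv nn
            by (simp add: simps nth_append, intro Ii; simp add: frx Bs h_def[symmetric] agree_def fr_def handle_def nth_append)
        next
          case y0: False
          then have yc: "y \<in> codes" "0 < y" "y - Suc 0 < n" using y codes_pos[of y] codes_le[of y] by auto
          have T1: "elem ` set (take (b * K) L') = insert (elem y) (elem ` set (take (b * K) L)) - {elem x}"
            using elem_minus[of "insert y (set (take (b * K) L))" x] tL yc xb False y0 sT by simp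
          show ?thesis using yc fr' hs T1 lv nn
            by (simp add: simps nth_append, intro Ii; simp add: frx Bs h_def[symmetric] agree_def fr_def handle_def nth_append)
        qed
      qed
    qed
    show "com_cost shift_body \<le> 310" by (simp add: shift_body_def)
  qed
  have init: "wpc (Assign ''b'' (Const 0)) 10 (I ?c) s0"
    by (rule wpc_straight) (auto simp: I_def fr_def agree_def)
  have loop: "wpc (While (Less (Var ''b'') (Var ''c'')) shift_body) (320 * (?c + 1)) ?Q s"
    if "I ?c s" for s
  proof (rule wpc_whileI[OF that step])
    fix m s assume I: "I m s" and e: "aval (Less (Var ''b'') (Var ''c'')) s = 0"
    then have fr: "fr s" by (simp add: I_def)
    have b: "vars s ''b'' = ?c" using I e frD[OF fr] by (auto simp: I_def split: if_splits)
    have "length L' \<le> ?c * K" using length_upd[OF L xL y] bl by (simp add: L'_def marked_def)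
    then show "?Q s" using I fr unfolding L'_def[symmetric]
      by (auto simp: I_def b fr_def marked_def prefixes_def)
  qed auto
  show ?thesis unfolding shift_com_def
    by (rule wpc_seqI[OF init loop]) auto
qed

lemma link_correct:
  assumes xv: "vars s0 ''x'' = x" and yv: "vars s0 ''y'' = y"
    and ch: "chained s0 (vars s0 ''l'') L"
    and p: "vars s0 ''p'' = (if pos L y = 0 then 0 else L ! (pos L y - 1))"
    and r: "vars s0 ''r'' = (if pos L x = 0 then 0 else L ! (pos L x - 1))"
  shows "wpc link_com 100 (\<lambda>s. vars s = vars s0 \<and> created s = created s0 \<and>
      chained s (vars s0 ''l'') (upd L x y) \<and>
      (\<forall>a. a \<noteq> ''N'' \<longrightarrow> arrs s a = arrs s0 a) \<and>
      (\<forall>e. e \<notin> insert y (set L) \<longrightarrow> arrs s ''N'' (vars s0 ''l'' + e) = arrs s0 ''N'' (vars s0 ''l'' + e)) \<and>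
      (\<forall>t<vars s0 ''l''. arrs s ''N'' t = arrs s0 ''N'' t)) s0"
    (is "wpc _ _ ?Q _")
proof (rule wpc_straight)
  define L' where "L' = upd L x y"
  define i where "i = pos L x"
  define j where "j = pos L y"
  let ?l = "vars s0 ''l''"
  have ij: "i < j" "i < length L" "L ! i = x" using upd_pos[OF L xL y] by (auto simp: i_def j_def)
  have jL: "j \<le> length L" unfolding j_def by (rule pos_le)
  have n0: "nth0 L' m = (if m < i then nth0 L m else if m + 1 < j then nth0 L (m + 1)
     else if m + 1 = j then y else nth0 L m)" for m
    unfolding L'_def i_def j_def by (rule nth0_upd[OF L xL y])
  have N: "arrs s0 ''N'' (?l + L ! m) = nth0 L (m + 1)" if "m < length L" for m
    using ch that by (simp add: chained_def)
  have eqL: "L ! k = L ! m \<longleftrightarrow> k = m" if "k < length L" "m < length L" for k m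
    using slist_distinct[OF L] that by (simp add: nth_eq_iff_index_eq)
  \<comment> \<open>\<open>N1\<close> is the link array after \<open>y\<close> has been linked in,
    \<open>N2\<close> the one after \<open>x\<close> has been bypassed. The predecessor
    \<open>L ! (j - 1)\<close> of \<open>y\<close> may be \<open>x\<close>.\<close>
  define N1 where "N1 = (if y = 0 then arrs s0 ''N'' else
    (arrs s0 ''N'')(?l + y := arrs s0 ''N'' (?l + L ! (j - 1)), ?l + L ! (j - 1) := y))"
  define N2 where "N2 = (if i = 0 then N1 else N1(?l + L ! (i - 1) := N1 (?l + x)))"
  have j1: "j - 1 < length L" "j - 1 + 1 = j" using ij jL by auto
  have yL: "y \<noteq> 0 \<Longrightarrow> L ! k \<noteq> y" if "k < length L" for k using y that by auto
  have N1L: "N1 (?l + L ! k) = (if k + 1 = j then y else nth0 L (k + 1))" if "k < length L" for k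
  proof (cases "y = 0")
    case True
    then have "j = length L" using pos_0[OF L] by (simp add: j_def)
    then show ?thesis using True N[OF that] by (auto simp: N1_def nth0_def)
  next
    case False
    then show ?thesis using N[OF that] eqL[OF that j1(1)] yL[OF that] j1 by (auto simp: N1_def)
  qed
  have N1y: "N1 (?l + y) = nth0 L j" if "y \<noteq> 0"
    using that N[OF j1(1)] yL[OF j1(1)] j1 by (auto simp: N1_def)
  have N2L: "N2 (?l + L' ! m) = nth0 L' (m + 1)" if m: "m < length L'" for m
  proof -
    have Lm: "L' ! m = nth0 L' m" using m by (simp add: nth0_def)
    consider "m + 1 < i" | "m + 1 = i" | "i \<le> m" "m + 1 < j" | "m + 1 = j" "i \<le> m" | "j \<le> m" by linarith
    then show ?thesis
    proof cases
      case 1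
      then have "L' ! m = L ! m" "m < length L" using ij by (auto simp: Lm n0 nth0_nth)
      then show ?thesis using 1 ij N1L[of m] eqL[of m "i - 1"] by (auto simp: N2_def n0)
    next
      case 2
      then have "L' ! m = L ! (i - 1)" "i \<noteq> 0" using ij by (auto simp: Lm n0 nth0_nth)
      then show ?thesis using 2 ij N1L[of i] by (auto simp: N2_def n0)
    next
      case 3
      then have "L' ! m = L ! (m + 1)" "m + 1 < length L" using ij jL by (auto simp: Lm n0 nth0_nth)
      then show ?thesis using 3 ij N1L[of "m + 1"] eqL[of "m + 1" "i - 1"] by (auto simp: N2_def n0)
    next
      case 4
      then have e: "L' ! m = y" using ij by (auto simp: Lm n0)
      \<comment> \<open>With \<open>y = 0\<close> this index would be the end of the updated list
        instead of an entry.\<close>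
      have y0: "y \<noteq> 0"
      proof
        assume "y = 0"
        then have "0 \<in> set L'" using e m nth_mem by fastforce
        moreover have "slist L'" unfolding L'_def by (rule slist_upd[OF L xL y])
        ultimately show False using codes_pos by (auto simp: slist_def)
      qed
      have "y \<noteq> L ! (i - 1)" if "i \<noteq> 0" using yL[of "i - 1"] y0 ij that by (metis less_imp_diff_less)
      then show ?thesis using 4 e N1y[OF y0] by (auto simp: N2_def n0)
    next
      case 5
      have "nth0 L' m \<noteq> 0" using Lm m slist_codes[OF slist_upd[OF L xL y]] codes_pos
        unfolding L'_def by (metis less_irrefl)
      then have "nth0 L m \<noteq> 0" "L' ! m = nth0 L m" using 5 ij by (auto simp: Lm n0)
      then have "L' ! m = L ! m" "m < length L" by (auto simp: nth0_def split: if_splits)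
      then show ?thesis using 5 ij N1L[of m] eqL[of m "i - 1"] by (auto simp: N2_def n0)
    qed
  qed
  have pr: "vars s0 ''p'' = L ! (j - 1)" "vars s0 ''r'' = (if i = 0 then 0 else L ! (i - 1))"
    using p r ij by (auto simp: i_def j_def)
  have cp: "L ! k \<in> set L" "0 < L ! k" if "k < length L" for k
    using that slist_codes[OF L] codes_pos by auto
  have run: "wpl link_com (\<lambda>s. s = s0\<lparr>arrs := (arrs s0)(''N'' := N2)\<rparr>) s0"
  proof (cases "y = 0"; cases "i = 0")
    assume "y = 0" "i = 0"
    then show ?thesis using pr xv yv by (simp add: link_com_def N1_def N2_def)
  next
    assume "y = 0" "i \<noteq> 0"
    moreover have "0 < L ! (i - 1)" using ij by (intro cp) simp
    ultimately show ?thesis using pr xv yv by (simp add: link_com_def N1_def N2_def)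
  next
    assume "y \<noteq> 0" "i = 0"
    then show ?thesis using pr xv yv by (simp add: link_com_def N1_def N2_def)
  next
    assume "y \<noteq> 0" "i \<noteq> 0"
    moreover have "0 < L ! (i - 1)" using ij by (intro cp) simp
    ultimately show ?thesis using pr xv yv by (simp add: link_com_def N1_def N2_def)
  qed
  have out: "N2 (?l + e) = arrs s0 ''N'' (?l + e)" if "e \<notin> insert y (set L)" for e
  proof -
    have "e \<noteq> L ! (i - 1)" "e \<noteq> L ! (j - 1)" "e \<noteq> y"
      using that cp(1)[of "i - 1"] cp(1)[of "j - 1"] ij j1 by auto
    then show ?thesis by (simp add: N2_def N1_def)
  qed
  have out': "N2 t = arrs s0 ''N'' t" if "t < ?l" for t
    using that by (auto simp: N2_def N1_def)
  show "wpl link_com ?Q s0"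
    by (rule wpl_mono[OF run]) (use N2L out out' in \<open>auto simp: chained_def L'_def\<close>)
  show "com_cost link_com \<le> 100" by (simp add: link_com_def)
qed

end

text \<open>Spanning is monotone in the length of the prefix, which is what makes a search by blocks
  possible.\<close>

lemma cl_take_mono: "slist L \<Longrightarrow> k \<le> m \<Longrightarrow> x \<in> cl (set (take k L)) \<Longrightarrow> x \<in> cl (set (take m L))"
  using cl_mono[of "set (take k L)" "set (take m L)"] set_take_subset_set_take[of k m L]
  by (auto simp: slist_def dest: in_set_takeD)

lemma search_correct:
  assumes L: "slist L" and x: "x \<in> codes" "x \<notin> cl {}" and xv: "vars s0 ''x'' = x"
    and ch: "chained s0 (vars s0 ''l'') L"
    and bl: "marked s0 (vars s0 ''o'') (vars s0 ''c'') L"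
    and hd: "prefixes s0 (vars s0 ''o'') (vars s0 ''c'') L"
    and c: "vars s0 ''c'' \<le> 2 * n + 2" "0 < vars s0 ''c''"
  shows "wpc search_com (110 * (vars s0 ''c'' + K + 4)) (\<lambda>s.
      agree {''b'', ''g'', ''u'', ''v'', ''h'', ''e'', ''f''} s0 s \<and> arrs s = arrs s0 \<and>
      (\<exists>ys. created s = created s0 @ ys) \<and>
      (\<exists>m\<le>length L. vars s ''e'' = nth0 L m \<and> x \<notin> cl (set (take m L)) \<and>
         (m < length L \<longrightarrow> x \<in> cl (set (take (m + 1) L))))) s0" (is "wpc _ _ ?Q s0")
proof -
  let ?c1 = "Assign ''e'' (Arr ''B'' (Add (Var ''o'') (Sub (Var ''b'') (Const 1)))) ;;
      Assign ''h'' (Arr ''H'' (Add (Var ''o'') (Sub (Var ''b'') (Const 1)))) ;;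
      Assign ''g'' (Const 1)"
  let ?c = "vars s0 ''c''" and ?o = "vars s0 ''o''" and ?l = "vars s0 ''l''"
  define fr where "fr s \<longleftrightarrow> agree {''b'', ''g'', ''u'', ''v'', ''h'', ''e'', ''f''} s0 s \<and> arrs s = arrs s0 \<and>
      (\<exists>ys. created s = created s0 @ ys)" for s
  have frD: "arrs s = arrs s0" "vars s ''o'' = ?o" "vars s ''l'' = ?l"
    "vars s ''c'' = ?c" "vars s ''x'' = x" if "fr s" for s
    using that xv by (auto simp: fr_def agree_def)
  have x': "0 < x" "x - Suc 0 < n" using x codes_pos codes_le by fastforce+
  have B: "arrs s0 ''B'' (?o + b) = nth0 L (b * K)" if "b < ?c" for b
    using bl that by (simp add: marked_def)
  have H: "handle s (arrs s0 ''H'' (?o + b)) (set (take (b * K) L))" if "b < ?c" "fr s" for b s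
    using hd that handle_mono by (auto simp: prefixes_def fr_def)
  have N: "arrs s0 ''N'' (?l + L ! m) = nth0 L (m + 1)" if "m < length L" for m
    using ch that by (simp add: chained_def)
  have tL: "set (take k L) \<subseteq> codes" for k using L by (auto simp: slist_def dest: in_set_takeD)
  \<comment> \<open>\<open>g = 0\<close> records that the loop stopped because prefix
    \<open>b\<close> spans \<open>x\<close>. Adding \<open>g\<close> to the variant lets clearing
    this flag count as progress.\<close>
  define I1 where "I1 m s \<longleftrightarrow> fr s \<and> 1 \<le> vars s ''b'' \<and> vars s ''b'' \<le> ?c \<and>
     vars s ''g'' \<le> 1 \<and> m = ?c - vars s ''b'' + vars s ''g'' \<and>
     x \<notin> cl (set (take ((vars s ''b'' - 1) * K) L)) \<and>
     (vars s ''g'' = 0 \<longrightarrow> x \<in> cl (set (take (vars s ''b'' * K) L)))" for m s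
  have step1: "wpc probe_body 90 (\<lambda>s'. \<exists>m'<m. I1 m' s') s"
    if I: "I1 m s" and b: "aval (Mul (Var ''g'') (Less (Var ''b'') (Var ''c''))) s \<noteq> 0" for m s
  proof (rule wpc_straight)
    have fr: "fr s" using I by (simp add: I1_def)
    note [simp] = frD[OF fr]
    define b where "b = vars s ''b''"
    have bc: "b < ?c" "vars s ''g'' = 1" using that by (auto simp: b_def I1_def split: if_splits)
    have bv: "Suc b \<le> vmax s'" for s' using bc c by (intro le_vmax) simp
    have h: "arrs s0 ''H'' (?o + b) < length (created s)"
      "created s ! arrs s0 ''H'' (?o + b) = elem ` set (take (b * K) L)"
      using H[OF bc(1) fr] by (auto simp: handle_def)
    have fr': "agree {''b'', ''g'', ''u'', ''v'', ''h'', ''e'', ''f''} s0 s"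
      using fr by (auto simp: fr_def)
    obtain ys where ys: "created s = created s0 @ ys" using fr by (auto simp: fr_def)
    have I': "1 \<le> b" "m = ?c - b + 1" "x \<notin> cl (set (take ((b - 1) * K) L))"
      using I bc by (auto simp: I1_def b_def)
    have run: "wpl probe_body (I1 (?c - b)) s"
    proof (cases "x \<in> cl (set (take (b * K) L))")
      case True
      then show ?thesis using I' fr' bc ys h x'
        by (simp add: bv probe_body_def I1_def fr_def agree_def b_def[symmetric] el_elem rank_elem
          rnk_less_iff[OF tL x(1)])
    next
      case False
      then show ?thesis using I' fr' bc ys h x'
        by (simp add: bv probe_body_def I1_def fr_def agree_def b_def[symmetric] el_elem rank_elem
          rnk_less_iff[OF tL x(1)])
    qed
    show "wpl probe_body (\<lambda>s'. \<exists>m'<m. I1 m' s') s"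
      by (rule wpl_mono[OF run]) (use I' in auto)
    show "com_cost probe_body \<le> 90" by (simp add: probe_body_def)
  qed
  have init1: "wpc (Assign ''b'' (Const 1) ;; Assign ''g'' (Const 1)) 10 (I1 ?c) s0"
    using x c by (intro wpc_straight) (auto simp: I1_def fr_def agree_def)
  define J where "J s \<longleftrightarrow> fr s \<and> 1 \<le> vars s ''b'' \<and> vars s ''b'' \<le> ?c \<and>
     x \<notin> cl (set (take ((vars s ''b'' - 1) * K) L)) \<and>
     (vars s ''b'' = ?c \<or> x \<in> cl (set (take (vars s ''b'' * K) L)))" for s
  have loop1: "wpc (While (Mul (Var ''g'') (Less (Var ''b'') (Var ''c''))) probe_body) (110 * (?c + 1)) J s"
    if "I1 ?c s" for s
    by (rule wpc_whileI[OF that step1]) (auto simp: I1_def J_def dest: frD(4) split: if_splits)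
  \<comment> \<open>The end of the block in which the walk takes place, cut off at the end of the
    list.\<close>
  define T where "T b = min (b * K) (length L)" for b
  define I2 where "I2 b m s \<longleftrightarrow> fr s \<and> vars s ''b'' = b \<and> (\<exists>k\<le>length L. vars s ''e'' = nth0 L k \<and>
     x \<notin> cl (set (take k L)) \<and> vars s ''g'' \<le> 1 \<and> m = T b - k + vars s ''g'' \<and>
     (if vars s ''g'' = 0 then k < length L \<and> x \<in> cl (set (take (k + 1) L))
      else handle s (vars s ''h'') (set (take k L))))" for b m s
  have I2I: "I2 b m s" if "k \<le> length L" "fr s" "vars s ''b'' = b" "vars s ''e'' = nth0 L k"
     "x \<notin> cl (set (take k L))" "vars s ''g'' \<le> 1" "m = T b - k + vars s ''g''"
     "vars s ''g'' = 0 \<Longrightarrow> k < length L \<and> x \<in> cl (set (take (k + 1) L))"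
     "vars s ''g'' \<noteq> 0 \<Longrightarrow> handle s (vars s ''h'') (set (take k L))" for k b m s
    unfolding I2_def using that by auto
  have step2: "wpc advance_body 90 (\<lambda>s'. \<exists>m'<m. I2 b m' s') s"
    if I: "I2 b m s" and g: "aval (Mul (Var ''g'') (Var ''e'')) s \<noteq> 0"
      and b: "b = ?c \<or> x \<in> cl (set (take (b * K) L))" for b m s
  proof (rule wpc_straight)
    have fr: "fr s" using I by (simp add: I2_def)
    note [simp] = frD[OF fr]
    from I obtain k where k: "k \<le> length L" "vars s ''e'' = nth0 L k" "x \<notin> cl (set (take k L))"
      "vars s ''g'' \<le> 1" "m = T b - k + vars s ''g''" and
      h: "if vars s ''g'' = 0 then k < length L \<and> x \<in> cl (set (take (k + 1) L))
        else handle s (vars s ''h'') (set (take k L))" by (auto simp: I2_def)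
    have g1: "vars s ''g'' = 1" "nth0 L k \<noteq> 0" using g k by auto
    then have kL: "k < length L" by (auto simp: nth0_def split: if_splits)
    have bs: "vars s ''b'' = b" using I by (simp add: I2_def)
    have e: "vars s ''e'' = L ! k" "nth0 L k = L ! k" using k kL by (auto simp: nth0_def)
    \<comment> \<open>Either the first loop ran out of marks, and these cover the list, or the
      prefix of length \<open>b * K\<close> spans \<open>x\<close>. In both cases the walk cannot
      leave the block.\<close>
    have kT: "k < T b"
    proof -
      have "k < b * K"
      proof (rule ccontr)
        assume "\<not> k < b * K"
        then have ge: "b * K \<le> k" by simp
        show False
        proof (cases "b = ?c")
          case True
          then show False using ge kL bl by (simp add: marked_def)
        next
          case False
          then show False using b cl_take_mono[OF L ge] k(3) by blast
        qed
      qed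
      with kL show ?thesis by (simp add: T_def)
    qed
    have hs: "vars s ''h'' < length (created s)" "created s ! vars s ''h'' = elem ` set (take k L)"
      using h g1 by (auto simp: handle_def)
    have ec: "L ! k \<in> codes" "0 < L ! k" "L ! k - Suc 0 < n"
      using slist_codes[OF L kL] codes_pos[of "L ! k"] codes_le[of "L ! k"] by auto
    have tS: "set (take (Suc k) L) = insert (L ! k) (set (take k L))"
      using kL by (simp add: take_Suc_conv_app_nth)
    have frx: "\<exists>ya. created s @ zs = created s0 @ ya" for zs
      using fr by (auto simp: fr_def)
    have rl: "rnk (insert (L ! k) (set (take k L))) < rnk (insert x (insert (L ! k) (set (take k L)))) \<longleftrightarrow>
        x \<notin> cl (set (take (Suc k) L))"
      using rnk_less_iff[OF tL[of "Suc k"] x(1)] unfolding tS .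
    have fr': "agree {''b'', ''g'', ''u'', ''v'', ''h'', ''e'', ''f''} s0 s" using fr by (simp add: fr_def)
    have N': "arrs s0 ''N'' (?l + L ! k) = nth0 L (Suc k)" using N[OF kL] by simp
    show "wpl advance_body (\<lambda>s'. \<exists>m'<m. I2 b m' s') s"
    proof (cases "x \<in> cl (set (take (Suc k) L))")
      case True
      then have "wpl advance_body (I2 b (T b - k)) s"
        using rl hs ec x' fr' k kL e g1 bs
        by (simp add: advance_body_def el_elem rank_elem nth_append,
            intro I2I[of k]; simp add: frx fr_def agree_def)
      then show ?thesis by (rule wpl_mono) (use k g1 in auto)
    next
      case False
      then have "wpl advance_body (I2 b (T b - Suc k + 1)) s"
        using rl hs ec x' fr' k kL e g1 bs N'
        by (simp add: advance_body_def el_elem rank_elem nth_append,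
            intro I2I[of "Suc k"]; simp add: frx fr_def agree_def handle_def tS nth_append)
      then show ?thesis by (rule wpl_mono) (use k g1 kT in \<open>auto intro!: exI[of _ "T b - Suc k + 1"]\<close>)
    qed
    show "com_cost advance_body \<le> 90" by (simp add: advance_body_def)
  qed
  have init2: "wpc ?c1 40 (\<lambda>s'. \<exists>m\<le>K + 1. I2 b m s' \<and> (b = ?c \<or> x \<in> cl (set (take (b * K) L)))) s"
    if J: "J s" and b: "b = vars s ''b''" for s b
  proof -
    have fr: "fr s" using J by (simp add: J_def)
    note [simp] = frD[OF fr]
    have b1: "b - 1 < ?c" "1 \<le> b" using J b by (auto simp: J_def)
    define k where "k = min ((b - 1) * K) (length L)"
    have kk: "nth0 L ((b - 1) * K) = nth0 L k" "take ((b - 1) * K) L = take k L" "k \<le> length L"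
      by (auto simp: k_def nth0_def min_def)
    \<comment> \<open>A block has at most \<open>K\<close> entries; the \<open>+ 1\<close> is the
      flag \<open>g\<close> in the variant.\<close>
    have TK: "T b - k + 1 \<le> K + 1"
      using b1 by (cases b) (auto simp: T_def k_def)
    have h: "arrs s0 ''H'' (?o + (b - Suc 0)) < length (created s)"
      "created s ! arrs s0 ''H'' (?o + (b - Suc 0)) = elem ` set (take k L)"
      using H[OF b1(1) fr] kk by (auto simp: handle_def)
    have "wpl ?c1 (I2 b (T b - k + 1)) s"
      using J fr h kk B[OF b1(1)]
      by (auto simp: I2_def J_def fr_def agree_def handle_def b[symmetric] intro!: exI[of _ k])
    then have "wpc ?c1 40 (I2 b (T b - k + 1)) s"
      by (rule wpc_straight) simp
    then show ?thesis by (rule wpc_weaken) (use TK J b in \<open>auto simp: J_def\<close>)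
  qed
  have loop2: "wpc (While (Mul (Var ''g'') (Var ''e'')) advance_body) (100 * (K + 2)) ?Q s"
    if I: "I2 b m s" and m: "m \<le> K + 1" and b: "b = ?c \<or> x \<in> cl (set (take (b * K) L))" for b m s
  proof (rule wpc_whileI[of "I2 b", OF I])
    show "wpc advance_body 90 (\<lambda>s'. \<exists>m'<m. I2 b m' s') s"
      if "I2 b m s" "aval (Mul (Var ''g'') (Var ''e'')) s \<noteq> 0" for m s
      using step2[OF that b] .
  next
    fix m s assume I: "I2 b m s" and g: "aval (Mul (Var ''g'') (Var ''e'')) s = 0"
    from I obtain k where k: "k \<le> length L" "vars s ''e'' = nth0 L k" "x \<notin> cl (set (take k L))" and
      h0: "if vars s ''g'' = 0 then k < length L \<and> x \<in> cl (set (take (k + 1) L))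
        else handle s (vars s ''h'') (set (take k L))" by (auto simp: I2_def)
    from h0 have h: "vars s ''g'' = 0 \<Longrightarrow> x \<in> cl (set (take (k + 1) L))" by simp
    have "k < length L \<Longrightarrow> nth0 L k \<noteq> 0" using slist_codes[OF L] codes_pos by (fastforce simp: nth0_def)
    then have "k < length L \<Longrightarrow> x \<in> cl (set (take (k + 1) L))" using g k h by auto
    with k I show "?Q s" by (auto simp: I2_def fr_def)
  next
    have "(m + 1) * (90 + 1 + expr_cost (Mul (Var ''g'') (Var ''e''))) \<le> (K + 2) * 100"
      using m by (intro mult_le_mono) auto
    then show "(m + 1) * (90 + 1 + expr_cost (Mul (Var ''g'') (Var ''e''))) \<le> 100 * (K + 2)" by simp
  qed
  have tail: "wpc ((Assign ''e'' (Arr ''B'' (Add (Var ''o'') (Sub (Var ''b'') (Const 1)))) ;;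
      Assign ''h'' (Arr ''H'' (Add (Var ''o'') (Sub (Var ''b'') (Const 1)))) ;;
      Assign ''g'' (Const 1)) ;; While (Mul (Var ''g'') (Var ''e'')) advance_body) (40 + 100 * (K + 2)) ?Q s"
    if "J s" for s
    by (rule wpc_seqI[OF init2[OF that refl] _ order_refl]) (elim exE conjE, rule loop2)
  show ?thesis unfolding search_com_def
    by (rule wpc_seqI[OF init1 wpc_seqI[OF loop1 tail]]) auto
qed

end

text \<open>\<open>q\<close> is the width of a node on this level, and rounding \<open>arg\<close>
  down to a multiple of \<open>q\<close> finds the node above the leaf. The entry found by the
  search is handed upwards as \<open>y\<close>, while \<open>z\<close> records whether
  \<open>x\<close> was in the basis of the node.\<close>

definition level_com :: com where
  "level_com =
     (Assign ''o'' (Add (Var ''l'') (Mul (Div (Var ''arg'') (Var ''q'')) (Var ''q''))) ;;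
      Assign ''c'' (Arr ''T'' (Var ''o'')) ;;
      Assign ''t'' (Var ''x'')) ;;
     find_pred ;;
     (Assign ''r'' (Var ''p'') ;; Assign ''t'' (Var ''y'')) ;;
     find_pred ;;
     shift_com ;;
     link_com ;;
     search_com ;;
     (lighter_com ''g'' (Var ''e'') (Var ''x'') ;;
      Cond (Var ''g'') (Assign ''z'' (Const 0)) Skip ;;
      Assign ''y'' (Var ''e'') ;;
      Assign ''l'' (Add (Var ''l'') (Var ''W'')) ;;
      Assign ''q'' (Add (Var ''q'') (Var ''q'')))"

section \<open>Replacement of a deleted element\<close>

context ranked
begin

text \<open>The contract between a child and its parent: a newcomer must be heavier than
  \<open>x\<close> and absent from the old basis, which is what \<open>upd\<close> requires.\<close>

definition replaces :: "'b \<Rightarrow> 'b set \<Rightarrow> 'b option \<Rightarrow> bool" where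
  "replaces x R y \<longleftrightarrow> x \<in> greedy R \<and> greedy (R - {x}) = greedy R - {x} \<union> set_option y \<and>
     (\<forall>z\<in>set_option y. z \<in> R - {x} \<and> wt x < wt z \<and> z \<notin> greedy R)"

lemma replaces_none:
  assumes R: "R \<subseteq> G" and x: "x \<in> R" "x \<notin> cl (R - {x})" shows "replaces x R None"
proof -
  have "below R x \<subseteq> R - {x}" by (auto simp: below_def)
  then have "x \<in> greedy R" using x cl_mono[of "below R x" "R - {x}"] R by (auto simp: greedy_def)
  then show ?thesis using greedy_delete_unreplaced[OF assms] by (simp add: replaces_def)
qed

text \<open>As \<open>z\<close> is heavier than \<open>x\<close>, the elements below
  \<open>x\<close> lie in the prefix that fails to span \<open>x\<close>; this is why
  \<open>x\<close> was in the basis.\<close>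

lemma replaces_some:
  assumes R: "R \<subseteq> G" and x: "x \<in> R" and z: "z \<in> R" "z \<noteq> x" "wt x < wt z"
    and nz: "x \<notin> cl (below (R - {x}) z)"
    and zc: "x \<in> cl (insert z (below (R - {x}) z))"
  shows "replaces x R (Some z)"
proof -
  have "below R x \<subseteq> below (R - {x}) z" using z by (auto simp: below_def)
  then have "x \<in> greedy R"
    using x nz cl_mono[of "below R x" "below (R - {x}) z"] R by (auto simp: greedy_def below_def)
  then show ?thesis using greedy_delete_replaced[OF assms] z by (simp add: replaces_def)
qed

text \<open>The spanning prefix ends at \<open>z\<close>, so it consists of elements lighter than
  \<open>x\<close> only.\<close>

lemma not_greedy_if_spanned:
  assumes R: "R \<subseteq> G" and z: "z \<in> R" "z \<noteq> x" "wt z < wt x"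
    and zc: "x \<in> cl (insert z (below (R - {x}) z))"
  shows "x \<notin> greedy R"
proof -
  have "insert z (below (R - {x}) z) \<subseteq> below R x" using z by (auto simp: below_def)
  moreover have "below R x \<subseteq> G" using R by (auto simp: below_def)
  ultimately have "x \<in> cl (below R x)" using zc cl_mono by blast
  then show ?thesis by (simp add: greedy_def)
qed

end

context numbered_matroid
begin

definition opt :: "nat \<Rightarrow> nat option" where
  "opt y = (if y = 0 then None else Some y)"

lemma set_opt: "set_option (opt y) = (if y = 0 then {} else {y})"
  by (simp add: opt_def)

text \<open>
  One step of the sparsification: the node lists are the greedy bases of the two halves, and the
  first prefix of the updated list that spans \<open>x\<close> ends with the replacement of \<open>x\<close> in the union.
\<close>
lemma replaces_union:
  assumes R: "R1 \<subseteq> codes" "R2 \<subseteq> codes" "R1 \<inter> R2 = {}" and x: "x \<in> R1"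
    and L: "slist L" "set L = greedy (R1 - {x}) \<union> greedy R2"
    and m: "m \<le> length L" "x \<notin> cl (set (take m L))"
      "m < length L \<Longrightarrow> x \<in> cl (set (take (m + 1) L))"
  shows "if lt (nth0 L m) x then x \<notin> greedy (R1 \<union> R2) else replaces x (R1 \<union> R2) (opt (nth0 L m))"
proof -
  let ?R = "R1 \<union> R2"
  have RG: "?R \<subseteq> codes" and xR: "x \<in> ?R" and R1x: "R1 - {x} \<subseteq> codes" using R x by auto
  have R': "?R - {x} = (R1 - {x}) \<union> R2" using R x by auto
  \<comment> \<open>Prefixes of the short node list are as good as prefixes of all remaining
    elements of the node.\<close>
  have clb: "cl (below (set L) t) = cl (below (?R - {x}) t)" for t
    unfolding L(2) R' using R by (intro cl_below_sparse) auto
  show ?thesis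
  proof (cases "m < length L")
    case False
    then have "x \<notin> cl (set L)" using m by simp
    then have "x \<notin> cl (?R - {x})" unfolding L(2) R' using cl_sparse[OF R1x R(2)] by simp
    from replaces_none[OF RG xR this] show ?thesis using False by (simp add: nth0_def lt_def opt_def)
  next
    case True
    define z where "z = L ! m"
    have z: "nth0 L m = z" "z \<in> codes" "0 < z" "z \<in> set L"
      using True slist_codes[OF L(1) True] codes_pos by (auto simp: nth0_def z_def)
    have zR: "z \<in> ?R" "z \<noteq> x" using z(4) unfolding L(2) using greedy_subset R x by blast+
    have t1: "set (take m L) = below (set L) z" unfolding z_def by (rule set_take_below[OF L(1) True])
    have t2: "set (take (m + 1) L) = below (set L) z \<union> {z}"
      using True t1 by (simp add: take_Suc_conv_app_nth z_def)
    have nz: "x \<notin> cl (below (?R - {x}) z)" using m(2) unfolding t1 clb .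
    have Lc: "set L \<subseteq> codes" using L by (simp add: slist_def)
    have "cl (below (set L) z \<union> {z}) = cl (below (?R - {x}) z \<union> {z})"
      by (rule cl_cong_union) (use clb RG Lc z in \<open>auto simp: below_def\<close>)
    then have zc: "x \<in> cl (insert z (below (?R - {x}) z))" using m(3)[OF True] unfolding t2 by simp
    show ?thesis
    proof (cases "wt z < wt x")
      case True
      then have "lt z x" using z by (simp add: lt_def)
      then show ?thesis using not_greedy_if_spanned[OF RG zR True zc] z by simp
    next
      case False
      moreover have "wt z \<noteq> wt x" using inj_onD[OF wt_inj, of z x] z zR xR RG by auto
      ultimately have lt: "wt x < wt z" by simp
      have x0: "0 < x" using codes_pos xR RG by auto
      have "\<not> lt z x" using lt z x0 by (simp add: lt_def)
      then show ?thesis using replaces_some[OF RG xR zR lt nz zc] z by (simp add: opt_def)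
    qed
  qed
qed

end

section \<open>One level of a deletion\<close>

context blocked
begin

text \<open>Each stage is linear in the number of marks and the block length, and
  \<open>c \<le> 2 * K\<close> makes both linear in \<open>K\<close>. The frame conditions are what
  \<open>node_frame\<close> needs for the other nodes. Cell \<open>lw + y\<close> is exempt even for
  \<open>y = 0\<close>, which saves a case distinction here.\<close>

lemma level_correct:
  fixes s0
  defines "lw \<equiv> vars s0 ''l''"
    and "o' \<equiv> vars s0 ''l'' + vars s0 ''arg'' div vars s0 ''q'' * vars s0 ''q''"
  defines "c \<equiv> arrs s0 ''T'' o'"
  assumes L: "slist L" and xL: "x \<in> set L" and y: "y = 0 \<or> y \<in> codes \<and> y \<notin> set L \<and> wt x < wt y"
    and x: "x \<notin> cl {}" and xv: "vars s0 ''x'' = x" and yv: "vars s0 ''y'' = y"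
    and ch: "chained s0 lw L" and bl: "marked s0 o' c L" and hd: "prefixes s0 o' c L"
    and c: "c \<le> 2 * n + 2" "c \<le> 2 * K"
    and v: "o' \<le> value_bound n" "lw + vars s0 ''W'' \<le> value_bound n" "vars s0 ''q'' + vars s0 ''q'' \<le> value_bound n"
  shows "wpc level_com (2000 * (K + 2)) (\<lambda>s.
    (\<forall>a\<in>{''arg'', ''x'', ''W'', ''size'', ''ret''}. vars s a = vars s0 a) \<and>
    vars s ''l'' = lw + vars s0 ''W'' \<and> vars s ''q'' = 2 * vars s0 ''q'' \<and>
    (\<exists>m\<le>length (upd L x y). vars s ''y'' = nth0 (upd L x y) m \<and> x \<notin> cl (set (take m (upd L x y))) \<and>
         (m < length (upd L x y) \<longrightarrow> x \<in> cl (set (take (m + 1) (upd L x y))))) \<and>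
    vars s ''z'' = (if lt (vars s ''y'') x then 0 else vars s0 ''z'') \<and>
    chained s lw (upd L x y) \<and> marked s o' c (upd L x y) \<and> prefixes s o' c (upd L x y) \<and>
    (\<forall>a. a \<notin> {''N'', ''B'', ''H''} \<longrightarrow> arrs s a = arrs s0 a) \<and>
    (\<forall>a i. a \<noteq> ''N'' \<and> i \<notin> {o'..<o' + c} \<longrightarrow> arrs s a i = arrs s0 a i) \<and>
    (\<forall>e. e \<notin> insert y (set L) \<longrightarrow> arrs s ''N'' (lw + e) = arrs s0 ''N'' (lw + e)) \<and>
    (\<forall>t<lw. arrs s ''N'' t = arrs s0 ''N'' t) \<and>
    (\<exists>ys. created s = created s0 @ ys)) s0" (is "wpc _ _ ?Q s0")
proof -
  let ?c1 = "lighter_com ''g'' (Var ''e'') (Var ''x'') ;;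
      Cond (Var ''g'') (Assign ''z'' (Const 0)) Skip ;; Assign ''y'' (Var ''e'') ;;
      Assign ''l'' (Add (Var ''l'') (Var ''W'')) ;; Assign ''q'' (Add (Var ''q'') (Var ''q''))"
  let ?c2 = "Assign ''o'' (Add (Var ''l'') (Mul (Div (Var ''arg'') (Var ''q'')) (Var ''q''))) ;;
      Assign ''c'' (Arr ''T'' (Var ''o'')) ;; Assign ''t'' (Var ''x'')"
  let ?c3 = "Assign ''r'' (Var ''p'') ;; Assign ''t'' (Var ''y'')"
  let ?L = "upd L x y"
  note ub = upd_bounds[OF L xL y]
  have L': "slist ?L" by (rule slist_upd[OF L xL y])
  have c0: "0 < c" using bl xL by (cases "c = 0") (auto simp: marked_def)
  define Z :: "vname set" where "Z = {''o'', ''c'', ''t'', ''p'', ''b'', ''g'', ''r'', ''v'', ''e'', ''u'', ''h'', ''f''}"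
  define F where "F s \<longleftrightarrow> agree Z s0 s \<and> vars s ''o'' = o' \<and> vars s ''c'' = c" for s
  have FD: "vars s ''l'' = lw" "vars s ''x'' = x" "vars s ''y'' = y" "vars s ''o'' = o'" "vars s ''c'' = c"
    if "F s" for s using that xv yv by (auto simp: F_def agree_def Z_def lw_def)
  have Fag: "F s'" if "F s" "agree Z' s s'" "Z' \<subseteq> Z - {''o'', ''c''}" for s s' Z'
  proof -
    have "vars s' z = vars s z" if "z \<notin> Z \<or> z \<in> {''o'', ''c''}" for z
      using \<open>agree Z' s s'\<close> \<open>Z' \<subseteq> Z - {''o'', ''c''}\<close> that by (auto simp: agree_def)
    with \<open>F s\<close> show ?thesis by (simp add: F_def agree_def)
  qed
  define P1 where "P1 s \<longleftrightarrow> F s \<and> vars s ''t'' = x \<and> arrs s = arrs s0 \<and> created s = created s0" for s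
  define P2 where "P2 s \<longleftrightarrow> F s \<and> vars s ''p'' = (if pos L x = 0 then 0 else L ! (pos L x - 1)) \<and>
    arrs s = arrs s0 \<and> created s = created s0" for s
  define P3 where "P3 s \<longleftrightarrow> F s \<and> vars s ''t'' = y \<and> vars s ''r'' = (if pos L x = 0 then 0 else L ! (pos L x - 1)) \<and>
    arrs s = arrs s0 \<and> created s = created s0" for s
  define P4 where "P4 s \<longleftrightarrow> F s \<and> vars s ''p'' = (if pos L y = 0 then 0 else L ! (pos L y - 1)) \<and>
    vars s ''r'' = (if pos L x = 0 then 0 else L ! (pos L x - 1)) \<and>
    arrs s = arrs s0 \<and> created s = created s0" for s
  define P5 where "P5 s \<longleftrightarrow> F s \<and> vars s ''p'' = (if pos L y = 0 then 0 else L ! (pos L y - 1)) \<and>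
    vars s ''r'' = (if pos L x = 0 then 0 else L ! (pos L x - 1)) \<and>
    marked s o' c ?L \<and> prefixes s o' c ?L \<and>
    (\<forall>a. a \<notin> {''B'', ''H''} \<longrightarrow> arrs s a = arrs s0 a) \<and>
    (\<forall>a i. i \<notin> {o'..<o' + c} \<longrightarrow> arrs s a i = arrs s0 a i) \<and> (\<exists>ys. created s = created s0 @ ys)" for s
  define Ar where "Ar s \<longleftrightarrow> chained s lw ?L \<and> marked s o' c ?L \<and> prefixes s o' c ?L \<and>
    (\<forall>a. a \<notin> {''N'', ''B'', ''H''} \<longrightarrow> arrs s a = arrs s0 a) \<and>
    (\<forall>a i. a \<noteq> ''N'' \<and> i \<notin> {o'..<o' + c} \<longrightarrow> arrs s a i = arrs s0 a i) \<and>
    (\<forall>e. e \<notin> insert y (set L) \<longrightarrow> arrs s ''N'' (lw + e) = arrs s0 ''N'' (lw + e)) \<and>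
    (\<forall>t<lw. arrs s ''N'' t = arrs s0 ''N'' t) \<and>
    (\<exists>ys. created s = created s0 @ ys)" for s
  have Arx: "Ar s'" if "Ar s" "arrs s' = arrs s" "\<exists>ys. created s' = created s @ ys" for s s'
  proof -
    from that(3) obtain ys where ys: "created s' = created s @ ys" by blast
    have "prefixes s' o' c ?L" using that handle_mono[OF _ ys] by (simp add: Ar_def prefixes_def)
    then show ?thesis using that by (auto simp: Ar_def chained_def marked_def)
  qed
  define P7 where "P7 s \<longleftrightarrow> F s \<and> Ar s \<and>
    (\<exists>m\<le>length ?L. vars s ''e'' = nth0 ?L m \<and> x \<notin> cl (set (take m ?L)) \<and>
         (m < length ?L \<longrightarrow> x \<in> cl (set (take (m + 1) ?L))))" for s
  have oldn: "chained s lw L" "marked s o' c L" "prefixes s o' c L"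
    if "arrs s = arrs s0" "created s = created s0" for s
    using that ch bl hd by (auto simp: chained_def marked_def prefixes_def handle_def)
  have 1: "wpc ?c2 50 P1 s0"
  proof (rule wpc_straight)
    have "o' \<le> vmax s" for s using v(1) by (simp add: vmax_def)
    then show "wpl ?c2 P1 s0"
      using xv by (simp add: o'_def c_def P1_def F_def agree_def Z_def)
  qed simp
  have 2: "wpc find_pred (100 * (c + K + 3)) P2 s" if s: "P1 s" for s
  proof -
    have F: "F s" "vars s ''t'' = x" "arrs s = arrs s0" "created s = created s0" using s by (auto simp: P1_def)
    note fd = FD[OF F(1)]
    have "wpc find_pred (100 * (vars s ''c'' + K + 3)) (\<lambda>s'.
        vars s' ''p'' = (if pos L (vars s ''t'') = 0 then 0 else L ! (pos L (vars s ''t'') - 1)) \<and>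
        agree {''p'', ''b'', ''g''} s s' \<and> arrs s' = arrs s \<and> created s' = created s) s"
      by (rule find_pred_correct[OF L]) (use fd F oldn[OF F(3,4)] ub c in auto)
    then show ?thesis unfolding fd
    proof (rule wpc_weaken[OF _ order_refl])
      fix s' assume a: "vars s' ''p'' = (if pos L (vars s ''t'') = 0 then 0 else L ! (pos L (vars s ''t'') - 1)) \<and>
        agree {''p'', ''b'', ''g''} s s' \<and> arrs s' = arrs s \<and> created s' = created s"
      then have "F s'" using Fag[OF F(1), of "{''p'', ''b'', ''g''}" s'] by (simp add: Z_def)
      then show "P2 s'" using a F by (simp add: P2_def)
    qed
  qed
  have 3: "wpc ?c3 20 P3 s" if s: "P2 s" for s
  proof (rule wpc_straight)
    have F: "F s" using s by (simp add: P2_def)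
    have F': "F s'" if "agree {''r'', ''t''} s s'" for s' by (rule Fag[OF F that]) (simp add: Z_def)
    show "wpl ?c3 P3 s"
      using s FD(3)[OF F] F' by (simp add: P2_def P3_def agree_def)
  qed simp
  have 4: "wpc find_pred (100 * (c + K + 3)) P4 s" if s: "P3 s" for s
  proof -
    have F: "F s" "vars s ''t'' = y" "arrs s = arrs s0" "created s = created s0"
      "vars s ''r'' = (if pos L x = 0 then 0 else L ! (pos L x - 1))" using s by (auto simp: P3_def)
    note fd = FD[OF F(1)]
    have "wpc find_pred (100 * (vars s ''c'' + K + 3)) (\<lambda>s'.
        vars s' ''p'' = (if pos L (vars s ''t'') = 0 then 0 else L ! (pos L (vars s ''t'') - 1)) \<and>
        agree {''p'', ''b'', ''g''} s s' \<and> arrs s' = arrs s \<and> created s' = created s) s"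
      by (rule find_pred_correct[OF L]) (use fd F oldn[OF F(3,4)] ub c in auto)
    then show ?thesis unfolding fd
    proof (rule wpc_weaken[OF _ order_refl])
      fix s' assume a: "vars s' ''p'' = (if pos L (vars s ''t'') = 0 then 0 else L ! (pos L (vars s ''t'') - 1)) \<and>
        agree {''p'', ''b'', ''g''} s s' \<and> arrs s' = arrs s \<and> created s' = created s"
      then have "F s'" using Fag[OF F(1), of "{''p'', ''b'', ''g''}" s'] by (simp add: Z_def)
      moreover have "vars s' ''r'' = vars s ''r''" using a by (simp add: agree_def)
      ultimately show "P4 s'" using a F by (simp add: P4_def)
    qed
  qed
  have 5: "wpc shift_com (320 * (c + 2)) P5 s" if s: "P4 s" for s
  proof -
    have F: "F s" "arrs s = arrs s0" "created s = created s0"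
      "vars s ''r'' = (if pos L x = 0 then 0 else L ! (pos L x - 1))"
      "vars s ''p'' = (if pos L y = 0 then 0 else L ! (pos L y - 1))" using s by (auto simp: P4_def)
    note fd = FD[OF F(1)]
    from shift_correct[OF L xL y, of s] show ?thesis unfolding fd
    proof (rule wpc_weaken[OF _ order_refl], goal_cases)
      case (7 s')
      then have "F s'" using Fag[OF F(1), of "{''v'', ''g'', ''e'', ''u'', ''h'', ''b''}" s'] by (simp add: Z_def)
      moreover have "vars s' ''r'' = vars s ''r''" "vars s' ''p'' = vars s ''p''" using 7 by (simp_all add: agree_def)
      ultimately show ?case using 7 F by (simp add: P5_def)
    qed (use oldn[OF F(2,3)] c in auto)
  qed
  have 6: "wpc link_com 100 (\<lambda>s. F s \<and> Ar s) s" if s: "P5 s" for s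
  proof -
    have F: "F s" using s by (simp add: P5_def)
    note fd = FD[OF F]
    have chs: "chained s lw L" using s ch by (simp add: P5_def chained_def)
    have N: "arrs s ''N'' = arrs s0 ''N''" using s by (simp add: P5_def)
    from link_correct[OF L xL y, of s] show ?thesis unfolding fd
    proof (rule wpc_weaken[OF _ order_refl], goal_cases)
      case (6 s')
      then have "F s'" using F by (simp add: F_def agree_def)
      moreover have "marked s' o' c ?L" "prefixes s' o' c ?L"
        using 6 s by (simp_all add: P5_def marked_def prefixes_def handle_def)
      moreover have "arrs s' a i = arrs s0 a i" if "a \<noteq> ''N''" "i \<notin> {o'..<o' + c}" for a i
        using 6 s that by (simp add: P5_def)
      ultimately show ?case using 6 s N by (simp add: P5_def Ar_def)
    qed (use s chs in \<open>auto simp: P5_def\<close>)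
  qed
  have 7: "wpc search_com (110 * (c + K + 4)) P7 s" if s: "F s \<and> Ar s" for s
  proof -
    have F: "F s" and A: "Ar s" using s by auto
    note fd = FD[OF F]
    from search_correct[OF L' ub(1) x, of s] show ?thesis unfolding fd
    proof (rule wpc_weaken[OF _ order_refl], goal_cases)
      case (7 s')
      then have "F s'" using Fag[OF F, of "{''b'', ''g'', ''u'', ''v'', ''h'', ''e'', ''f''}" s'] by (simp add: Z_def)
      moreover have "Ar s'" using Arx[OF A, of s'] 7 by blast
      ultimately show ?case using 7 by (simp add: P7_def)
    qed (use A c c0 in \<open>auto simp: Ar_def\<close>)
  qed
  have 8: "wpc ?c1 100 ?Q s" if s: "P7 s" for s
  proof -
    have F: "F s" and A: "Ar s" using s by (auto simp: P7_def)
    note fd = FD[OF F]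
    obtain m where m: "m \<le> length ?L" "vars s ''e'' = nth0 ?L m" "x \<notin> cl (set (take m ?L))"
      "m < length ?L \<longrightarrow> x \<in> cl (set (take (m + 1) ?L))" using s by (auto simp: P7_def)
    have vs: "vars s ''W'' = vars s0 ''W''" "vars s ''q'' = vars s0 ''q''" "vars s ''z'' = vars s0 ''z''"
      "vars s ''arg'' = vars s0 ''arg''" "vars s ''size'' = vars s0 ''size''" "vars s ''ret'' = vars s0 ''ret''"
      using F by (auto simp: F_def agree_def Z_def)
    have b: "lw + vars s0 ''W'' \<le> vmax s'" "vars s0 ''q'' + vars s0 ''q'' \<le> vmax s'" for s'
      using v by (auto simp: vmax_def)
    have fin: "?Q s'" if "\<forall>a\<in>{''arg'', ''x'', ''W'', ''size'', ''ret''}. vars s' a = vars s0 a"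
      "vars s' ''l'' = lw + vars s0 ''W''" "vars s' ''q'' = 2 * vars s0 ''q''"
      "vars s' ''y'' = nth0 ?L m" "vars s' ''z'' = (if lt (nth0 ?L m) x then 0 else vars s0 ''z'')"
      "arrs s' = arrs s" "created s' = created s" for s'
    proof -
      have "Ar s'" using Arx[OF A, of s'] that by auto
      then show ?thesis using that m unfolding Ar_def by auto
    qed
    show ?thesis
    proof (rule wpc_straight)
      have "wpl ?c1 (\<lambda>s'.
        (\<forall>a\<in>{''arg'', ''x'', ''W'', ''size'', ''ret''}. vars s' a = vars s0 a) \<and>
        vars s' ''l'' = lw + vars s0 ''W'' \<and> vars s' ''q'' = 2 * vars s0 ''q'' \<and>
        vars s' ''y'' = nth0 ?L m \<and> vars s' ''z'' = (if lt (nth0 ?L m) x then 0 else vars s0 ''z'') \<and>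
        arrs s' = arrs s \<and> created s' = created s) s"
        using fd m nth0_le[OF L', of m] ub xv by (simp add: vs b mult_2)
      then show "wpl ?c1 ?Q s"
        by (rule wpl_mono) (rule fin; simp)
    qed simp
  qed
  show ?thesis unfolding level_com_def
    \<comment> \<open>With \<open>c \<le> 2 * K\<close> the stages add up to at most
      \<open>1570 * K + 1950\<close>.\<close>
    by (rule wpc_seqI[OF 1 wpc_seqI[OF 2 wpc_seqI[OF 3 wpc_seqI[OF 4 wpc_seqI[OF 5 wpc_seqI[OF 6 wpc_seqI[OF 7 8]]]]]]])
      (use c in auto)
qed

end

text \<open>The basis array is unordered, so the slot of \<open>x\<close> is refilled by
  \<open>y\<close> or by the last entry, with \<open>''L''\<close> as the inverse map. The code
  \<open>y\<close> already has the format prescribed for \<open>''ret''\<close>.\<close>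

definition root_com :: com where
  "root_com =
     Assign ''k'' (Arr ''L'' (Var ''x'')) ;;
     Cond (Var ''y'')
       (Store ''basis'' (Var ''k'') (Sub (Var ''y'') (Const 1)) ;;
        Store ''L'' (Var ''y'') (Var ''k'') ;;
        Assign ''ret'' (Var ''y''))
       (Assign ''size'' (Sub (Var ''size'') (Const 1)) ;;
        Assign ''e'' (Arr ''basis'' (Var ''size'')) ;;
        Store ''basis'' (Var ''k'') (Var ''e'') ;;
        Store ''L'' (Add (Var ''e'') (Const 1)) (Var ''k''))"

text \<open>A leaf has no replacement to offer, hence \<open>y = 0\<close>, and its basis contains
  \<open>x\<close> unless \<open>x\<close> is a loop, hence \<open>z\<close> is the rank of the
  singleton. Handle 0 is the empty set. The climb starts at level 1, whose nodes have width
  2.\<close>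

definition delete_com :: com where
  "delete_com =
     (Assign ''x'' (Add (Var ''arg'') (Const 1)) ;;
      Assign ''y'' (Const 0) ;;
      Assign ''ret'' (Const 0) ;;
      Insert ''h'' (Const 0) (Var ''arg'') ;;
      Rank ''z'' (Var ''h'') ;;
      Assign ''l'' (Var ''W'') ;;
      Assign ''q'' (Const 2)) ;;
     While (Mul (Var ''z'') (Less (Var ''q'') (Var ''W''))) level_com ;;
     Cond (Var ''z'') root_com Skip"

text \<open>\<open>d1\<close> makes the root an inner node, and the summand 2 in
  \<open>pow_le\<close> admits \<open>d = 1\<close> even for \<open>n = 0\<close>.\<close>

locale tree = blocked U indep n el w K
  for U :: "'a set" and indep n el w K + fixes d :: nat
  assumes d1: "1 \<le> d" and n_le: "n \<le> 2 ^ d" and pow_le: "2 ^ d \<le> 2 * n + 2"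
begin

text \<open>The links are indexed by codes, which run up to \<open>2 ^ d\<close>, whereas the other
  arrays of a node use positions below \<open>2 ^ d\<close>. The extra cell keeps the levels apart
  for both.\<close>

definition W :: nat where
  "W = 2 ^ d + 1"

definition part :: "nat \<Rightarrow> nat \<Rightarrow> nat set \<Rightarrow> nat set" where
  "part k p X = {e \<in> X. p < e \<and> e \<le> p + 2 ^ k}"

definition cand :: "nat \<Rightarrow> nat \<Rightarrow> nat set \<Rightarrow> nat set" where
  "cand k p X = greedy (part (k - 1) p X) \<union> greedy (part (k - 1) (p + 2 ^ (k - 1)) X)"

definition valid :: "nat \<Rightarrow> nat \<Rightarrow> bool" where
  "valid k p \<longleftrightarrow> 1 \<le> k \<and> k \<le> d \<and> 2 ^ k dvd p \<and> p < 2 ^ d"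

text \<open>Of the two bounds on the number of marks, \<open>2 * K\<close> controls the time and
  \<open>2 ^ k\<close> keeps the marks within the cells of the node.\<close>

definition node :: "'a state \<Rightarrow> nat \<Rightarrow> nat \<Rightarrow> nat list \<Rightarrow> bool" where
  "node s k p L \<longleftrightarrow> slist L \<and> chained s (k * W) L \<and>
     arrs s ''T'' (k * W + p) \<le> 2 * K \<and> arrs s ''T'' (k * W + p) \<le> 2 ^ k \<and>
     marked s (k * W + p) (arrs s ''T'' (k * W + p)) L \<and>
     prefixes s (k * W + p) (arrs s ''T'' (k * W + p)) L"

text \<open>The inverse array also guarantees that the list has no repetitions.\<close>

definition basis_ok :: "'a state \<Rightarrow> nat set \<Rightarrow> bool" where
  "basis_ok s B \<longleftrightarrow>
     (\<forall>i<vars s ''size''. arrs s ''basis'' i < n \<and> arrs s ''L'' (arrs s ''basis'' i + 1) = i) \<and>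
     (\<lambda>i. arrs s ''basis'' i + 1) ` {..<vars s ''size''} = B"

definition represents :: "'a state \<Rightarrow> nat set \<Rightarrow> bool" where
  "represents s X \<longleftrightarrow> X \<subseteq> codes \<and> vars s ''W'' = W \<and> created s \<noteq> [] \<and> created s ! 0 = {} \<and>
     (\<forall>k p. valid k p \<longrightarrow> (\<exists>L. node s k p L \<and> set L = cand k p X)) \<and>
     basis_ok s (greedy X)"

section \<open>Layout of the tree in memory\<close>

lemma idx_inj:
  assumes "a < W" "b < W" "k * W + a = k' * W + b" shows "k = k' \<and> a = b"
proof -
  have "(k * W + a) div W = k" using assms(1) by simp
  moreover have "(k' * W + b) div W = k'" using assms(2) by simp
  ultimately have "k = k'" using assms(3) by simp
  then show ?thesis using assms(3) by auto
qed

lemma valid_le: "valid k p \<Longrightarrow> p + 2 ^ k \<le> 2 ^ d"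
proof -
  assume v: "valid k p"
  then obtain a where a: "p = 2 ^ k * a" by (auto simp: valid_def)
  obtain b where b: "(2::nat) ^ d = 2 ^ k * b" using v le_imp_power_dvd[of k d 2] by (auto simp: valid_def)
  have "2 ^ k * a < 2 ^ k * b" using v a b by (simp add: valid_def)
  then have "a + 1 \<le> b" by simp
  then have "2 ^ k * (a + 1) \<le> 2 ^ k * b" by (rule mult_le_mono2)
  then show ?thesis using a b by simp
qed

lemma dvd_interval_eq:
  fixes q p :: nat
  assumes "q dvd p" "p < e" "e \<le> p + q" shows "(e - 1) div q * q = p"
proof -
  obtain a where a: "p = q * a" using assms by auto
  have q0: "0 < q" using assms by (cases q) auto
  have "(e - 1) div q = a"
    using assms a q0 by (intro div_nat_eqI) (auto simp: algebra_simps)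
  then show ?thesis using a by simp
qed

lemma off_bounds:
  fixes q e :: nat
  assumes "0 < q" "0 < e" shows "(e - 1) div q * q < e" "e \<le> (e - 1) div q * q + q"
proof -
  have "(e - 1) div q * q + (e - 1) mod q = e - 1" by simp
  moreover have "(e - 1) mod q < q" using assms by simp
  ultimately show "(e - 1) div q * q < e" "e \<le> (e - 1) div q * q + q" using assms by linarith+
qed

lemma part_subset: "part k p X \<subseteq> X"
  by (auto simp: part_def)

lemma part_split:
  assumes "1 \<le> k"
  shows "part k p X = part (k - 1) p X \<union> part (k - 1) (p + 2 ^ (k - 1)) X"
    "part (k - 1) p X \<inter> part (k - 1) (p + 2 ^ (k - 1)) X = {}"
proof -
  have "(2::nat) ^ k = 2 ^ (k - 1) + 2 ^ (k - 1)" using assms by (cases k) auto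
  then show "part k p X = part (k - 1) p X \<union> part (k - 1) (p + 2 ^ (k - 1)) X"
    by (auto simp: part_def)
qed (auto simp: part_def)

lemma part_minus: "part k p (X - {x}) = part k p X - {x}"
  by (auto simp: part_def)

lemma part_all: "X \<subseteq> codes \<Longrightarrow> part d 0 X = X"
  using n_le by (auto simp: part_def codes_def)

lemma cand_subset: "1 \<le> k \<Longrightarrow> cand k p X \<subseteq> part k p X"
  unfolding cand_def part_split(1)[of k] using greedy_subset by blast

lemma idx_bound: "k \<le> d \<Longrightarrow> p \<le> W \<Longrightarrow> k * W + p \<le> value_bound n"
proof -
  assume k: "k \<le> d" "p \<le> W"
  have "d + 1 \<le> 2 ^ d" by (simp add: Suc_le_eq)
  then have d: "d + 1 \<le> 2 * n + 2" using pow_le by linarith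
  have W: "W \<le> 2 * n + 3" using pow_le by (simp add: W_def)
  have "k * W + p \<le> (d + 1) * W" using add_le_mono[OF mult_le_mono1[OF k(1), of W] k(2)] by (simp add: add.commute)
  also have "\<dots> \<le> (2 * n + 4) * (2 * n + 4)" using d W by (intro mult_le_mono) auto
  finally show ?thesis by (simp add: value_bound_def power2_eq_square)
qed

text \<open>Levels are separated by \<open>W\<close>, and nodes on the same level by their
  intervals. Multiples of \<open>W\<close> in \<open>''N''\<close> would be the links of the code 0,
  which no list reads; leaving them open matches the frame of \<open>level_correct\<close> when
  there is no replacement.\<close>

lemma node_frame:
  assumes node: "node s k' p' L'" and v': "valid k' p'" and L': "set L' \<subseteq> part k' p' X'"
    and v: "valid k p" and ne: "k' \<noteq> k \<or> p' \<noteq> p"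
    and T: "arrs s' ''T'' (k' * W + p') = arrs s ''T'' (k' * W + p')"
    and BH: "\<And>a i. a \<in> {''B'', ''H''} \<Longrightarrow> i \<notin> {k * W + p..<k * W + p + 2 ^ k} \<Longrightarrow> arrs s' a i = arrs s a i"
    and N: "\<And>i. i \<notin> (+) (k * W) ` {p<..p + 2 ^ k} \<Longrightarrow> i \<notin> (*) W ` UNIV \<Longrightarrow> arrs s' ''N'' i = arrs s ''N'' i"
    and cr: "created s' = created s @ ys"
  shows "node s' k' p' L'"
proof -
  have dis: "k' * W + a \<noteq> k * W + b" if "p' < a" "a \<le> p' + 2 ^ k'" "p < b" "b \<le> p + 2 ^ k" for a b
  proof
    assume eq: "k' * W + a = k * W + b"
    have "a < W" "b < W" using that valid_le[OF v] valid_le[OF v'] by (auto simp: W_def)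
    from idx_inj[OF this eq] have kk: "k' = k" "a = b" by auto
    then have "p' = p"
      using dvd_interval_eq[of "2 ^ k" p' a] dvd_interval_eq[of "2 ^ k" p a] that v v'
      by (auto simp: valid_def)
    with kk ne show False by simp
  qed
  let ?c = "arrs s ''T'' (k' * W + p')"
  have c: "?c \<le> 2 ^ k'" using node by (simp add: node_def)
  have bh: "arrs s' a (k' * W + p' + b) = arrs s a (k' * W + p' + b)" if "b < ?c" "a \<in> {''B'', ''H''}" for a b
  proof (rule BH[OF that(2)])
    show "k' * W + p' + b \<notin> {k * W + p..<k * W + p + 2 ^ k}"
    proof
      assume "k' * W + p' + b \<in> {k * W + p..<k * W + p + 2 ^ k}"
      then obtain t where t: "k' * W + p' + b = k * W + p + t" "t < 2 ^ k"
        by (metis atLeastLessThan_iff le_Suc_ex nat_add_left_cancel_less)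
      \<comment> \<open>Marks are counted from \<open>p\<close> on and codes from
        \<open>p + 1\<close> on; the shift by one lets \<open>dis\<close> serve for both.\<close>
      show False using dis[of "p' + b + 1" "p + t + 1"] t that(1) c by simp
    qed
  qed
  have nn: "arrs s' ''N'' (k' * W + L' ! m) = arrs s ''N'' (k' * W + L' ! m)" if "m < length L'" for m
  proof (rule N)
    have m: "p' < L' ! m" "L' ! m \<le> p' + 2 ^ k'" using L' that nth_mem by (fastforce simp: part_def)+
    show "k' * W + L' ! m \<notin> (+) (k * W) ` {p<..p + 2 ^ k}"
      by (rule notI, elim imageE) (use dis[OF m] in auto)
    have "L' ! m < W" "0 < L' ! m" using m valid_le[OF v'] by (auto simp: W_def)
    then show "k' * W + L' ! m \<notin> (*) W ` UNIV"
      using idx_inj[of "L' ! m" 0 k'] by (auto simp: mult.commute[of W])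
  qed
  show ?thesis using node nn bh handle_mono[OF _ cr]
    by (simp add: node_def T chained_def marked_def prefixes_def)
qed

lemma root_correct:
  assumes ok: "basis_ok s0 B" and B: "B \<subseteq> codes" and x: "x \<in> B" and y: "y = 0 \<or> y \<in> codes \<and> y \<notin> B"
    and xv: "vars s0 ''x'' = x" and yv: "vars s0 ''y'' = y" and r0: "vars s0 ''ret'' = 0"
  shows "wpc root_com 100 (\<lambda>s. basis_ok s (B - {x} \<union> set_option (opt y)) \<and> vars s ''ret'' = y \<and>
     vars s ''W'' = vars s0 ''W'' \<and> created s = created s0 \<and>
     (\<forall>a. a \<notin> {''basis'', ''L''} \<longrightarrow> arrs s a = arrs s0 a)) s0"
    (is "wpc _ _ ?Q _")
proof (rule wpc_straight)
  let ?b = "arrs s0 ''basis''" and ?z = "vars s0 ''size''"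
  have loc: "?b i < n" "arrs s0 ''L'' (?b i + 1) = i" if "i < ?z" for i
    using ok that by (simp_all add: basis_ok_def)
  have img: "(\<lambda>i. ?b i + 1) ` {..<?z} = B" using ok by (simp add: basis_ok_def)
  from x img obtain k where k: "k < ?z" "?b k + 1 = x" by auto
  have kx: "arrs s0 ''L'' x = k" using loc(2)[OF k(1)] k(2) by simp
  have inj: "?b i = ?b j \<longleftrightarrow> i = j" if "i < ?z" "j < ?z" for i j
    using loc(2)[OF that(1)] loc(2)[OF that(2)] by metis
  show "wpl root_com ?Q s0"
  proof (cases "y = 0")
    case False
    then have yc: "y \<in> codes" "y \<notin> B" "0 < y" "y - 1 < n" using y codes_pos[of y] codes_le[of y] by auto
    have yb: "\<forall>i. i \<noteq> k \<longrightarrow> Suc (?b i) = y \<longrightarrow> \<not> i < ?z" using img yc(2) by auto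
    have im: "(\<lambda>i. Suc ((?b(k := y - Suc 0)) i)) ` {..<?z} = insert y (B - {x})"
    proof -
      have e: "{..<?z} = insert k ({..<?z} - {k})" using k by auto
      have "(\<lambda>i. Suc ((?b(k := y - Suc 0)) i)) ` {..<?z} =
          insert y ((\<lambda>i. ?b i + 1) ` ({..<?z} - {k}))"
        using yc by (subst e, subst image_insert) auto
      also have "(\<lambda>i. ?b i + 1) ` ({..<?z} - {k}) = B - {x}"
        unfolding img[symmetric] k(2)[symmetric] using inj k(1) by (auto simp: image_iff)
      finally show ?thesis .
    qed
    show ?thesis using False yc xv yv kx loc yb im k
      by (simp add: root_com_def basis_ok_def opt_def)
  next
    case True
    define t where "t = ?z - 1"
    have tz: "t < ?z" "?z = Suc t" using k by (auto simp: t_def)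
    have im: "(\<lambda>i. Suc ((?b(k := ?b t)) i)) ` {..<t} = B - {x}"
    proof -
      \<comment> \<open>If \<open>x\<close> occupies the last slot, shortening the list removes it;
        otherwise the last entry moves into its slot.\<close>
      have "(\<lambda>i. Suc ((?b(k := ?b t)) i)) ` {..<t} = (\<lambda>i. Suc (?b i)) ` ({..<?z} - {k})"
      proof (cases "k = t")
        case True
        then show ?thesis using tz by (auto simp: lessThan_Suc)
      next
        case False
        define S where "S = {..<t} - {k}"
        have e: "{..<t} = insert k S" "{..<?z} - {k} = insert t S" using False tz k by (auto simp: S_def)
        have "(\<lambda>i. Suc ((?b(k := ?b t)) i)) ` S = (\<lambda>i. Suc (?b i)) ` S"
          by (rule image_cong) (auto simp: S_def)
        then show ?thesis unfolding e image_insert by simp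
      qed
      also have "\<dots> = B - {x}"
        unfolding img[symmetric] k(2)[symmetric] using inj k(1) by (auto simp: image_iff)
      finally show ?thesis .
    qed
    have l': "?b i < n" "arrs s0 ''L'' (Suc (?b i)) = i" "?b i = ?b t \<longleftrightarrow> i = t" if "i < t" for i
      using loc[of i] inj[of i t] that tz by auto
    have kt: "k \<le> t" using k tz by simp
    have bt: "?b t < n" using loc tz by simp
    show ?thesis using True xv yv kx l' im kt tz r0 bt
      by (auto simp: root_com_def basis_ok_def opt_def t_def[symmetric])
  qed
  show "com_cost root_com \<le> 100" by (simp add: root_com_def)
qed

section \<open>The path from a leaf to the root\<close>

definition off :: "nat \<Rightarrow> nat \<Rightarrow> nat" where
  "off x k = (x - 1) div 2 ^ k * 2 ^ k"

lemma off_valid: "x \<in> codes \<Longrightarrow> 1 \<le> k \<Longrightarrow> k \<le> d \<Longrightarrow> valid k (off x k)"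
  using off_bounds(1)[of "2 ^ k" x] codes_pos[of x] codes_le[of x] n_le by (auto simp: valid_def off_def)

lemma in_part_off: "x \<in> X \<Longrightarrow> 0 < x \<Longrightarrow> x \<in> part k (off x k) X"
  using off_bounds[of "2 ^ k" x] by (auto simp: part_def off_def)

lemma not_in_part: "valid k p \<Longrightarrow> p \<noteq> off x k \<Longrightarrow> x \<notin> part k p X"
  using dvd_interval_eq[of "2 ^ k" p x] by (auto simp: part_def off_def valid_def)

lemma off_step:
  assumes "1 \<le> k" "0 < x"
  shows "off x (k - 1) = off x k \<or> off x (k - 1) = off x k + 2 ^ (k - 1)"
proof -
  have e: "(2::nat) ^ k = 2 ^ (k - 1) + 2 ^ (k - 1)" using assms by (cases k) auto
  have b: "off x k < x" "x \<le> off x k + 2 ^ k" using off_bounds[of "2 ^ k" x] assms by (auto simp: off_def)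
  have dv: "2 ^ (k - 1) dvd off x k"
    unfolding off_def by (intro dvd_mult le_imp_power_dvd) simp
  show ?thesis
  proof (cases "x \<le> off x k + 2 ^ (k - 1)")
    case True
    then show ?thesis using dvd_interval_eq[OF dv b(1)] by (simp add: off_def)
  next
    case False
    then show ?thesis using dvd_interval_eq[of "2 ^ (k - 1)" "off x k + 2 ^ (k - 1)" x] dv b e
      by (simp add: off_def)
  qed
qed

lemma cand_other: "valid k p \<Longrightarrow> p \<noteq> off x k \<Longrightarrow> cand k p (X - {x}) = cand k p X"
  using not_in_part[of k p x X] part_split(1)[of k p X]
  by (simp add: cand_def part_minus valid_def)

text \<open>The nodes above a leaf are nested, so by \<open>greedy_antimono\<close> a rejected
  \<open>x\<close> remains rejected further up. This justifies the early stop.\<close>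

lemma not_greedy_parts:
  assumes X: "X \<subseteq> codes" and x: "x \<in> X" and k: "k \<le> k'" and ng: "x \<notin> greedy (part k (off x k) X)"
  shows "x \<notin> greedy (part k' (off x k') X)"
proof
  assume g: "x \<in> greedy (part k' (off x k') X)"
  have x0: "0 < x" using x X codes_pos by blast
  have "part k (off x k) X \<subseteq> part k' (off x k') X"
  proof
    fix e assume e: "e \<in> part k (off x k) X"
    have dv: "(2::nat) ^ k dvd 2 ^ k'" using k by (rule le_imp_power_dvd)
    have o1: "off x k < e" "e \<le> off x k + 2 ^ k" "e \<in> X" using e by (auto simp: part_def)
    have eq: "(e - 1) div 2 ^ k = (x - 1) div 2 ^ k"
      using dvd_interval_eq[OF _ o1(1,2)] by (simp add: off_def)
    obtain a where a: "(2::nat) ^ k' = 2 ^ k * a" using dv by auto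
    have "(e - 1) div 2 ^ k' = (x - 1) div 2 ^ k'" unfolding a using eq by (simp add: div_mult2_eq)
    then have "off e k' = off x k'" by (simp add: off_def)
    moreover have "e \<in> part k' (off e k') X" using o1 by (intro in_part_off) auto
    ultimately show "e \<in> part k' (off x k') X" by simp
  qed
  moreover have "part k' (off x k') X \<subseteq> codes" using part_subset X by blast
  ultimately have "x \<in> greedy (part k (off x k) X)"
    using greedy_antimono[OF g] in_part_off[OF x x0] by blast
  with ng show False by simp
qed

text \<open>The child that contains \<open>x\<close> keeps its basis by
  \<open>greedy_delete_irrelevant\<close>, and the other child does not contain \<open>x\<close>:
  above the stopping point no stored list has to change.\<close>

lemma cand_irrelevant:
  assumes X: "X \<subseteq> codes" and x: "x \<in> X" and k: "1 \<le> k" and ng: "x \<notin> greedy (part (k - 1) (off x (k - 1)) X)"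
  shows "cand k (off x k) (X - {x}) = cand k (off x k) X"
proof -
  have x0: "0 < x" using x X codes_pos by blast
  have "greedy (part (k - 1) p (X - {x})) = greedy (part (k - 1) p X)"
    if p: "p = off x k \<or> p = off x k + 2 ^ (k - 1)" for p
  proof (cases "x \<in> part (k - 1) p X")
    case False
    then show ?thesis by (simp add: part_minus)
  next
    case True
    have "2 ^ (k - 1) dvd off x k" unfolding off_def by (intro dvd_mult le_imp_power_dvd) simp
    then have "2 ^ (k - 1) dvd p" using p by auto
    then have "p = off x (k - 1)"
      using dvd_interval_eq[of "2 ^ (k - 1)" p x] True by (auto simp: part_def off_def)
    then show ?thesis unfolding part_minus using ng True
      by (intro greedy_delete_irrelevant) (use X part_subset in blast)+
  qed
  then show ?thesis by (simp add: cand_def)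
qed

text \<open>Connects the contract of the child with \<open>replaces_union\<close>: \<open>R1\<close>
  is the child containing \<open>x\<close>, whose basis has just exchanged \<open>x\<close> for
  \<open>y\<close>, and \<open>R2\<close> is its sibling.\<close>

lemma delete_step:
  assumes X: "X \<subseteq> codes" and x: "x \<in> X" and k: "1 \<le> k"
    and rep: "replaces x (part (k - 1) (off x (k - 1)) X) (opt y)"
    and L: "slist L" "set L = cand k (off x k) X"
  shows "x \<in> set L" "y = 0 \<or> y \<in> codes \<and> y \<notin> set L \<and> wt x < wt y"
    "y \<noteq> 0 \<Longrightarrow> y \<in> part k (off x k) X"
    "set (upd L x y) = cand k (off x k) (X - {x})"
    "\<And>m. m \<le> length (upd L x y) \<Longrightarrow> x \<notin> cl (set (take m (upd L x y))) \<Longrightarrow>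
       (m < length (upd L x y) \<Longrightarrow> x \<in> cl (set (take (m + 1) (upd L x y)))) \<Longrightarrow>
       if lt (nth0 (upd L x y) m) x then x \<notin> greedy (part k (off x k) X)
       else replaces x (part k (off x k) X) (opt (nth0 (upd L x y) m))"
proof -
  have x0: "0 < x" using x X codes_pos by blast
  define p2 where "p2 = (if off x (k - 1) = off x k then off x k + 2 ^ (k - 1) else off x k)"
  define R1 where "R1 = part (k - 1) (off x (k - 1)) X"
  define R2 where "R2 = part (k - 1) p2 X"
  \<comment> \<open>The leaf may lie in the left or in the right child.\<close>
  have ee: "(off x (k - 1) = off x k \<and> p2 = off x k + 2 ^ (k - 1)) \<or>
      (off x (k - 1) = off x k + 2 ^ (k - 1) \<and> p2 = off x k)"
    using off_step[OF k x0] by (auto simp: p2_def)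
  have RR: "part k (off x k) X = R1 \<union> R2" "R1 \<inter> R2 = {}"
    using ee part_split[OF k, of "off x k" X] unfolding R1_def R2_def
    by (elim disjE conjE; simp add: Un_commute Int_commute)+
  have cX: "cand k (off x k) X = greedy R1 \<union> greedy R2"
    using ee by (elim disjE conjE) (simp_all add: cand_def R1_def R2_def Un_commute)
  have xR1: "x \<in> R1" unfolding R1_def by (rule in_part_off[OF x x0])
  have xR2: "x \<notin> R2" using xR1 RR by blast
  have cX': "cand k (off x k) (X - {x}) = greedy (R1 - {x}) \<union> greedy R2"
    using ee xR2 unfolding R1_def R2_def
    by (elim disjE conjE) (simp_all add: cand_def part_minus Un_commute)
  have Rc: "R1 \<subseteq> codes" "R2 \<subseteq> codes" using X part_subset unfolding R1_def R2_def by blast+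
  have rep: "x \<in> greedy R1" "greedy (R1 - {x}) = greedy R1 - {x} \<union> set_option (opt y)"
    "y \<noteq> 0 \<Longrightarrow> y \<in> R1 - {x} \<and> wt x < wt y \<and> y \<notin> greedy R1"
    using rep by (auto simp: replaces_def R1_def opt_def)
  show xL: "x \<in> set L" using rep L cX by simp
  have "y \<notin> greedy R2" if "y \<noteq> 0" using rep(3)[OF that] RR greedy_subset by blast
  then show yL: "y = 0 \<or> y \<in> codes \<and> y \<notin> set L \<and> wt x < wt y"
    using rep(3) Rc L cX by auto
  show "y \<noteq> 0 \<Longrightarrow> y \<in> part k (off x k) X" using rep(3) RR by auto
  have "x \<notin> greedy R2" using xR2 greedy_subset by blast
  then show sU: "set (upd L x y) = cand k (off x k) (X - {x})"
    unfolding set_upd[OF L(1) xL yL] cX' rep(2) L(2) cX set_opt by auto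
  show "if lt (nth0 (upd L x y) m) x then x \<notin> greedy (part k (off x k) X)
       else replaces x (part k (off x k) X) (opt (nth0 (upd L x y) m))"
    if "m \<le> length (upd L x y)" "x \<notin> cl (set (take m (upd L x y)))"
      "m < length (upd L x y) \<Longrightarrow> x \<in> cl (set (take (m + 1) (upd L x y)))" for m
    unfolding RR(1)
    using replaces_union[OF Rc RR(2) xR1 slist_upd[OF L(1) xL yL] sU[unfolded cX'] that] .
qed

lemma delete_correct:
  assumes ds: "represents s0 X" and x: "x \<in> X" and arg: "vars s0 ''arg'' = x - 1"
  shows "wpc delete_com (2100 * (d + 2) * (K + 2)) (\<lambda>s. represents s (X - {x}) \<and>
    (vars s ''ret'' = 0 \<or> vars s ''ret'' \<in> codes) \<and>
    greedy (X - {x}) - greedy X = set_option (opt (vars s ''ret''))) s0" (is "wpc _ _ ?Q s0")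
proof -
  let ?c1 = "Assign ''x'' (Add (Var ''arg'') (Const 1)) ;; Assign ''y'' (Const 0) ;;
      Assign ''ret'' (Const 0) ;; Insert ''h'' (Const 0) (Var ''arg'') ;;
      Rank ''z'' (Var ''h'') ;; Assign ''l'' (Var ''W'') ;; Assign ''q'' (Const 2)"
  let ?b2 = "Mul (Var ''z'') (Less (Var ''q'') (Var ''W''))"
  have X: "X \<subseteq> codes" and Wv: "vars s0 ''W'' = W" and cr0: "created s0 \<noteq> []" "created s0 ! 0 = {}"
    and nodes: "\<And>k p. valid k p \<Longrightarrow> \<exists>L. node s0 k p L \<and> set L = cand k p X"
    and bas: "basis_ok s0 (greedy X)" using ds by (auto simp: represents_def)
  have xc: "x \<in> codes" using x X by blast
  have x0: "0 < x" "x \<le> n" using xc codes_pos codes_le by auto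
  define bk where "bk s \<longleftrightarrow> vars s ''W'' = W \<and> vars s ''x'' = x \<and> vars s ''arg'' = x - 1 \<and>
    vars s ''size'' = vars s0 ''size'' \<and> vars s ''ret'' = 0 \<and> arrs s ''basis'' = arrs s0 ''basis'' \<and>
    arrs s ''L'' = arrs s0 ''L'' \<and> (\<exists>ys. created s = created s0 @ ys)" for s :: "'a state"
  define st where "st k s \<longleftrightarrow> vars s ''z'' \<le> 1 \<and>
    (if vars s ''z'' = 0 then x \<notin> greedy (part (k - 1) (off x (k - 1)) X)
     else replaces x (part (k - 1) (off x (k - 1)) X) (opt (vars s ''y'')))" for k and s :: "'a state"
  \<comment> \<open>Levels below \<open>k\<close> already describe the set without \<open>x\<close>,
    all others still the old one.\<close>
  define nd where "nd k s \<longleftrightarrow> (\<forall>k' p'. valid k' p' \<longrightarrow> (\<exists>L. node s k' p' L \<and>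
    set L = cand k' p' (if k' < k then X - {x} else X)))" for k s
  define I where "I m s \<longleftrightarrow> (\<exists>k. 1 \<le> k \<and> k \<le> d + 1 \<and> m = d + 1 - k \<and> vars s ''q'' = 2 ^ k \<and>
    vars s ''l'' = k * W \<and> bk s \<and> st k s \<and> nd k s)" for m s
  have init: "wpc ?c1 60 (I d) s0"
  proof (rule wpc_straight)
    have a: "x - 1 < n" "Suc (x - 1) = x" using x0 by auto
    have xm: "x \<le> vmax s" for s using x0 by (intro le_vmax) simp
    have p0: "part 0 (off x 0) X = {x}" using x x0 by (auto simp: part_def off_def)
    have g0: "greedy {x} = (if x \<in> cl {} then {} else {x})"
    proof -
      have "below {x} x = {}" by (auto simp: below_def)
      then show ?thesis by (auto simp: greedy_def)
    qed
    have ge0: "greedy {} = {}" by (simp add: greedy_def)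
    have r1: "rnk {x} \<le> 1" using r_insert_le[of "{}" x] xc by (simp add: r_empty)
    have rcl: "rnk {x} = 0 \<longleftrightarrow> x \<in> cl {}" using xc by (simp add: cl_def r_empty)
    have mr: "matroid_rank indep {el (x - Suc 0)} = rnk {x}" by (simp add: rnk_def elem_def)
    have nd1: "nd 1 s" if "arrs s = arrs s0" "created s = created s0 @ [y]" for s y
      unfolding nd_def
    proof (intro allI impI)
      fix k p assume v: "valid k p"
      then obtain L where L: "node s0 k p L" "set L = cand k p X" using nodes by blast
      have "node s k p L" using L(1) that handle_mono[OF _ that(2)]
        by (simp add: node_def chained_def marked_def prefixes_def)
      then show "\<exists>L. node s k p L \<and> set L = cand k p (if k < 1 then X - {x} else X)"
        using L v by (auto simp: valid_def)
    qed
    have Ii: "I d s" if "vars s ''q'' = 2" "vars s ''l'' = W" "bk s" "st 1 s" "nd 1 s" for s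
      unfolding I_def using that by (intro exI[of _ 1]) simp
    have st1: "st 1 s" if "vars s ''z'' = rnk {x}" "vars s ''y'' = 0" for s
      using that r1 rcl g0 ge0 p0 by (simp add: st_def replaces_def opt_def)
    show "wpl ?c1 (I d) s0"
      using a cr0 arg Wv
      by (simp add: xm nth_append mr, intro Ii; (intro nd1 st1)?; simp add: bk_def)
  qed simp
  have step: "wpc level_com (2000 * (K + 2)) (\<lambda>s'. \<exists>m'<m. I m' s') s"
    if I: "I m s" and g: "aval ?b2 s \<noteq> 0" for m s
  proof -
    from I obtain k where k: "1 \<le> k" "m = d + 1 - k" "vars s ''q'' = 2 ^ k"
      "vars s ''l'' = k * W" and bk: "bk s" and st: "st k s" and nd: "nd k s" by (auto simp: I_def)
    have bkD: "vars s ''W'' = W" "vars s ''x'' = x" "vars s ''arg'' = x - 1" using bk by (auto simp: bk_def)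
    have z: "vars s ''z'' = 1" using g st by (auto simp: st_def)
    have "2 ^ k < W" using g k bkD by (auto split: if_splits)
    then have "(2::nat) ^ k \<le> 2 ^ d" unfolding W_def by linarith
    then have kd: "k \<le> d" by simp
    define y where "y = vars s ''y''"
    have rep: "replaces x (part (k - 1) (off x (k - 1)) X) (opt y)" using st z by (simp add: st_def y_def)
    have v: "valid k (off x k)" by (rule off_valid[OF xc k(1) kd])
    obtain L where L: "node s k (off x k) L" "set L = cand k (off x k) X" using nd[unfolded nd_def, rule_format, OF v] by auto
    have sl: "slist L" using L by (simp add: node_def)
    note ds = delete_step[OF X x k(1) rep sl L(2)]
    let ?L = "upd L x y"
    define c where "c = arrs s ''T'' (k * W + off x k)"
    have o': "vars s ''l'' + vars s ''arg'' div vars s ''q'' * vars s ''q'' = k * W + off x k"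
      using k bkD by (simp add: off_def)
    have cb: "c \<le> 2 * K" "c \<le> 2 ^ k" using L by (auto simp: node_def c_def)
    have c2: "c \<le> 2 * n + 2" using cb(2) \<open>2 ^ k \<le> 2 ^ d\<close> pow_le by linarith
    have xcl: "x \<notin> cl {}"
    proof -
      have "x \<notin> cl (below (part (k - 1) (off x (k - 1)) X) x)" using rep by (auto simp: replaces_def greedy_def)
      moreover have "cl {} \<subseteq> cl (below (part (k - 1) (off x (k - 1)) X) x)"
        using X part_subset below_subset by (intro cl_mono) blast+
      ultimately show ?thesis by blast
    qed
    have offW: "off x k \<le> W" using v by (simp add: valid_def W_def)
    have vb: "k * W + off x k \<le> value_bound n" "k * W + W \<le> value_bound n" "2 ^ k + 2 ^ k \<le> value_bound n"
    proof -
      show "k * W + off x k \<le> value_bound n" "k * W + W \<le> value_bound n"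
        using kd offW by (auto intro!: idx_bound)
      have "W + W \<le> value_bound n" using idx_bound[of 1 W] d1 by simp
      then show "2 ^ k + 2 ^ k \<le> value_bound n" using \<open>2 ^ k < W\<close> by linarith
    qed
    have lc: "wpc level_com (2000 * (K + 2)) (\<lambda>s'.
      (\<forall>a\<in>{''arg'', ''x'', ''W'', ''size'', ''ret''}. vars s' a = vars s a) \<and>
      vars s' ''l'' = k * W + W \<and> vars s' ''q'' = 2 * 2 ^ k \<and>
      (\<exists>m\<le>length ?L. vars s' ''y'' = nth0 ?L m \<and> x \<notin> cl (set (take m ?L)) \<and>
         (m < length ?L \<longrightarrow> x \<in> cl (set (take (m + 1) ?L)))) \<and>
      vars s' ''z'' = (if lt (vars s' ''y'') x then 0 else vars s ''z'') \<and>
      chained s' (k * W) ?L \<and> marked s' (k * W + off x k) c ?L \<and> prefixes s' (k * W + off x k) c ?L \<and>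
      (\<forall>a. a \<notin> {''N'', ''B'', ''H''} \<longrightarrow> arrs s' a = arrs s a) \<and>
      (\<forall>a i. a \<noteq> ''N'' \<and> i \<notin> {k * W + off x k..<k * W + off x k + c} \<longrightarrow> arrs s' a i = arrs s a i) \<and>
      (\<forall>e. e \<notin> insert y (set L) \<longrightarrow> arrs s' ''N'' (k * W + e) = arrs s ''N'' (k * W + e)) \<and>
      (\<forall>t<k * W. arrs s' ''N'' t = arrs s ''N'' t) \<and>
      (\<exists>ys. created s' = created s @ ys)) s"
      using level_correct[OF sl ds(1,2) xcl, of s, unfolded o', folded c_def, unfolded k(3,4) bkD]
        L(1) cb c2 vb y_def by (simp add: node_def c_def)
    then show ?thesis
    proof (rule wpc_weaken[OF _ order_refl], elim conjE exE)
      fix s' j ys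
      assume vs: "\<forall>a\<in>{''arg'', ''x'', ''W'', ''size'', ''ret''}. vars s' a = vars s a"
        and l': "vars s' ''l'' = k * W + W" and q': "vars s' ''q'' = 2 * 2 ^ k"
        and j: "j \<le> length ?L" "vars s' ''y'' = nth0 ?L j" "x \<notin> cl (set (take j ?L))"
          "j < length ?L \<longrightarrow> x \<in> cl (set (take (j + 1) ?L))"
        and z': "vars s' ''z'' = (if lt (vars s' ''y'') x then 0 else vars s ''z'')"
        and N': "chained s' (k * W) ?L" "marked s' (k * W + off x k) c ?L" "prefixes s' (k * W + off x k) c ?L"
        and A1: "\<forall>a. a \<notin> {''N'', ''B'', ''H''} \<longrightarrow> arrs s' a = arrs s a"
        and A2: "\<forall>a i. a \<noteq> ''N'' \<and> i \<notin> {k * W + off x k..<k * W + off x k + c} \<longrightarrow> arrs s' a i = arrs s a i"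
        and A3: "\<forall>e. e \<notin> insert y (set L) \<longrightarrow> arrs s' ''N'' (k * W + e) = arrs s ''N'' (k * W + e)"
        and A4: "\<forall>t<k * W. arrs s' ''N'' t = arrs s ''N'' t"
        and cr: "created s' = created s @ ys"
      have T: "arrs s' ''T'' = arrs s ''T''" "arrs s' ''basis'' = arrs s ''basis''" "arrs s' ''L'' = arrs s ''L''"
        using A1 by simp_all
      have bk': "bk s'" using bk vs T cr by (auto simp: bk_def)
      have kk: "Suc k - 1 = k" by simp
      have st': "st (Suc k) s'" using ds(5)[OF j(1,3)] j(4) z z' j(2) unfolding st_def kk by auto
      have new: "node s' k (off x k) ?L"
        using N' slist_upd[OF sl ds(1,2)] cb by (simp add: node_def T c_def)
      have other: "node s' k' p' L'" if v': "valid k' p'" and ne: "k' \<noteq> k \<or> p' \<noteq> off x k"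
        and n': "node s k' p' L'" and sL: "set L' = cand k' p' X'" for k' p' L' X'
      proof (rule node_frame[OF n' v' _ v ne fun_cong[OF T(1)] _ _ cr])
        show "set L' \<subseteq> part k' p' X'" using sL cand_subset[of k' p' X'] v' by (simp add: valid_def)
        show "arrs s' a i = arrs s a i"
          if "a \<in> {''B'', ''H''}" "i \<notin> {k * W + off x k..<k * W + off x k + 2 ^ k}" for a i
          using A2 that cb(2) by auto
        show "arrs s' ''N'' i = arrs s ''N'' i"
          if i: "i \<notin> (+) (k * W) ` {off x k<..off x k + 2 ^ k}" "i \<notin> (*) W ` UNIV" for i
        proof (cases "i < k * W")
          case True
          then show ?thesis using A4 by simp
        next
          case False
          then obtain e where e: "i = k * W + e" using le_Suc_ex not_less by blast
          have Ls: "set L \<subseteq> part k (off x k) X" using L(2) cand_subset[OF k(1)] by blast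
          have "e \<notin> set L" using i(1) Ls e by (auto simp: part_def)
          moreover have "e \<noteq> y"
          proof
            assume ey: "e = y"
            show False
            proof (cases "y = 0")
              case True
              then show False using i(2) e ey by (auto simp: mult.commute)
            next
              case False
              then show False using ds(3)[OF False] i(1) e ey by (auto simp: part_def)
            qed
          qed
          ultimately show ?thesis using A3 e by simp
        qed
      qed
      have nd': "nd (Suc k) s'"
        unfolding nd_def
      proof (intro allI impI)
        fix k' p' assume v': "valid k' p'"
        show "\<exists>L. node s' k' p' L \<and> set L = cand k' p' (if k' < Suc k then X - {x} else X)"
        proof (cases "k' = k \<and> p' = off x k")
          case True
          then show ?thesis using new ds(4) by (intro exI[of _ ?L]) simp
        next
          case False
          obtain L' where L': "node s k' p' L'" "set L' = cand k' p' (if k' < k then X - {x} else X)"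
            using nd v' unfolding nd_def by blast
          have "node s' k' p' L'" using other[OF v' _ L'] False by blast
          moreover have "cand k' p' (if k' < k then X - {x} else X) = cand k' p' (if k' < Suc k then X - {x} else X)"
          proof (cases "k' = k")
            case True
            then have "p' \<noteq> off x k'" using False by simp
            from cand_other[OF v' this, of X] True show ?thesis by simp
          next
            case False
            then show ?thesis by (simp add: less_Suc_eq)
          qed
          ultimately show ?thesis using L'(2) by auto
        qed
      qed
      have "I (d + 1 - Suc k) s'"
        unfolding I_def using kd l' q' bk' st' nd' by (intro exI[of _ "Suc k"]) simp
      then show "\<exists>m'<m. I m' s'" using k kd by (intro exI[of _ "d + 1 - Suc k"]) auto
    qed
  qed
  define J where "J s \<longleftrightarrow> bk s \<and> vars s ''z'' \<le> 1 \<and> (if vars s ''z'' = 0 then x \<notin> greedy X else replaces x X (opt (vars s ''y''))) \<and>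
    (\<forall>k p. valid k p \<longrightarrow> (\<exists>L. node s k p L \<and> set L = cand k p (X - {x})))" for s
  \<comment> \<open>The climb ends in two ways. With \<open>z = 0\<close> the unvisited levels are
    correct as they stand, by \<open>cand_irrelevant\<close> and \<open>cand_other\<close>;
    otherwise the root has been processed and \<open>k = d + 1\<close>.\<close>
  have exit: "J s" if I: "I m s" and g: "aval ?b2 s = 0" for m s
  proof -
    from I obtain k where k: "1 \<le> k" "k \<le> d + 1" "vars s ''q'' = 2 ^ k"
      and bk: "bk s" and st: "st k s" and nd: "nd k s" by (auto simp: I_def)
    have offd: "off x d = 0" using x0 n_le by (simp add: off_def)
    have pd: "part d (off x d) X = X" unfolding offd by (rule part_all[OF X])
    show ?thesis
    proof (cases "vars s ''z'' = 0")
      case True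
      then have ng: "x \<notin> greedy (part (k - 1) (off x (k - 1)) X)" using st by (simp add: st_def)
      have ngk: "x \<notin> greedy (part k' (off x k') X)" if "k - 1 \<le> k'" for k'
        by (rule not_greedy_parts[OF X x that ng])
      have "x \<notin> greedy X" using ngk[of d] k pd by simp
      moreover have "\<exists>L. node s k' p' L \<and> set L = cand k' p' (X - {x})" if v': "valid k' p'" for k' p'
      proof -
        obtain L where L: "node s k' p' L" "set L = cand k' p' (if k' < k then X - {x} else X)"
          using nd v' unfolding nd_def by blast
        have "cand k' p' X = cand k' p' (X - {x})" if "\<not> k' < k"
        proof (cases "p' = off x k'")
          case True
          then show ?thesis using cand_irrelevant[OF X x _ ngk[of "k' - 1"]] that k(1) by simp
        next
          case False
          then show ?thesis using cand_other[OF v' False, of X] by simp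
        qed
        then show ?thesis using L by (intro exI[of _ L]) simp
      qed
      ultimately show ?thesis using True bk by (simp add: J_def)
    next
      case False
      then have z: "vars s ''z'' = 1" using st by (simp add: st_def)
      then have "\<not> 2 ^ k < W" using g k(3) bk by (simp add: bk_def split: if_splits)
      then have "\<not> (2::nat) ^ k \<le> 2 ^ d" unfolding W_def by linarith
      then have "k = d + 1" using k(2) by simp
      then have kd: "k - 1 = d" "k = Suc d" by auto
      have "replaces x X (opt (vars s ''y''))" using st z unfolding st_def kd(1) pd by simp
      moreover have "\<exists>L. node s k' p' L \<and> set L = cand k' p' (X - {x})" if v': "valid k' p'" for k' p'
        using nd v' unfolding nd_def kd(2) by (auto simp: valid_def less_Suc_eq_le)
      ultimately show ?thesis using z bk by (simp add: J_def)
    qed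
  qed
  have loop: "wpc (While (Mul (Var ''z'') (Less (Var ''q'') (Var ''W''))) level_com)
      ((d + 1) * (2000 * (K + 2) + 20)) J s" if "I d s" for s
  proof (rule wpc_whileI[of I, OF that step exit])
    show "(d + 1) * (2000 * (K + 2) + 1 + expr_cost ?b2) \<le>
        (d + 1) * (2000 * (K + 2) + 20)" by (rule mult_le_mono2) simp
  qed
  have dsI: "represents s (X - {x})" if "vars s ''W'' = W" "created s = created s0 @ ys"
    "\<And>k p. valid k p \<Longrightarrow> \<exists>L. node s k p L \<and> set L = cand k p (X - {x})"
    "basis_ok s (greedy (X - {x}))" for s ys
    using that X cr0 by (auto simp: represents_def nth_append)
  have fin: "wpc (Cond (Var ''z'') root_com Skip) 120 ?Q s" if J: "J s" for s
  proof (rule wpc_condI[where N = 100])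
    have bs: "basis_ok s (greedy X)" using J bas by (simp add: J_def bk_def basis_ok_def)
    obtain ys where ys: "created s = created s0 @ ys" using J by (auto simp: J_def bk_def)
    {
      assume "aval (Var ''z'') s \<noteq> 0"
      then have rep: "replaces x X (opt (vars s ''y''))" using J by (auto simp: J_def)
      define y where "y = vars s ''y''"
      have y: "y = 0 \<or> y \<in> codes \<and> y \<notin> greedy X" using rep X by (auto simp: replaces_def y_def opt_def split: if_splits)
      have gX: "greedy X \<subseteq> codes" using greedy_subset X by blast
      have xg: "x \<in> greedy X" and eq: "greedy (X - {x}) = greedy X - {x} \<union> set_option (opt y)"
        using rep by (auto simp: replaces_def y_def)
      have vs: "vars s ''x'' = x" "vars s ''ret'' = 0" "vars s ''W'' = W" using J by (auto simp: J_def bk_def)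
      from root_correct[OF bs gX xg y vs(1) y_def[symmetric] vs(2)]
      show "wpc root_com 100 ?Q s"
      proof (rule wpc_weaken[OF _ order_refl], elim conjE)
        fix s' assume b: "basis_ok s' (greedy X - {x} \<union> set_option (opt y))" "vars s' ''ret'' = y"
          "vars s' ''W'' = vars s ''W''" "created s' = created s"
          "\<forall>a. a \<notin> {''basis'', ''L''} \<longrightarrow> arrs s' a = arrs s a"
        have nn: "node s' k p L" if "node s k p L" for k p L
          using that b(4,5) by (simp add: node_def chained_def marked_def prefixes_def handle_def)
        have "represents s' (X - {x})"
        proof (rule dsI)
          show "\<exists>L. node s' k p L \<and> set L = cand k p (X - {x})" if v: "valid k p" for k p
          proof -
            obtain L where "node s k p L" "set L = cand k p (X - {x})" using J v unfolding J_def by blast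
            then show ?thesis using nn by blast
          qed
        qed (use b vs ys eq in simp_all)
        moreover have "greedy (X - {x}) - greedy X = set_option (opt y)"
          unfolding eq using y by (auto simp: opt_def)
        ultimately show "?Q s'" using b(2) y by auto
      qed
    next
      assume z: "aval (Var ''z'') s = 0"
      then have ng: "x \<notin> greedy X" using J by (simp add: J_def)
      have eq: "greedy (X - {x}) = greedy X" by (rule greedy_delete_irrelevant[OF X x ng])
      have "represents s (X - {x})"
        by (rule dsI) (use J bs ys eq in \<open>simp_all add: J_def bk_def\<close>)
      moreover have "vars s ''ret'' = 0" using J by (simp add: J_def bk_def)
      ultimately have "?Q s" using eq by (simp add: opt_def)
      then show "wpc Skip 100 ?Q s" by (intro wpc_straight) auto
    }
  qed simp
  have cost: "60 + ((d + 1) * (2000 * (K + 2) + 20) + 120) \<le> 2100 * (d + 2) * (K + 2)"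
    by (simp add: algebra_simps)
  show ?thesis unfolding delete_com_def
    by (rule wpc_seqI[OF init wpc_seqI[OF loop fin order_refl] cost])
qed

end

section \<open>Initialization\<close>

text \<open>Multiplying by the range test turns an exhausted list into the code 0, which loses
  against every remaining entry.\<close>

definition choose_com :: com where
  "choose_com =
     lighter_com ''g'' (Mul (Less (Var ''a'') (Var ''A'')) (Arr ''C'' (Var ''a'')))
       (Mul (Less (Var ''b'') (Var ''B'')) (Arr ''C'' (Var ''b''))) ;;
     Cond (Var ''g'')
       (Assign ''e'' (Arr ''C'' (Var ''a'')) ;; Assign ''a'' (Add (Var ''a'') (Const 1)))
       (Assign ''e'' (Arr ''C'' (Var ''b'')) ;; Assign ''b'' (Add (Var ''b'') (Const 1)))"

text \<open>\<open>t\<close> counts down to the next mark. This runs before \<open>e\<close> enters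
  the set \<open>h\<close>, so the stored handle denotes the entries strictly before the
  mark.\<close>

definition mark_com :: com where
  "mark_com =
     Cond (Var ''t'') Skip
       (Store ''B'' (Add (Add (Var ''l'') (Var ''o'')) (Var ''k'')) (Var ''e'') ;;
        Store ''H'' (Add (Add (Var ''l'') (Var ''o'')) (Var ''k'')) (Var ''h'') ;;
        Assign ''k'' (Add (Var ''k'') (Const 1)) ;;
        Assign ''t'' (Var ''K'')) ;;
     Assign ''t'' (Sub (Var ''t'') (Const 1))"

definition chain_com :: com where
  "chain_com =
     Cond (Var ''v'') (Store ''N'' (Add (Var ''l'') (Var ''v'')) (Var ''e'')) Skip ;;
     Store ''N'' (Add (Var ''l'') (Var ''e'')) (Const 0) ;;
     Assign ''v'' (Var ''e'')"

text \<open>The newest element is the heaviest so far, so by \<open>greedy_insert_max\<close> it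
  belongs to the greedy basis exactly when it raises the rank \<open>u\<close>.\<close>

definition grow_com :: com where
  "grow_com =
     Insert ''h'' (Var ''h'') (Sub (Var ''e'') (Const 1)) ;;
     Rank ''g'' (Var ''h'') ;;
     Cond (Less (Var ''u'') (Var ''g''))
       (Assign ''u'' (Var ''g'') ;;
        Store ''C'' (Add (Add (Var ''l'') (Var ''o'')) (Var ''m'')) (Var ''e'') ;;
        Assign ''m'' (Add (Var ''m'') (Const 1)))
       Skip"

definition merge_body :: com where
  "merge_body = choose_com ;; mark_com ;; chain_com ;; grow_com"

definition build_node :: com where
  "build_node =
     (Assign ''a'' (Add (Var ''p'') (Var ''o'')) ;;
      Assign ''A'' (Add (Var ''a'') (Arr ''S'' (Var ''a''))) ;;
      Assign ''b'' (Add (Var ''a'') (Var ''f'')) ;;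
      Assign ''B'' (Add (Var ''b'') (Arr ''S'' (Var ''b''))) ;;
      Assign ''h'' (Const 0) ;; Assign ''t'' (Const 0) ;; Assign ''v'' (Const 0) ;;
      Assign ''k'' (Const 0) ;; Assign ''m'' (Const 0) ;; Assign ''u'' (Const 0)) ;;
     While (Add (Less (Var ''a'') (Var ''A'')) (Less (Var ''b'') (Var ''B''))) merge_body ;;
     (Store ''S'' (Add (Var ''l'') (Var ''o'')) (Var ''m'') ;;
      Store ''T'' (Add (Var ''l'') (Var ''o'')) (Var ''k'') ;;
      Assign ''o'' (Add (Var ''o'') (Var ''q'')))"

section \<open>Merging the bases of two children\<close>

context tree
begin

text \<open>The equation together with \<open>t < K\<close> makes \<open>k\<close> the quotient of
  the length by \<open>K\<close>, rounded up.\<close>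

definition marking :: "'a state \<Rightarrow> nat list \<Rightarrow> bool" where
  "marking s L \<longleftrightarrow> vars s ''t'' + length L = vars s ''k'' * K \<and> vars s ''t'' < K \<and>
     (\<forall>b<vars s ''k''. arrs s ''B'' (vars s ''l'' + vars s ''o'' + b) = nth0 L (b * K) \<and>
        handle s (arrs s ''H'' (vars s ''l'' + vars s ''o'' + b)) (set (take (b * K) L)))"

definition chaining :: "'a state \<Rightarrow> nat list \<Rightarrow> bool" where
  "chaining s L \<longleftrightarrow> chained s (vars s ''l'') L \<and> vars s ''v'' = (if L = [] then 0 else last L)"

definition growing :: "'a state \<Rightarrow> nat list \<Rightarrow> bool" where
  "growing s L \<longleftrightarrow> handle s (vars s ''h'') (set L) \<and> vars s ''u'' = rnk (set L) \<and>
     (\<exists>D. slist D \<and> set D = greedy (set L) \<and> vars s ''m'' = length D \<and>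
        (\<forall>j<length D. arrs s ''C'' (vars s ''l'' + vars s ''o'' + j) = D ! j))"

text \<open>Every mark opens a nonempty block, so there are never more marks than entries and they
  fit into the node.\<close>

lemma marking_count:
  assumes "marking s L" shows "b < vars s ''k'' \<Longrightarrow> b * K < length L" "vars s ''k'' \<le> length L"
proof -
  have m: "vars s ''t'' + length L = vars s ''k'' * K" "vars s ''t'' < K" using assms by (auto simp: marking_def)
  show lt: "b * K < length L" if "b < vars s ''k''" for b
  proof -
    have "(b + 1) * K \<le> vars s ''k'' * K" using that by (intro mult_le_mono1) simp
    then show ?thesis using m by simp
  qed
  show "vars s ''k'' \<le> length L"
  proof (cases "vars s ''k''")
    case (Suc b)
    then have "b * K < length L" by (intro lt) simp
    moreover have "b * 1 \<le> b * K" using m(2) by (intro mult_le_mono2) simp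
    ultimately show ?thesis using Suc by linarith
  qed simp
qed

lemma nth0_append1: "m < length L \<Longrightarrow> nth0 (L @ [e]) m = nth0 L m"
  by (simp add: nth0_def nth_append)

lemma mark_correct:
  assumes M: "marking s0 L" and h: "handle s0 (vars s0 ''h'') (set L)" and e: "vars s0 ''e'' = e"
    and KK: "vars s0 ''K'' = K" and len: "length L < 2 ^ d"
  shows "wpc mark_com 80 (\<lambda>s. marking s (L @ [e]) \<and> agree {''t'', ''k''} s0 s \<and> created s = created s0 \<and>
     (\<forall>a. a \<notin> {''B'', ''H''} \<longrightarrow> arrs s a = arrs s0 a) \<and>
     (\<forall>a i. i \<notin> {vars s0 ''l'' + vars s0 ''o''..vars s0 ''l'' + vars s0 ''o'' + length L} \<longrightarrow> arrs s a i = arrs s0 a i)) s0"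
    (is "wpc _ _ ?Q _")
proof (rule wpc_straight)
  let ?c = "vars s0 ''k''" and ?p = "vars s0 ''l'' + vars s0 ''o''"
  have m: "vars s0 ''t'' + length L = ?c * K" "vars s0 ''t'' < K"
    "\<And>b. b < ?c \<Longrightarrow> arrs s0 ''B'' (?p + b) = nth0 L (b * K)"
    "\<And>b. b < ?c \<Longrightarrow> handle s0 (arrs s0 ''H'' (?p + b)) (set (take (b * K) L))"
    using M by (auto simp: marking_def)
  note cl = marking_count[OF M]
  have cv: "Suc ?c \<le> vmax s" for s using cl(2) len pow_le by (intro le_vmax) simp
  show "wpl mark_com ?Q s0"
  proof (cases "vars s0 ''t'' = 0")
    case False
    define s where "s = set_var ''t'' (vars s0 ''t'' - 1) s0"
    have "marking s (L @ [e])"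
      unfolding marking_def
    proof (intro conjI allI impI)
      fix b assume "b < vars s ''k''"
      then have b: "b < ?c" by (simp add: s_def)
      show "arrs s ''B'' (vars s ''l'' + vars s ''o'' + b) = nth0 (L @ [e]) (b * K)"
        using m(3)[OF b] cl(1)[OF b] by (simp add: s_def nth0_append1)
      show "handle s (arrs s ''H'' (vars s ''l'' + vars s ''o'' + b)) (set (take (b * K) (L @ [e])))"
        using m(4)[OF b] cl(1)[OF b] by (simp add: s_def handle_def)
    qed (use m False in \<open>auto simp: s_def\<close>)
    then show ?thesis using False by (simp add: mark_com_def s_def agree_def)
  next
    case True
    define s where "s = s0\<lparr>arrs := (arrs s0)(''B'' := (arrs s0 ''B'')(?p + ?c := e),
        ''H'' := (arrs s0 ''H'')(?p + ?c := vars s0 ''h'')),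
      vars := (vars s0)(''k'' := Suc ?c, ''t'' := K - 1)\<rparr>"
    have cK: "?c * K = length L" using m True by simp
    have "marking s (L @ [e])"
      unfolding marking_def
    proof (intro conjI allI impI)
      fix b assume "b < vars s ''k''"
      then consider "b < ?c" | "b = ?c" by (auto simp: s_def less_Suc_eq)
      then show "arrs s ''B'' (vars s ''l'' + vars s ''o'' + b) = nth0 (L @ [e]) (b * K)"
        using m(3) cl(1) cK by cases (auto simp: s_def nth0_append1, simp add: nth0_def)
      from \<open>b < vars s ''k''\<close> consider "b < ?c" | "b = ?c" by (auto simp: s_def less_Suc_eq)
      then show "handle s (arrs s ''H'' (vars s ''l'' + vars s ''o'' + b)) (set (take (b * K) (L @ [e])))"
      proof cases
        case 1
        then show ?thesis using m(4)[OF 1] cl(1)[OF 1] by (simp add: s_def handle_def)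
      next
        case 2
        then show ?thesis using h cK by (simp add: s_def handle_def)
      qed
    qed (use m cK in \<open>auto simp: s_def\<close>)
    then show ?thesis using True e KK cl(2) by (simp add: mark_com_def s_def agree_def cv)
  qed
  show "com_cost mark_com \<le> 80" by (simp add: mark_com_def)
qed

lemma chain_correct:
  assumes C: "chaining s0 L" and L: "slist (L @ [e])" and e: "vars s0 ''e'' = e"
  shows "wpc chain_com 50 (\<lambda>s. chaining s (L @ [e]) \<and> agree {''v''} s0 s \<and> created s = created s0 \<and>
     (\<forall>a. a \<noteq> ''N'' \<longrightarrow> arrs s a = arrs s0 a) \<and>
     (\<forall>i. i \<notin> (+) (vars s0 ''l'') ` insert e (set L) \<longrightarrow> arrs s ''N'' i = arrs s0 ''N'' i)) s0"
    (is "wpc _ _ ?Q _")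
proof (rule wpc_straight)
  let ?l = "vars s0 ''l''"
  have ch: "\<And>m. m < length L \<Longrightarrow> arrs s0 ''N'' (?l + L ! m) = nth0 L (m + 1)"
    and v: "vars s0 ''v'' = (if L = [] then 0 else last L)" using C by (auto simp: chaining_def chained_def)
  have dist: "distinct (L @ [e])" by (rule slist_distinct[OF L])
  show "wpl chain_com ?Q s0"
  proof (cases "L = []")
    case True
    then show ?thesis using e v
      by (simp add: chain_com_def chaining_def chained_def agree_def nth0_def)
  next
    case False
    define t where "t = length L - 1"
    have t: "last L = L ! t" "t < length L" "length L = Suc t" using False by (auto simp: t_def last_conv_nth)
    have lin: "last L \<in> set L" using False by simp
    then have "last L \<in> codes" using L by (auto simp: slist_def)
    then have l0: "last L \<noteq> 0" using codes_pos by blast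
    define s where "s = s0\<lparr>arrs := (arrs s0)(''N'' := (arrs s0 ''N'')(?l + last L := e, ?l + e := 0)),
      vars := (vars s0)(''v'' := e)\<rparr>"
    have "chained s ?l (L @ [e])"
      unfolding chained_def
    proof (intro allI impI)
      fix m assume m: "m < length (L @ [e])"
      consider "m < t" | "m = t" | "m = length L" using m t by fastforce
      then show "arrs s ''N'' (?l + (L @ [e]) ! m) = nth0 (L @ [e]) (m + 1)"
      proof cases
        case 1
        then have "L ! m \<noteq> last L" "L ! m \<noteq> e" using dist t by (auto simp: nth_eq_iff_index_eq)
        then show ?thesis using 1 ch[of m] t by (simp add: s_def nth_append nth0_append1)
      next
        case 2
        then show ?thesis using dist lin t by (auto simp: s_def nth_append nth0_def)
      next
        case 3
        then show ?thesis by (simp add: s_def nth0_def)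
      qed
    qed
    then have "chaining s (L @ [e])" by (simp add: chaining_def s_def)
    moreover have "arrs s ''N'' i = arrs s0 ''N'' i" if "i \<notin> (+) ?l ` insert e (set L)" for i
      using that lin by (auto simp: s_def)
    moreover have "wpl chain_com (\<lambda>s'. s' = s) s0"
      using e v False l0 by (simp add: chain_com_def s_def)
    ultimately show ?thesis by (elim wpl_mono) (simp add: s_def agree_def)
  qed
  show "com_cost chain_com \<le> 50" by (simp add: chain_com_def)
qed

lemma grow_correct:
  assumes G: "growing s0 L" and L: "slist (L @ [e])" and e: "vars s0 ''e'' = e"
    and len: "length L < 2 ^ d"
  shows "wpc grow_com 80 (\<lambda>s. growing s (L @ [e]) \<and> agree {''h'', ''g'', ''u'', ''m''} s0 s \<and>
     (\<exists>ys. created s = created s0 @ ys) \<and>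
     (\<forall>a. a \<noteq> ''C'' \<longrightarrow> arrs s a = arrs s0 a) \<and>
     (\<forall>a i. i \<notin> {vars s0 ''l'' + vars s0 ''o''..vars s0 ''l'' + vars s0 ''o'' + length L} \<longrightarrow> arrs s a i = arrs s0 a i)) s0"
    (is "wpc _ _ ?Q _")
proof (rule wpc_straight)
  let ?p = "vars s0 ''l'' + vars s0 ''o''"
  obtain D where h: "handle s0 (vars s0 ''h'') (set L)" and u: "vars s0 ''u'' = rnk (set L)"
    and D: "slist D" "set D = greedy (set L)" "vars s0 ''m'' = length D"
      "\<And>j. j < length D \<Longrightarrow> arrs s0 ''C'' (?p + j) = D ! j"
    using G by (auto simp: growing_def)
  have ec: "e \<in> codes" "0 < e" "e - Suc 0 < n"
    using L codes_pos[of e] codes_le[of e] by (auto simp: slist_append slist_Cons)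
  have lt: "wt a < wt e" if "a \<in> set L" for a using L that by (auto simp: slist_append)
  have Lc: "set L \<subseteq> codes" using L by (auto simp: slist_def)
  have "length D = card (set D)" using slist_distinct[OF D(1)] by (simp add: distinct_card)
  also have "\<dots> \<le> card (set L)" unfolding D(2) by (intro card_mono greedy_subset) simp
  also have "\<dots> \<le> length L" by (rule card_length)
  finally have Dlen: "length D \<le> length L" .
  have mv: "Suc (length D) \<le> vmax s" for s using Dlen len pow_le by (intro le_vmax) simp
  have gr: "greedy (insert e (set L)) = (if e \<in> cl (set L) then greedy (set L) else insert e (greedy (set L)))"
    by (rule greedy_insert_max) (rule lt)
  have hs: "vars s0 ''h'' < length (created s0)" "created s0 ! vars s0 ''h'' = elem ` set L"
    using h by (auto simp: handle_def)
  show "wpl grow_com ?Q s0"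
  proof (cases "e \<in> cl (set L)")
    case True
    then have ng: "\<not> rnk (set L) < rnk (insert e (set L))" and re: "rnk (insert e (set L)) = rnk (set L)"
      by (auto simp: cl_def)
    have "\<exists>D. slist D \<and> set D = greedy (insert e (set L)) \<and> vars s0 ''m'' = length D \<and>
        (\<forall>j<length D. arrs s0 ''C'' (?p + j) = D ! j)"
      using D gr True by auto
    then show ?thesis using e ec hs u ng re
      by (simp add: grow_com_def el_elem nth_append rank_elem growing_def handle_def agree_def)
  next
    case False
    then have g: "rnk (set L) < rnk (insert e (set L))" using rnk_less_iff[OF Lc ec(1)] by simp
    have "\<forall>a\<in>set D. wt a < wt e" using D(2) lt greedy_subset[of "set L"] by blast
    moreover have "slist [e]" using ec by (simp add: slist_def)
    ultimately have sD: "slist (D @ [e])" using D(1) by (simp add: slist_append)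
    have "\<exists>D'. slist D' \<and> set D' = greedy (insert e (set L)) \<and> Suc (length D) = length D' \<and>
        (\<forall>j<length D'. ((arrs s0 ''C'')(?p + length D := e)) (?p + j) = D' ! j)"
    proof (intro exI[of _ "D @ [e]"] conjI sD allI impI)
      show "set (D @ [e]) = greedy (insert e (set L))" using D gr False by simp
      show "Suc (length D) = length (D @ [e])" by simp
      fix j assume "j < length (D @ [e])"
      then show "((arrs s0 ''C'')(?p + length D := e)) (?p + j) = (D @ [e]) ! j"
        using D(4)[of j] by (cases "j = length D") (auto simp: nth_append)
    qed
    then show ?thesis using e ec hs u g D(3) Dlen
      by (simp add: grow_com_def el_elem nth_append rank_elem growing_def handle_def agree_def mv)
  qed
  show "com_cost grow_com \<le> 80" by (simp add: grow_com_def)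
qed

lemma agree_in: "agree Y s s' \<Longrightarrow> z \<in> Z \<Longrightarrow> Z \<inter> Y = {} \<Longrightarrow> vars s' z = vars s z"
  by (auto simp: agree_def)

lemma marking_cong:
  "marking s L \<Longrightarrow> (\<And>z. z \<in> {''t'', ''k'', ''l'', ''o''} \<Longrightarrow> vars s' z = vars s z) \<Longrightarrow>
   arrs s' ''B'' = arrs s ''B'' \<Longrightarrow> arrs s' ''H'' = arrs s ''H'' \<Longrightarrow> created s' = created s @ ys \<Longrightarrow> marking s' L"
  using handle_mono[of s _ _ s' ys] by (simp add: marking_def)

lemma chaining_cong:
  "chaining s L \<Longrightarrow> (\<And>z. z \<in> {''v'', ''l''} \<Longrightarrow> vars s' z = vars s z) \<Longrightarrow>
   arrs s' ''N'' = arrs s ''N'' \<Longrightarrow> chaining s' L"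
  by (simp add: chaining_def chained_def)

lemma growing_cong:
  "growing s L \<Longrightarrow> (\<And>z. z \<in> {''h'', ''u'', ''m'', ''l'', ''o''} \<Longrightarrow> vars s' z = vars s z) \<Longrightarrow>
   arrs s' ''C'' = arrs s ''C'' \<Longrightarrow> created s' = created s @ ys \<Longrightarrow> growing s' L"
  using handle_mono[of s _ _ s' ys] by (simp add: growing_def)

definition clist :: "'a state \<Rightarrow> nat \<Rightarrow> nat \<Rightarrow> nat list \<Rightarrow> bool" where
  "clist s k p D \<longleftrightarrow> slist D \<and> set D \<subseteq> {p<..p + 2 ^ k} \<and> arrs s ''S'' (k * W + p) = length D \<and>
     (\<forall>j<length D. arrs s ''C'' (k * W + p + j) = D ! j)"

lemma slist_length_le: "slist D \<Longrightarrow> set D \<subseteq> {p<..p + m} \<Longrightarrow> length D \<le> m"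
  using card_mono[of "{p<..p + m}" "set D"] slist_distinct[of D] by (simp add: distinct_card)

lemma build_node_correct:
  assumes v: "valid k po" and K1: "1 \<le> K"
    and vs: "vars s0 ''p'' = (k - 1) * W" "vars s0 ''l'' = k * W" "vars s0 ''o'' = po"
      "vars s0 ''f'' = 2 ^ (k - 1)" "vars s0 ''q'' = 2 ^ k" "vars s0 ''K'' = K"
    and cr: "created s0 \<noteq> []" "created s0 ! 0 = {}"
    and CA: "clist s0 (k - 1) po CA" and CB: "clist s0 (k - 1) (po + 2 ^ (k - 1)) CB"
    and KK: "length CA + length CB \<le> 2 * (K * K)"
  shows "wpc build_node (700 * 2 ^ k) (\<lambda>s.
     (\<exists>L. node s k po L \<and> set L = set CA \<union> set CB) \<and>
     (\<exists>D. clist s k po D \<and> set D = greedy (set CA \<union> set CB)) \<and>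
     vars s ''o'' = po + 2 ^ k \<and>
     (\<forall>z\<in>{''p'', ''l'', ''f'', ''q'', ''W'', ''K''}. vars s z = vars s0 z) \<and>
     (\<exists>ys. created s = created s0 @ ys) \<and>
     (\<forall>a\<in>{''B'', ''H'', ''C''}. \<forall>i. i \<notin> {k * W + po..<k * W + po + 2 ^ k} \<longrightarrow> arrs s a i = arrs s0 a i) \<and>
     (\<forall>a\<in>{''S'', ''T''}. \<forall>i. i \<noteq> k * W + po \<longrightarrow> arrs s a i = arrs s0 a i) \<and>
     (\<forall>i. i \<notin> (+) (k * W) ` {po<..po + 2 ^ k} \<longrightarrow> arrs s ''N'' i = arrs s0 ''N'' i)) s0"
    (is "wpc _ _ ?Q s0")
proof -
  let ?c1 = "Assign ''a'' (Add (Var ''p'') (Var ''o'')) ;;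
      Assign ''A'' (Add (Var ''a'') (Arr ''S'' (Var ''a''))) ;;
      Assign ''b'' (Add (Var ''a'') (Var ''f'')) ;;
      Assign ''B'' (Add (Var ''b'') (Arr ''S'' (Var ''b''))) ;; Assign ''h'' (Const 0) ;;
      Assign ''t'' (Const 0) ;; Assign ''v'' (Const 0) ;; Assign ''k'' (Const 0) ;;
      Assign ''m'' (Const 0) ;; Assign ''u'' (Const 0)"
  let ?c2 = "Store ''S'' (Add (Var ''l'') (Var ''o'')) (Var ''m'') ;;
      Store ''T'' (Add (Var ''l'') (Var ''o'')) (Var ''k'') ;;
      Assign ''o'' (Add (Var ''o'') (Var ''q''))"
  let ?b3 = "Add (Less (Var ''a'') (Var ''A'')) (Less (Var ''b'') (Var ''B''))"
  have k: "1 \<le> k" "k \<le> d" using v by (auto simp: valid_def)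
  have kk: "(2::nat) ^ k = 2 ^ (k - 1) + 2 ^ (k - 1)" using k by (cases k) auto
  have le: "po + 2 ^ k \<le> 2 ^ d" by (rule valid_le[OF v])
  define la lb where "la = length CA" and "lb = length CB"
  define P where "P = (k - 1) * W + po"
  define h2 where "h2 = (2::nat) ^ (k - 1)"
  have lab: "la \<le> h2" "lb \<le> h2"
    using slist_length_le[of CA po "2 ^ (k - 1)"] slist_length_le[of CB "po + 2 ^ (k - 1)" "2 ^ (k - 1)"] CA CB
    by (auto simp: clist_def la_def lb_def h2_def)
  have lsum: "la + lb \<le> 2 ^ k" using lab kk by (simp add: h2_def)
  have sA: "slist CA" "slist CB" using CA CB by (auto simp: clist_def)
  have CAs: "set CA \<subseteq> {po<..po + h2}" "set CB \<subseteq> {po + h2<..po + h2 + h2}" using CA CB by (auto simp: clist_def h2_def)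
  have CAa: "arrs s0 ''S'' P = la" "arrs s0 ''S'' (P + h2) = lb"
    "\<And>j. j < la \<Longrightarrow> arrs s0 ''C'' (P + j) = CA ! j" "\<And>j. j < lb \<Longrightarrow> arrs s0 ''C'' (P + h2 + j) = CB ! j"
    using CA CB by (simp_all add: clist_def la_def lb_def P_def h2_def add.assoc)
  \<comment> \<open>The bases of the children lie on the previous level, in front of all cells
    written here, so they survive while the merge reads them.\<close>
  have zone: "P + h2 + lb < k * W + po"
  proof -
    have "k * W = (k - 1) * W + W" using k by (cases k) auto
    then show ?thesis using lab kk le by (simp add: P_def h2_def W_def)
  qed
  have PV: "x \<le> vmax s" if "x \<le> P + h2 + lb + 1" for x s
  proof -
    have "P + h2 + lb + 1 \<le> (k - 1) * W + W" using lab kk le by (simp add: P_def h2_def W_def)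
    also have "\<dots> \<le> value_bound n" using k by (intro idx_bound) auto
    finally show ?thesis using that by (simp add: vmax_def)
  qed
  define Z :: "vname set" where "Z = {''a'', ''A'', ''b'', ''B'', ''h'', ''t'', ''v'', ''k'', ''m'', ''u'', ''g'', ''e''}"
  define fr where "fr s \<longleftrightarrow> agree Z s0 s \<and> vars s ''A'' = P + la \<and> vars s ''B'' = P + h2 + lb \<and>
     (\<forall>a. a \<notin> {''N'', ''B'', ''H'', ''C''} \<longrightarrow> arrs s a = arrs s0 a) \<and>
     (\<forall>a i. a \<noteq> ''N'' \<and> i \<notin> {k * W + po..<k * W + po + 2 ^ k} \<longrightarrow> arrs s a i = arrs s0 a i) \<and>
     (\<forall>i. i \<notin> (+) (k * W) ` {po<..po + 2 ^ k} \<longrightarrow> arrs s ''N'' i = arrs s0 ''N'' i) \<and>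
     (\<exists>ys. created s = created s0 @ ys)" for s
  have frv: "vars s z = vars s0 z" if "fr s" "z \<notin> Z" for s z using that by (simp add: fr_def agree_def)
  have frD: "vars s ''l'' = k * W" "vars s ''o'' = po" "vars s ''K'' = K" if "fr s" for s
    using frv[OF that] vs by (simp_all add: Z_def)
  have frC: "arrs s ''C'' i = arrs s0 ''C'' i" if "fr s" "i < k * W + po" for s i
    using that by (auto simp: fr_def)
  \<comment> \<open>The merge invariant: \<open>L\<close> consists of the first \<open>i\<close> and
    \<open>j\<close> entries of the two lists, all of them lighter than what is left.\<close>
  define cur where "cur i j L \<longleftrightarrow> i \<le> la \<and> j \<le> lb \<and> length L = i + j \<and> slist L \<and>
     set L = set (take i CA) \<union> set (take j CB) \<and>
     (\<forall>x\<in>set L. \<forall>y\<in>set (drop i CA) \<union> set (drop j CB). wt x < wt y)" for i j L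
  define cv where "cv i j s \<longleftrightarrow> fr s \<and> vars s ''a'' = P + i \<and> vars s ''b'' = P + h2 + j" for i j s
  define I where "I m s \<longleftrightarrow> (\<exists>i j L. cur i j L \<and> cv i j s \<and> m = la + lb - (i + j) \<and>
     marking s L \<and> chaining s L \<and> growing s L)" for m s
  have init: "wpc ?c1 100 (I (la + lb)) s0"
  proof (rule wpc_straight)
    have Ii: "I (la + lb) s" if "fr s" "vars s ''a'' = P" "vars s ''b'' = P + h2"
      "marking s []" "chaining s []" "growing s []" for s
      unfolding I_def cur_def cv_def using that
      by (intro exI[of _ 0] exI[of _ "[]"]) (simp add: slist_def)
    have c0: "0 < length (created s0)" using cr by simp
    have g0: "greedy {} = {}" by (simp add: greedy_def)
    have aa: "(k - Suc 0) * W + po = P" "2 ^ (k - Suc 0) = h2" by (simp_all add: P_def h2_def)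
    have vv: "P \<le> vmax s" "P + la \<le> vmax s" "P + h2 \<le> vmax s" "P + h2 + lb \<le> vmax s" for s
      using lab by (auto intro!: PV)
    show "wpl ?c1 (I (la + lb)) s0"
      using vs CAa(1,2) K1 cr c0
      by (simp add: aa vv, intro Ii;
          simp add: fr_def agree_def Z_def marking_def chaining_def growing_def chained_def handle_def r_empty g0 slist_def)
  qed simp
  have choose: "wpc choose_com 150 (\<lambda>s'. \<exists>i' j'. i' + j' = i + j + 1 \<and> cur i' j' (L @ [vars s' ''e'']) \<and> cv i' j' s' \<and>
       marking s' L \<and> chaining s' L \<and> growing s' L) s"
    if c: "cur i j L" "cv i j s" and mcg: "marking s L" "chaining s L" "growing s L"
      and lt: "i + j < la + lb" for i j L s
  proof (rule wpc_straight)
    have fr: "fr s" and ab: "vars s ''a'' = P + i" "vars s ''b'' = P + h2 + j" using c(2) by (auto simp: cv_def)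
    have AB: "vars s ''A'' = P + la" "vars s ''B'' = P + h2 + lb" using fr by (auto simp: fr_def)
    have ij: "i \<le> la" "j \<le> lb" using c(1) by (auto simp: cur_def)
    have ca: "arrs s ''C'' (P + i) = CA ! i" if "i < la"
      using frC[OF fr, of "P + i"] CAa(3)[OF that] that lab zone by simp
    have cb: "arrs s ''C'' (P + h2 + j) = CB ! j" if "j < lb"
      using frC[OF fr, of "P + h2 + j"] CAa(4)[OF that] that lab zone by simp
    have x1: "(if P + i < P + la then 1 else 0) * arrs s ''C'' (P + i) = nth0 CA i"
      using ca by (auto simp: nth0_def la_def)
    have x2: "(if P + h2 + j < P + h2 + lb then 1 else 0) * arrs s ''C'' (P + h2 + j) = nth0 CB j"
      using cb by (auto simp: nth0_def lb_def)
    have nb: "nth0 CA i \<le> n" "nth0 CB j \<le> n" using nth0_le sA by auto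
    define g where "g = lt (nth0 CA i) (nth0 CB j)"
    define e where "e = (if g then CA ! i else CB ! j)"
    have gi: "i < la" if "g" using that by (auto simp: g_def lt_def nth0_def la_def split: if_splits)
    have gj: "j < lb" if "\<not> g"
    proof (rule ccontr)
      assume "\<not> j < lb"
      then have "i < la" "nth0 CB j = 0" using lt ij by (auto simp: nth0_def lb_def)
      moreover have "nth0 CA i \<noteq> 0" using slist_codes[OF sA(1)] codes_pos \<open>i < la\<close> by (fastforce simp: nth0_def la_def)
      ultimately show False using that by (simp add: g_def lt_def)
    qed
    define i' j' where "i' = (if g then i + 1 else i)" and "j' = (if g then j else j + 1)"
    define s' where "s' = s\<lparr>vars := (vars s)(''g'' := (if g then 1 else 0), ''e'' := e,
        ''a'' := P + i', ''b'' := P + h2 + j')\<rparr>"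
    have run: "wpl choose_com (\<lambda>t. t = s') s"
    proof -
      have v1: "Suc (P + i) \<le> vmax t" if g for t using gi[OF that] lab by (intro PV) simp
      have v2: "Suc (P + h2 + j) \<le> vmax t" if "\<not> g" for t using gj[OF that] by (intro PV) simp
      have u1: "(vars s)(''g'' := x, ''e'' := y, ''a'' := z, ''b'' := P + h2 + j) = (vars s)(''g'' := x, ''e'' := y, ''a'' := z)" for x y z
        by (rule ext) (simp add: ab)
      have u2: "(vars s)(''g'' := x, ''e'' := y, ''a'' := P + i, ''b'' := z) = (vars s)(''g'' := x, ''e'' := y, ''b'' := z)" for x y z
        by (rule ext) (simp add: ab)
      show ?thesis
      proof (cases g)
        case True
        then show ?thesis
          using v1[OF True] ab AB x1 x2 nb ca[OF gi[OF True]]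
          by (simp add: choose_com_def g_def[symmetric] s'_def e_def i'_def j'_def u1)
      next
        case False
        then show ?thesis
          using v2[OF False] ab AB x1 x2 nb cb[OF gj[OF False]]
          by (simp add: choose_com_def g_def[symmetric] s'_def e_def i'_def j'_def u2)
      qed
    qed
    have dA: "drop i CA = CA ! i # drop (i + 1) CA" "set (take (i + 1) CA) = insert (CA ! i) (set (take i CA))"
      if "i < la" using that by (simp_all add: la_def Cons_nth_drop_Suc take_Suc_conv_app_nth)
    have dB: "drop j CB = CB ! j # drop (j + 1) CB" "set (take (j + 1) CB) = insert (CB ! j) (set (take j CB))"
      if "j < lb" using that by (simp_all add: lb_def Cons_nth_drop_Suc take_Suc_conv_app_nth)
    have afterA: "wt (CA ! i) < wt y" if "y \<in> set (drop (i + 1) CA)" "i < la" for y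
    proof -
      have "slist (take i CA @ CA ! i # drop (i + 1) CA)" using sA(1) that(2) by (simp add: la_def id_take_nth_drop[symmetric])
      then show ?thesis using that by (auto simp: slist_append slist_Cons)
    qed
    have afterB: "wt (CB ! j) < wt y" if "y \<in> set (drop (j + 1) CB)" "j < lb" for y
    proof -
      have "slist (take j CB @ CB ! j # drop (j + 1) CB)" using sA(2) that(2) by (simp add: lb_def id_take_nth_drop[symmetric])
      then show ?thesis using that by (auto simp: slist_append slist_Cons)
    qed
    have cL: "slist L" "set L = set (take i CA) \<union> set (take j CB)" "length L = i + j"
      "\<And>x y. x \<in> set L \<Longrightarrow> y \<in> set (drop i CA) \<union> set (drop j CB) \<Longrightarrow> wt x < wt y"
      using c(1) by (auto simp: cur_def)
    have c': "cur i' j' (L @ [e])"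
    proof (cases g)
      case True
      note il = gi[OF True]
      have e: "e = CA ! i" "i' = i + 1" "j' = j" using True by (auto simp: e_def i'_def j'_def)
      have ec: "e \<in> codes" using slist_codes[OF sA(1)] il e by (simp add: la_def)
      have eB: "wt e < wt y" if y: "y \<in> set (drop j CB)" for y
      proof -
        have jl: "j < lb" using y by (cases "j < lb") (auto simp: lb_def)
        have "nth0 CB j \<noteq> 0" using slist_codes[OF sA(2)] codes_pos jl by (fastforce simp: nth0_def lb_def)
        then have "wt e < wt (CB ! j)" using True il jl e by (simp add: g_def lt_def nth0_def la_def lb_def)
        moreover have "y = CB ! j \<or> wt (CB ! j) < wt y" using y dB(1)[OF jl] afterB[OF _ jl] by auto
        ultimately show ?thesis by auto
      qed
      have Le: "wt x < wt e" if "x \<in> set L" for x using cL(4)[OF that] dA(1)[OF il] e by simp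
      show ?thesis unfolding cur_def
      proof (intro conjI ballI)
        show "slist (L @ [e])" using cL(1) ec Le by (simp add: slist_append slist_Cons) (simp add: slist_def)
        show "set (L @ [e]) = set (take i' CA) \<union> set (take j' CB)" using cL(2) dA(2)[OF il] e by auto
        fix x y assume x: "x \<in> set (L @ [e])" and y: "y \<in> set (drop i' CA) \<union> set (drop j' CB)"
        have y': "y \<in> set (drop i CA) \<union> set (drop j CB)" using y dA(1)[OF il] e by auto
        have "wt e < wt y" using y eB afterA[OF _ il] e by auto
        then show "wt x < wt y" using x cL(4)[OF _ y'] by auto
      qed (use e ij il cL in auto)
    next
      case False
      note jl = gj[OF False]
      have e: "e = CB ! j" "i' = i" "j' = j + 1" using False by (auto simp: e_def i'_def j'_def)
      have ec: "e \<in> codes" using slist_codes[OF sA(2)] jl e by (simp add: lb_def)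
      have eA: "wt e < wt y" if y: "y \<in> set (drop i CA)" for y
      proof -
        have il: "i < la" using y by (cases "i < la") (auto simp: la_def)
        have "nth0 CA i \<noteq> 0" "nth0 CA i = CA ! i" "nth0 CB j = CB ! j"
          using slist_codes[OF sA(1)] codes_pos il jl by (fastforce simp: nth0_def la_def lb_def)+
        then have "wt e \<le> wt (CA ! i)" using False e by (auto simp: g_def lt_def)
        \<comment> \<open>There are no ties: the children have disjoint codes, and weights are
          distinct.\<close>
        moreover have "wt e \<noteq> wt (CA ! i)"
        proof
          assume "wt e = wt (CA ! i)"
          then have "e = CA ! i" using inj_onD[OF wt_inj _ ec slist_codes[OF sA(1)]] il by (simp add: la_def)
          moreover have "CA ! i \<in> {po<..po + h2}" "CB ! j \<in> {po + h2<..po + h2 + h2}"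
            using CAs nth_mem[of i CA] nth_mem[of j CB] il jl unfolding la_def lb_def by blast+
          ultimately show False using e by auto
        qed
        moreover have "y = CA ! i \<or> wt (CA ! i) < wt y" using y dA(1)[OF il] afterA[OF _ il] by auto
        ultimately show ?thesis by auto
      qed
      have Le: "wt x < wt e" if "x \<in> set L" for x using cL(4)[OF that] dB(1)[OF jl] e by simp
      show ?thesis unfolding cur_def
      proof (intro conjI ballI)
        show "slist (L @ [e])" using cL(1) ec Le by (simp add: slist_append slist_Cons) (simp add: slist_def)
        show "set (L @ [e]) = set (take i' CA) \<union> set (take j' CB)" using cL(2) dB(2)[OF jl] e by auto
        fix x y assume x: "x \<in> set (L @ [e])" and y: "y \<in> set (drop i' CA) \<union> set (drop j' CB)"
        have y': "y \<in> set (drop i CA) \<union> set (drop j CB)" using y dB(1)[OF jl] e by auto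
        have "wt e < wt y" using y eA afterB[OF _ jl] e by auto
        then show "wt x < wt y" using x cL(4)[OF _ y'] by auto
      qed (use e ij jl cL in auto)
    qed
    have cr': "created s' = created s @ []" by (simp add: s'_def)
    have "marking s' L" by (rule marking_cong[OF mcg(1) _ _ _ cr']) (auto simp: s'_def)
    moreover have "chaining s' L" by (rule chaining_cong[OF mcg(2)]) (auto simp: s'_def)
    moreover have "growing s' L" by (rule growing_cong[OF mcg(3) _ _ cr']) (auto simp: s'_def)
    moreover have "fr s'" using fr by (simp add: fr_def s'_def agree_def Z_def)
    then have "cv i' j' s'" by (simp add: cv_def s'_def)
    moreover have "i' + j' = i + j + 1" by (simp add: i'_def j'_def)
    moreover have "vars s' ''e'' = e" by (simp add: s'_def)
    ultimately show "wpl choose_com (\<lambda>s'. \<exists>i' j'. i' + j' = i + j + 1 \<and> cur i' j' (L @ [vars s' ''e'']) \<and> cv i' j' s' \<and>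
       marking s' L \<and> chaining s' L \<and> growing s' L) s"
      using c' by (intro wpl_mono[OF run] exI[of _ i'] exI[of _ j']) simp
    show "com_cost choose_com \<le> 150" by (simp add: choose_com_def)
  qed
  have cvx: "cv i j s'" if c: "cv i j s" and ag: "agree Y s s'" and Y: "Y \<subseteq> {''h'', ''t'', ''v'', ''k'', ''m'', ''u'', ''g''}"
    and a1: "\<forall>a. a \<notin> {''N'', ''B'', ''H'', ''C''} \<longrightarrow> arrs s' a = arrs s a"
    and a2: "\<forall>a i. a \<noteq> ''N'' \<and> i \<notin> {k * W + po..<k * W + po + 2 ^ k} \<longrightarrow> arrs s' a i = arrs s a i"
    and a3: "\<forall>i. i \<notin> (+) (k * W) ` {po<..po + 2 ^ k} \<longrightarrow> arrs s' ''N'' i = arrs s ''N'' i"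
    and a4: "\<exists>ys. created s' = created s @ ys" for i j s s' Y
  proof -
    have ag': "vars s' z = vars s z" if "z \<notin> {''h'', ''t'', ''v'', ''k'', ''m'', ''u'', ''g''}" for z
    proof -
      have "z \<notin> Y" using that by (rule contra_subsetD[OF Y])
      with ag show ?thesis by (simp add: agree_def)
    qed
    have fr: "fr s" using c by (simp add: cv_def)
    have "agree Z s0 s'" using fr ag' by (simp add: fr_def agree_def Z_def)
    moreover have "\<exists>ys. created s' = created s0 @ ys"
    proof -
      have "\<exists>ys. created s = created s0 @ ys" using fr unfolding fr_def by blast
      with a4 show ?thesis by auto
    qed
    moreover have "vars s' ''A'' = P + la" "vars s' ''B'' = P + h2 + lb" using fr ag' by (simp_all add: fr_def)
    moreover have "arrs s' a i = arrs s0 a i" if "a \<noteq> ''N''" "i \<notin> {k * W + po..<k * W + po + 2 ^ k}" for a i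
      using a2 fr that unfolding fr_def by metis
    moreover have "arrs s' a = arrs s0 a" if "a \<notin> {''N'', ''B'', ''H'', ''C''}" for a
      using a1 fr that unfolding fr_def by metis
    moreover have "arrs s' ''N'' i = arrs s0 ''N'' i" if "i \<notin> (+) (k * W) ` {po<..po + 2 ^ k}" for i
      using a3 fr that unfolding fr_def by metis
    ultimately have "fr s'" unfolding fr_def by blast
    then show ?thesis using c ag' by (simp add: cv_def)
  qed
  have body: "wpc merge_body 360 (\<lambda>s'. \<exists>m'<m. I m' s') s"
    if I0: "I m s" and g: "aval ?b3 s \<noteq> 0" for m s
  proof -
    from I0 obtain i j L where c: "cur i j L" and cv: "cv i j s" and m: "m = la + lb - (i + j)"
      and mcg: "marking s L" "chaining s L" "growing s L" by (auto simp: I_def)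
    have "i < la \<or> j < lb" using g cv by (auto simp: cv_def fr_def split: if_splits)
    then have lt: "i + j < la + lb" using c by (auto simp: cur_def)
    have len: "length L < 2 ^ d" "length L < 2 ^ k" using c lt lsum le by (auto simp: cur_def)
    have zl: "i \<notin> {k * W + po..k * W + po + length L}" if "i \<notin> {k * W + po..<k * W + po + 2 ^ k}" for i
      using that len(2) by auto
    \<comment> \<open>The three flags tell which of the invariants for marks, links and basis has
      already absorbed the new element.\<close>
    define R where "R L1 L2 L3 s' \<longleftrightarrow> (\<exists>i' j'. i' + j' = i + j + 1 \<and> cur i' j' (L @ [vars s' ''e'']) \<and> cv i' j' s' \<and>
       marking s' (if L1 then L @ [vars s' ''e''] else L) \<and> chaining s' (if L2 then L @ [vars s' ''e''] else L) \<and>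
       growing s' (if L3 then L @ [vars s' ''e''] else L))" for L1 L2 L3 s'
    have b1: "wpc choose_com 150 (R False False False) s"
      by (rule wpc_weaken[OF choose[OF c cv mcg lt] order_refl]) (simp add: R_def)
    have b2: "wpc mark_com 80 (R True False False) s1" if R: "R False False False s1" for s1
    proof -
      from R obtain i' j' where ij: "i' + j' = i + j + 1" "cur i' j' (L @ [vars s1 ''e''])" "cv i' j' s1"
        and r: "marking s1 L" "chaining s1 L" "growing s1 L" by (auto simp: R_def)
      note fd = frD[of s1]
      have fr: "fr s1" using ij by (simp add: cv_def)
      have h: "handle s1 (vars s1 ''h'') (set L)" using r by (simp add: growing_def)
      from mark_correct[OF r(1) h refl frD(3)[OF fr] len(1)] show ?thesis unfolding frD(1,2)[OF fr]
      proof (rule wpc_weaken[OF _ order_refl], elim conjE)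
        fix s2 assume a: "marking s2 (L @ [vars s1 ''e''])" "agree {''t'', ''k''} s1 s2" "created s2 = created s1"
          "\<forall>a. a \<notin> {''B'', ''H''} \<longrightarrow> arrs s2 a = arrs s1 a"
          "\<forall>a i. i \<notin> {k * W + po..k * W + po + length L} \<longrightarrow> arrs s2 a i = arrs s1 a i"
        have cv2: "cv i' j' s2"
        proof (rule cvx[OF ij(3) a(2)])
          show "\<forall>a i. a \<noteq> ''N'' \<and> i \<notin> {k * W + po..<k * W + po + 2 ^ k} \<longrightarrow> arrs s2 a i = arrs s1 a i"
            using a(5) zl by blast
        qed (use a(3,4) in simp_all)
        have cr2: "created s2 = created s1 @ []" using a by simp
        have "chaining s2 L" by (rule chaining_cong[OF r(2)], erule agree_in[OF a(2)]) (use a(2-4) in simp_all)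
        moreover have "growing s2 L" by (rule growing_cong[OF r(3) _ _ cr2], erule agree_in[OF a(2)]) (use a(2-4) in simp_all)
        moreover have "vars s2 ''e'' = vars s1 ''e''" using a by (simp add: agree_def)
        ultimately show "R True False False s2" unfolding R_def using ij cv2 a(1) by (intro exI[of _ i'] exI[of _ j']) simp
      qed
    qed
    have b3: "wpc chain_com 50 (R True True False) s1" if R: "R True False False s1" for s1
    proof -
      from R obtain i' j' where ij: "i' + j' = i + j + 1" "cur i' j' (L @ [vars s1 ''e''])" "cv i' j' s1"
        and r: "marking s1 (L @ [vars s1 ''e''])" "chaining s1 L" "growing s1 L" by (auto simp: R_def)
      have fr: "fr s1" using ij by (simp add: cv_def)
      have sl: "slist (L @ [vars s1 ''e''])" using ij by (simp add: cur_def)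
      have sub: "insert (vars s1 ''e'') (set L) \<subseteq> {po<..po + 2 ^ k}"
      proof -
        have "set (L @ [vars s1 ''e'']) \<subseteq> set CA \<union> set CB" using ij(2) by (auto simp: cur_def dest: in_set_takeD)
        moreover have "set CA \<union> set CB \<subseteq> {po<..po + 2 ^ k}" using CAs kk by (auto simp: h2_def)
        ultimately show ?thesis by auto
      qed
      from chain_correct[OF r(2) sl refl] show ?thesis unfolding frD(1,2)[OF fr]
      proof (rule wpc_weaken[OF _ order_refl], elim conjE)
        fix s2 assume a: "chaining s2 (L @ [vars s1 ''e''])" "agree {''v''} s1 s2" "created s2 = created s1"
          "\<forall>a. a \<noteq> ''N'' \<longrightarrow> arrs s2 a = arrs s1 a"
          "\<forall>i. i \<notin> (+) (k * W) ` insert (vars s1 ''e'') (set L) \<longrightarrow> arrs s2 ''N'' i = arrs s1 ''N'' i"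
        have a5: "\<forall>i. i \<notin> (+) (k * W) ` {po<..po + 2 ^ k} \<longrightarrow> arrs s2 ''N'' i = arrs s1 ''N'' i"
          using a(5) image_mono[OF sub, of "(+) (k * W)"] by blast
        have cv2: "cv i' j' s2" by (rule cvx[OF ij(3) a(2) _ _ _ a5]) (use a(3,4) in simp_all)
        have cr2: "created s2 = created s1 @ []" using a by simp
        have "marking s2 (L @ [vars s1 ''e''])" by (rule marking_cong[OF r(1) _ _ _ cr2], erule agree_in[OF a(2)]) (use a(2-4) in simp_all)
        moreover have "growing s2 L" by (rule growing_cong[OF r(3) _ _ cr2], erule agree_in[OF a(2)]) (use a(2-4) in simp_all)
        moreover have "vars s2 ''e'' = vars s1 ''e''" using a by (simp add: agree_def)
        ultimately show "R True True False s2" unfolding R_def using ij cv2 a(1) by (intro exI[of _ i'] exI[of _ j']) simp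
      qed
    qed
    have b4: "wpc grow_com 80 (\<lambda>s'. \<exists>m'<m. I m' s') s1" if R: "R True True False s1" for s1
    proof -
      from R obtain i' j' where ij: "i' + j' = i + j + 1" "cur i' j' (L @ [vars s1 ''e''])" "cv i' j' s1"
        and r: "marking s1 (L @ [vars s1 ''e''])" "chaining s1 (L @ [vars s1 ''e''])" "growing s1 L" by (auto simp: R_def)
      have fr: "fr s1" using ij by (simp add: cv_def)
      have sl: "slist (L @ [vars s1 ''e''])" using ij by (simp add: cur_def)
      from grow_correct[OF r(3) sl refl len(1)] show ?thesis unfolding frD(1,2)[OF fr]
      proof (rule wpc_weaken[OF _ order_refl], elim conjE exE)
        fix s2 ys assume a: "growing s2 (L @ [vars s1 ''e''])" "agree {''h'', ''g'', ''u'', ''m''} s1 s2"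
          "\<forall>a. a \<noteq> ''C'' \<longrightarrow> arrs s2 a = arrs s1 a"
          "\<forall>a i. i \<notin> {k * W + po..k * W + po + length L} \<longrightarrow> arrs s2 a i = arrs s1 a i"
          and cr2: "created s2 = created s1 @ ys"
        have cv2: "cv i' j' s2"
        proof (rule cvx[OF ij(3) a(2)])
          show "\<forall>a i. a \<noteq> ''N'' \<and> i \<notin> {k * W + po..<k * W + po + 2 ^ k} \<longrightarrow> arrs s2 a i = arrs s1 a i"
            using a(4) zl by blast
        qed (use a(3) cr2 in simp_all)
        have "marking s2 (L @ [vars s1 ''e''])" by (rule marking_cong[OF r(1) _ _ _ cr2], erule agree_in[OF a(2)]) (use a(2-4) in simp_all)
        moreover have "chaining s2 (L @ [vars s1 ''e''])" by (rule chaining_cong[OF r(2)], erule agree_in[OF a(2)]) (use a(2-4) in simp_all)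
        ultimately have "I (la + lb - (i' + j')) s2" unfolding I_def using ij cv2 a(1) by blast
        then show "\<exists>m'<m. I m' s2" using ij(1) m lt by (intro exI[of _ "la + lb - (i' + j')"]) simp
      qed
    qed
    show ?thesis unfolding merge_body_def
      by (rule wpc_seqI[OF b1 wpc_seqI[OF b2 wpc_seqI[OF b3 b4 order_refl] order_refl]]) simp_all
  qed
  define E where "E s \<longleftrightarrow> (\<exists>L. fr s \<and> slist L \<and> set L = set CA \<union> set CB \<and> length L = la + lb \<and>
     marking s L \<and> chaining s L \<and> growing s L)" for s
  have exit: "E s" if I0: "I m s" and g: "aval ?b3 s = 0" for m s
  proof -
    from I0 obtain i j L where c: "cur i j L" and cv: "cv i j s"
      and mcg: "marking s L" "chaining s L" "growing s L" by (auto simp: I_def)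
    have fr: "fr s" using cv by (simp add: cv_def)
    have "i = la" "j = lb" using g cv c by (auto simp: cv_def fr_def cur_def split: if_splits)
    then show ?thesis unfolding E_def using c fr mcg by (intro exI[of _ L]) (simp add: cur_def la_def lb_def)
  qed
  have loop: "wpc (While (Add (Less (Var ''a'') (Var ''A'')) (Less (Var ''b'') (Var ''B''))) merge_body)
      (380 * (2 ^ k + 1)) E s" if "I (la + lb) s" for s
  proof (rule wpc_whileI[of I, OF that body exit])
    have "(la + lb + 1) * (360 + 1 + expr_cost ?b3) \<le> (2 ^ k + 1) * 380"
      using lsum by (intro mult_le_mono) auto
    then show "(la + lb + 1) * (360 + 1 + expr_cost ?b3) \<le> 380 * (2 ^ k + 1)"
      by (simp only: mult.commute)
  qed
  have fin: "wpc ?c2 60 ?Q s" if s: "E s" for s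
  proof (rule wpc_straight)
    from s obtain L where fr: "fr s" and L: "slist L" "set L = set CA \<union> set CB" "length L = la + lb"
      and mcg: "marking s L" "chaining s L" "growing s L" by (auto simp: E_def)
    obtain D where D: "slist D" "set D = greedy (set L)" "vars s ''m'' = length D"
      "\<And>j. j < length D \<Longrightarrow> arrs s ''C'' (k * W + po + j) = D ! j"
      using mcg(3) frD[OF fr] by (auto simp: growing_def)
    define c where "c = vars s ''k''"
    have M: "vars s ''t'' + length L = c * K" "vars s ''t'' < K"
      "\<And>b. b < c \<Longrightarrow> arrs s ''B'' (k * W + po + b) = nth0 L (b * K)"
      "\<And>b. b < c \<Longrightarrow> handle s (arrs s ''H'' (k * W + po + b)) (set (take (b * K) L))"
      using mcg(1) frD[OF fr] by (auto simp: marking_def c_def)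
    have c1: "c \<le> 2 ^ k" using marking_count(2)[OF mcg(1)] L(3) lsum by (simp add: c_def)
    \<comment> \<open>Rounding up adds less than one block to a list of at most
      \<open>2 * (K * K)\<close> entries.\<close>
    have "c * K < (2 * K + 1) * K" using M(1,2) L(3) KK by (simp add: la_def lb_def)
    then have "c < 2 * K + 1" unfolding mult_less_cancel2 by blast
    then have c2: "c \<le> 2 * K" by simp
    define s' where "s' = s\<lparr>arrs := (arrs s)(''S'' := (arrs s ''S'')(k * W + po := length D),
      ''T'' := (arrs s ''T'')(k * W + po := c)), vars := (vars s)(''o'' := po + 2 ^ k)\<rparr>"
    have "po + 2 ^ k \<le> vmax t" for t using le pow_le by (intro le_vmax) simp
    then have run: "wpl ?c2 (\<lambda>t. t = s') s"
      using frD[OF fr] frv[OF fr, of "''q''"] vs D(3) by (simp add: s'_def c_def Z_def)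
    have nd: "node s' k po L"
      using L(1) mcg(2) frD[OF fr] M c1 c2
      by (simp add: node_def s'_def chaining_def chained_def marked_def prefixes_def handle_def)
    have "set CA \<union> set CB \<subseteq> {po<..po + 2 ^ k}" using CAs kk by (auto simp: h2_def)
    then have "set D \<subseteq> {po<..po + 2 ^ k}" using D(2) greedy_subset[of "set L"] L(2) by blast
    then have cl: "clist s' k po D" using D by (simp add: clist_def s'_def)
    have vs': "vars s' z = vars s0 z" if "z \<in> {''p'', ''l'', ''f'', ''q'', ''W'', ''K''}" for z
      using frv[OF fr, of z] that by (auto simp: s'_def Z_def)
    have a1: "arrs s' a i = arrs s0 a i" if "a \<in> {''B'', ''H'', ''C''}" "i \<notin> {k * W + po..<k * W + po + 2 ^ k}" for a i
    proof -
      have a: "a \<noteq> ''N''" "a \<noteq> ''S''" "a \<noteq> ''T''" using that(1) by auto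
      then have "arrs s' a i = arrs s a i" by (simp add: s'_def)
      then show ?thesis using fr a(1) that(2) unfolding fr_def by metis
    qed
    have a2: "arrs s' a i = arrs s0 a i" if "a \<in> {''S'', ''T''}" "i \<noteq> k * W + po" for a i
    proof -
      have "a \<notin> {''N'', ''B'', ''H'', ''C''}" using that(1) by auto
      then have "arrs s a = arrs s0 a" using fr unfolding fr_def by metis
      then show ?thesis using that by (auto simp: s'_def)
    qed
    have a3: "arrs s' ''N'' i = arrs s0 ''N'' i" if "i \<notin> (+) (k * W) ` {po<..po + 2 ^ k}" for i
    proof -
      have "arrs s' ''N'' i = arrs s ''N'' i" by (simp add: s'_def)
      then show ?thesis using fr that unfolding fr_def by metis
    qed
    have cr': "\<exists>ys. created s' = created s0 @ ys" using fr by (simp add: fr_def s'_def)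
    have Qs: "?Q s'"
    proof (intro conjI)
      show "\<exists>L. node s' k po L \<and> set L = set CA \<union> set CB" using nd L by blast
      show "\<exists>D. clist s' k po D \<and> set D = greedy (set CA \<union> set CB)" using cl D L by auto
      show "vars s' ''o'' = po + 2 ^ k" by (simp add: s'_def)
      show "\<exists>ys. created s' = created s0 @ ys" by (rule cr')
    qed (intro ballI allI impI; rule vs' a1 a2 a3; assumption)+
    show "wpl ?c2 ?Q s"
      by (rule wpl_mono[OF run]) (hypsubst, rule Qs)
  qed simp
  have "2 \<le> (2::nat) ^ k" using k power_increasing[of 1 k "2::nat"] by simp
  then have cost: "100 + (380 * (2 ^ k + 1) + 60) \<le> 700 * (2::nat) ^ k" by simp
  show ?thesis unfolding build_node_def
    by (rule wpc_seqI[OF init wpc_seqI[OF loop fin order_refl] cost])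
qed

end

text \<open>As \<open>W\<close> exceeds the number of leaves by one, the loop test says that
  \<open>o\<close> is below \<open>2 ^ d\<close>. Afterwards the parameters move one level
  up.\<close>

definition build_level :: com where
  "build_level =
     Assign ''o'' (Const 0) ;;
     While (Less (Add (Var ''o'') (Const 1)) (Var ''W'')) build_node ;;
     (Assign ''p'' (Var ''l'') ;; Assign ''l'' (Add (Var ''l'') (Var ''W'')) ;;
      Assign ''f'' (Var ''q'') ;; Assign ''q'' (Add (Var ''q'') (Var ''q'')))"

definition copy_body :: com where
  "copy_body =
     Assign ''e'' (Arr ''C'' (Add (Var ''p'') (Var ''i''))) ;;
     Store ''basis'' (Var ''i'') (Sub (Var ''e'') (Const 1)) ;;
     Store ''L'' (Var ''e'') (Var ''i'') ;;
     Assign ''i'' (Add (Var ''i'') (Const 1))"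

definition build_com :: com where
  "build_com =
     While (Less (Var ''q'') (Var ''W'')) build_level ;;
     (Assign ''size'' (Arr ''S'' (Var ''p'')) ;; Assign ''i'' (Const 0)) ;;
     While (Less (Var ''i'') (Var ''size'')) copy_body"

section \<open>Building all levels\<close>

context tree
begin

definition base :: "nat \<Rightarrow> 'a state \<Rightarrow> bool" where
  "base k s \<longleftrightarrow> vars s ''p'' = (k - 1) * W \<and> vars s ''l'' = k * W \<and> vars s ''f'' = 2 ^ (k - 1) \<and>
     vars s ''q'' = 2 ^ k \<and> vars s ''W'' = W \<and> vars s ''K'' = K \<and> created s \<noteq> [] \<and> created s ! 0 = {}"

text \<open>In contrast to \<open>nodes\<close> this includes level 0, where the leaves have bases
  but no node lists.\<close>

definition clists :: "nat set \<Rightarrow> nat \<Rightarrow> nat \<Rightarrow> 'a state \<Rightarrow> bool" where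
  "clists X k p s \<longleftrightarrow> 2 ^ k dvd p \<and> p < 2 ^ d \<longrightarrow> (\<exists>D. clist s k p D \<and> set D = greedy (part k p X))"

definition nodes :: "nat set \<Rightarrow> nat \<Rightarrow> nat \<Rightarrow> 'a state \<Rightarrow> bool" where
  "nodes X k p s \<longleftrightarrow> valid k p \<longrightarrow> (\<exists>L. node s k p L \<and> set L = cand k p X)"

lemma build_level_correct:
  assumes X: "X \<subseteq> codes" and K1: "1 \<le> K" and KK: "rnk X \<le> K * K" and k: "1 \<le> k" "k \<le> d"
    and b0: "base k s0" and c0: "\<And>p. clists X (k - 1) p s0" and n0: "\<And>k' p. k' < k \<Longrightarrow> nodes X k' p s0"
  shows "wpc build_level (1500 * 2 ^ d) (\<lambda>s. base (k + 1) s \<and> (\<forall>p. clists X k p s) \<and>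
     (\<forall>k' p. k' < k + 1 \<longrightarrow> nodes X k' p s)) s0" (is "wpc _ _ ?Q s0")
proof -
  let ?c1 = "Assign ''p'' (Var ''l'') ;; Assign ''l'' (Add (Var ''l'') (Var ''W'')) ;;
      Assign ''f'' (Var ''q'') ;; Assign ''q'' (Add (Var ''q'') (Var ''q''))"
  let ?b2 = "Less (Add (Var ''o'') (Const 1)) (Var ''W'')"
  have kk: "(2::nat) ^ k = 2 ^ (k - 1) + 2 ^ (k - 1)" using k by (cases k) auto
  define M where "M = (2::nat) ^ (d - k)"
  have Md: "M * 2 ^ k = 2 ^ d" using k by (simp add: M_def power_add[symmetric])
  define I where "I m s \<longleftrightarrow> (\<exists>j\<le>M. m = M - j \<and> vars s ''o'' = j * 2 ^ k \<and> base k s \<and>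
    (\<forall>p. clists X (k - 1) p s) \<and> (\<forall>k' p. k' < k \<longrightarrow> nodes X k' p s) \<and>
    (\<forall>p<j * 2 ^ k. clists X k p s \<and> nodes X k p s))" for m s
  have init: "wpc (Assign ''o'' (Const 0)) 10 (I M) s0"
  proof (rule wpc_straight)
    have "base k (set_var ''o'' 0 s0)" using b0 by (simp add: base_def)
    moreover have "clists X (k - 1) p (set_var ''o'' 0 s0)" for p
      using c0[of p] by (simp add: clists_def clist_def)
    moreover have "nodes X k' p (set_var ''o'' 0 s0)" if "k' < k" for k' p
      using n0[OF that, of p] by (simp add: nodes_def node_def chained_def marked_def prefixes_def handle_def)
    ultimately show "wpl (Assign ''o'' (Const 0)) (I M) s0"
      by (simp add: I_def)
  qed simp
  have step: "wpc build_node (700 * 2 ^ k) (\<lambda>s'. \<exists>m'<m. I m' s') s"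
    if I: "I m s" and g: "aval ?b2 s \<noteq> 0" for m s
  proof -
    from I obtain j where j: "j \<le> M" "m = M - j" "vars s ''o'' = j * 2 ^ k" and b: "base k s"
      and c: "\<And>p. clists X (k - 1) p s" and nd: "\<And>k' p. k' < k \<Longrightarrow> nodes X k' p s"
      and cn: "\<And>p. p < j * 2 ^ k \<Longrightarrow> clists X k p s \<and> nodes X k p s" unfolding I_def by blast
    define po where "po = j * 2 ^ k"
    have "po < 2 ^ d" using g j(3) b by (simp add: base_def W_def po_def split: if_splits)
    then have v: "valid k po" using k by (simp add: valid_def po_def)
    have jM: "j < M"
    proof -
      have "j * 2 ^ k < M * 2 ^ k" using \<open>po < 2 ^ d\<close> unfolding Md po_def .
      then show ?thesis by simp
    qed
    have le: "po + 2 ^ k \<le> 2 ^ d" by (rule valid_le[OF v])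
    have dv: "2 ^ (k - 1) dvd po" "2 ^ (k - 1) dvd po + 2 ^ (k - 1)"
      unfolding po_def by (auto intro!: dvd_mult le_imp_power_dvd)
    have "po + 2 ^ (k - 1) < 2 ^ d" using le kk by (simp add: less_le_trans[of _ "po + 2 ^ k"])
    then obtain CA CB where CA: "clist s (k - 1) po CA" "set CA = greedy (part (k - 1) po X)"
      and CB: "clist s (k - 1) (po + 2 ^ (k - 1)) CB" "set CB = greedy (part (k - 1) (po + 2 ^ (k - 1)) X)"
      using c[of po] c[of "po + 2 ^ (k - 1)"] dv \<open>po < 2 ^ d\<close> unfolding clists_def by blast
    \<comment> \<open>The size of a greedy basis is the rank of its node, and that is at most the
      rank of the whole set; here the choice of \<open>K\<close> enters.\<close>
    have lenK: "length D \<le> K * K" if "slist D" "set D = greedy (part k' p X)" for D k' p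
    proof -
      have pX: "part k' p X \<subseteq> codes" using X part_subset by blast
      have "length D = card (set D)" using slist_distinct[OF that(1)] by (simp add: distinct_card)
      also have "\<dots> = rnk (part k' p X)" unfolding that(2) by (rule card_greedy[OF pX])
      also have "\<dots> \<le> rnk X" using X part_subset by (intro r_mono) auto
      finally show ?thesis using KK by simp
    qed
    have lens: "length CA + length CB \<le> 2 * (K * K)"
      using lenK[of CA, OF _ CA(2)] lenK[of CB, OF _ CB(2)] CA(1) CB(1) by (simp add: clist_def)
    have cX: "set CA \<union> set CB = cand k po X" using CA CB by (simp add: cand_def)
    have gX: "greedy (set CA \<union> set CB) = greedy (part k po X)"
      unfolding CA(2) CB(2) part_split(1)[OF k(1), of po X] using X part_subset by (intro greedy_sparse) blast+
    note bD = b[unfolded base_def]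
    from build_node_correct[OF v K1 _ _ _ _ _ _ _ _ CA(1) CB(1) lens] show ?thesis
    proof (rule wpc_weaken[OF _ order_refl], goal_cases)
      case (9 s')
      then show ?case
      proof (elim conjE exE)
        fix ys L D
        assume vo: "vars s' ''o'' = po + 2 ^ k"
          and vs0: "\<forall>z\<in>{''p'', ''l'', ''f'', ''q'', ''W'', ''K''}. vars s' z = vars s z"
          and cr: "created s' = created s @ ys"
          and BHC0: "\<forall>a\<in>{''B'', ''H'', ''C''}. \<forall>i. i \<notin> {k * W + po..<k * W + po + 2 ^ k} \<longrightarrow> arrs s' a i = arrs s a i"
          and ST0: "\<forall>a\<in>{''S'', ''T''}. \<forall>i. i \<noteq> k * W + po \<longrightarrow> arrs s' a i = arrs s a i"
          and NN0: "\<forall>i. i \<notin> (+) (k * W) ` {po<..po + 2 ^ k} \<longrightarrow> arrs s' ''N'' i = arrs s ''N'' i"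
          and L0: "node s' k po L" "set L = set CA \<union> set CB"
          and D0: "clist s' k po D" "set D = greedy (set CA \<union> set CB)"
      note vs = vs0[rule_format] and BHC = BHC0[rule_format] and ST = ST0[rule_format] and NN = NN0[rule_format]
      have b': "base k s'" using b cr by (simp add: base_def vs nth_append)
      \<comment> \<open>Nodes are built by increasing level and position, so finished lists end
        before the cells of the new node.\<close>
      have clf: "clist s' k' p D" if cl: "clist s k' p D" and lt: "k' * W + p + 2 ^ k' \<le> k * W + po" for k' p D
      proof -
        have "length D \<le> 2 ^ k'" using cl slist_length_le by (auto simp: clist_def)
        then have "arrs s' ''C'' (k' * W + p + x) = arrs s ''C'' (k' * W + p + x)" if "x < length D" for x
          using lt that by (intro BHC) auto
        moreover have "arrs s' ''S'' (k' * W + p) = arrs s ''S'' (k' * W + p)"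
        proof (rule ST)
          have "0 < (2::nat) ^ k'" by simp
          then show "k' * W + p \<noteq> k * W + po" using lt by linarith
        qed simp
        ultimately show ?thesis using cl by (simp add: clist_def)
      qed
      have c': "clists X (k - 1) p s'" for p
        unfolding clists_def
      proof
        assume p: "2 ^ (k - 1) dvd p \<and> p < 2 ^ d"
        then obtain D where D: "clist s (k - 1) p D" "set D = greedy (part (k - 1) p X)"
          using c[of p] unfolding clists_def by blast
        have "p + 2 ^ (k - 1) \<le> 2 ^ d"
        proof (cases "k - 1 = 0")
          case False
          then have "valid (k - 1) p" using p k by (simp add: valid_def; linarith)
          then show ?thesis by (rule valid_le)
        qed (use p in simp)
        moreover have "k * W = (k - 1) * W + W" using k by (cases k) auto
        ultimately have "(k - 1) * W + p + 2 ^ (k - 1) \<le> k * W + po" by (simp add: W_def)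
        from clf[OF D(1) this] D(2) show "\<exists>D. clist s' (k - 1) p D \<and> set D = greedy (part (k - 1) p X)" by blast
      qed
      have ndf: "nodes X k' p s'" if n: "nodes X k' p s" and ne: "k' \<noteq> k \<or> p \<noteq> po" for k' p
        unfolding nodes_def
      proof
        assume v': "valid k' p"
        then obtain L where L: "node s k' p L" "set L = cand k' p X" using n by (auto simp: nodes_def)
        have "node s' k' p L"
        proof (rule node_frame[OF L(1) v' _ v ne _ _ _ cr])
          show "set L \<subseteq> part k' p X" using L(2) cand_subset[of k' p X] v' by (simp add: valid_def)
          have "p < W" "po < W" using v v' by (auto simp: valid_def W_def)
          then have "k' * W + p \<noteq> k * W + po" using idx_inj[of p po k' k] ne by blast
          then show "arrs s' ''T'' (k' * W + p) = arrs s ''T'' (k' * W + p)" by (intro ST) auto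
        qed (use BHC NN in auto)
        then show "\<exists>L. node s' k' p L \<and> set L = cand k' p X" using L by blast
      qed
      have new: "clists X k po s'" "nodes X k po s'"
        using L0(1) L0(2)[unfolded cX] D0(1) D0(2)[unfolded gX] unfolding clists_def nodes_def by blast+
      have cn': "clists X k p s' \<and> nodes X k p s'" if p: "p < Suc j * 2 ^ k" for p
      proof (cases "2 ^ k dvd p")
        case False
        then show ?thesis by (simp add: clists_def nodes_def valid_def)
      next
        case True
        then obtain i where i: "p = i * 2 ^ k" by (auto simp: mult.commute)
        have "i < Suc j" using p unfolding i mult_less_cancel2 by blast
        show ?thesis
        proof (cases "i = j")
          case True
          then show ?thesis using new i by (simp add: po_def)
        next
          case False
          then have "i + 1 \<le> j" using \<open>i < Suc j\<close> by simp
          then have "(i + 1) * 2 ^ k \<le> j * 2 ^ k" by (rule mult_le_mono1)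
          then have ppo: "p + 2 ^ k \<le> po" by (simp add: i po_def)
          then have "p < po" using zero_less_power[of "2::nat" k] by linarith
          have "clists X k p s'" using cn[of p] \<open>p < po\<close> clf[of k p] ppo
            unfolding clists_def po_def[symmetric] by (metis add.assoc add_le_cancel_left)
          moreover have "nodes X k p s'" using ndf[of k p] cn[of p] \<open>p < po\<close> by (simp add: po_def[symmetric])
          ultimately show ?thesis by simp
        qed
      qed
      have "I (M - Suc j) s'"
        unfolding I_def
      proof (intro exI[of _ "Suc j"] conjI allI impI)
        show "vars s' ''o'' = Suc j * 2 ^ k" using vo by (simp add: po_def)
        show "nodes X k' p s'" if "k' < k" for k' p using ndf[OF nd[OF that]] that by simp
      qed (use jM b' c' cn' in auto)
      then show "\<exists>m'<m. I m' s'" using j jM by (intro exI[of _ "M - Suc j"]) simp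
      qed
    qed (use bD j in \<open>simp_all add: po_def\<close>)
  qed
  define E where "E s \<longleftrightarrow> base k s \<and> (\<forall>p. clists X k p s) \<and> (\<forall>k' p. k' < k + 1 \<longrightarrow> nodes X k' p s)" for s
  have exit: "E s" if I: "I m s" and g: "aval ?b2 s = 0" for m s
  proof -
    from I obtain j where j: "j \<le> M" "vars s ''o'' = j * 2 ^ k" and b: "base k s"
      and nd: "\<And>k' p. k' < k \<Longrightarrow> nodes X k' p s"
      and cn: "\<And>p. p < j * 2 ^ k \<Longrightarrow> clists X k p s \<and> nodes X k p s" unfolding I_def by blast
    have "2 ^ d \<le> j * 2 ^ k" using g j b by (simp add: base_def W_def split: if_splits)
    then have all: "clists X k p s \<and> nodes X k p s" if "p < 2 ^ d" for p using cn that by simp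
    have "clists X k p s" "nodes X k p s" for p
      using all[of p] by (auto simp: clists_def nodes_def valid_def)
    with b nd show ?thesis by (auto simp: E_def less_Suc_eq)
  qed
  have loop: "wpc (While (Less (Add (Var ''o'') (Const 1)) (Var ''W'')) build_node) (1440 * 2 ^ d) E s" if "I M s" for s
  proof (rule wpc_whileI[of I, OF that step exit])
    have p1: "1 \<le> (2::nat) ^ k" by simp
    have "expr_cost ?b2 \<le> 19" by simp
    then have "(M + 1) * (700 * 2 ^ k + 1 + expr_cost ?b2) \<le> (M + 1) * (720 * 2 ^ k)"
      using p1 by (intro mult_le_mono2) linarith
    \<comment> \<open>The nodes of a level together have width \<open>2 ^ d\<close>; the summand
      \<open>2 ^ k\<close> stems from the last loop test.\<close>
    also have "\<dots> = 720 * (2 ^ d + 2 ^ k)" unfolding Md[symmetric] by (simp add: algebra_simps)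
    also have "\<dots> \<le> 1440 * 2 ^ d" using power_increasing[of k d "2::nat"] k by simp
    finally show "(M + 1) * (700 * 2 ^ k + 1 + expr_cost ?b2) \<le> 1440 * 2 ^ d" .
  qed
  have fin: "wpc ?c1 40 ?Q s" if E: "E s" for s
  proof (rule wpc_straight)
    have b: "vars s ''l'' = k * W" "vars s ''q'' = 2 ^ k" "vars s ''W'' = W" "vars s ''K'' = K" "created s \<noteq> []" "created s ! 0 = {}"
      using E by (auto simp: E_def base_def)
    have v1: "k * W + W \<le> vmax t" for t using idx_bound[of k W] k by (simp add: vmax_def)
    have "(2::nat) ^ k \<le> 2 ^ d" using k by simp
    then have "2 ^ k + 2 ^ k \<le> 16 * n + 16" using pow_le by linarith
    then have v2: "2 ^ k + 2 ^ k \<le> vmax t" for t by (rule le_vmax)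
    have Qi: "?Q t" if "arrs t = arrs s" "created t = created s" "base (k + 1) t" for t
    proof -
      have "clists X k p t" for p using E that by (simp add: E_def clists_def clist_def)
      moreover have "nodes X k' p t" if "k' < k + 1" for k' p
        using E that \<open>arrs t = arrs s\<close> \<open>created t = created s\<close>
        by (simp add: E_def nodes_def node_def chained_def marked_def prefixes_def handle_def)
      ultimately show ?thesis using that by blast
    qed
    have "wpl ?c1
      (\<lambda>t. arrs t = arrs s \<and> created t = created s \<and> base (k + 1) t) s"
      using b by (simp add: v1 v2 base_def mult_2)
    then show "wpl ?c1 ?Q s"
      by (rule wpl_mono) (rule Qi; simp)
  qed simp
  have "2 \<le> (2::nat) ^ d" using d1 power_increasing[of 1 d "2::nat"] by simp
  then have cost: "10 + (1440 * 2 ^ d + 40) \<le> 1500 * (2::nat) ^ d" by simp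
  show ?thesis unfolding build_level_def
    by (rule wpc_seqI[OF init wpc_seqI[OF loop fin order_refl] cost])
qed

lemma build_correct:
  assumes X: "X \<subseteq> codes" and K1: "1 \<le> K" and KK: "rnk X \<le> K * K"
    and b0: "base 1 s0" and c0: "\<And>p. clists X 0 p s0"
  shows "wpc build_com (1700 * (d + 2) * 2 ^ d) (\<lambda>s. represents s X) s0"
proof -
  define I where "I m s \<longleftrightarrow> (\<exists>k. 1 \<le> k \<and> k \<le> d + 1 \<and> m = d + 1 - k \<and> base k s \<and>
    (\<forall>p. clists X (k - 1) p s) \<and> (\<forall>k' p. k' < k \<longrightarrow> nodes X k' p s))" for m s
  have I0: "I d s0"
  proof -
    have "nodes X 0 p s0" for p by (simp add: nodes_def valid_def)
    then show ?thesis unfolding I_def using b0 c0 by (intro exI[of _ 1]) simp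
  qed
  have step: "wpc build_level (1500 * 2 ^ d) (\<lambda>s'. \<exists>m'<m. I m' s') s"
    if I: "I m s" and g: "aval (Less (Var ''q'') (Var ''W'')) s \<noteq> 0" for m s
  proof -
    from I obtain k where k: "1 \<le> k" "m = d + 1 - k" "base k s"
      and c: "\<And>p. clists X (k - 1) p s" and nd: "\<And>k' p. k' < k \<Longrightarrow> nodes X k' p s" by (auto simp: I_def)
    have "2 ^ k < W" using g k by (simp add: base_def split: if_splits)
    then have "(2::nat) ^ k \<le> 2 ^ d" unfolding W_def by linarith
    then have kd: "k \<le> d" by simp
    from build_level_correct[OF X K1 KK k(1) kd k(3) c nd] show ?thesis
    proof (rule wpc_weaken[OF _ order_refl], goal_cases)
      case (2 s')
      then have "I (d - k) s'" unfolding I_def using kd by (intro exI[of _ "k + 1"]) simp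
      then show ?case using k kd by (intro exI[of _ "d - k"]) simp
    qed
  qed
  define E where "E s \<longleftrightarrow> vars s ''p'' = d * W \<and> vars s ''W'' = W \<and> created s \<noteq> [] \<and> created s ! 0 = {} \<and>
    (\<exists>D. clist s d 0 D \<and> set D = greedy X) \<and> (\<forall>k p. valid k p \<longrightarrow> (\<exists>L. node s k p L \<and> set L = cand k p X))" for s
  have exit: "E s" if I: "I m s" and g: "aval (Less (Var ''q'') (Var ''W'')) s = 0" for m s
  proof -
    from I obtain k where k: "k \<le> d + 1" "base k s"
      and c: "\<And>p. clists X (k - 1) p s" and nd: "\<And>k' p. k' < k \<Longrightarrow> nodes X k' p s" by (auto simp: I_def)
    have "\<not> 2 ^ k < W" using g k by (simp add: base_def split: if_splits)
    then have "\<not> (2::nat) ^ k \<le> 2 ^ d" unfolding W_def by linarith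
    then have kd: "k = d + 1" using k by simp
    have "\<exists>D. clist s d 0 D \<and> set D = greedy X"
      using c[of 0] kd part_all[OF X] by (simp add: clists_def)
    moreover have "\<exists>L. node s k' p L \<and> set L = cand k' p X" if "valid k' p" for k' p
      using nd[of k' p] that kd by (simp add: nodes_def valid_def)
    ultimately show ?thesis using k kd by (simp add: E_def base_def)
  qed
  have loop: "wpc (While (Less (Var ''q'') (Var ''W'')) build_level) ((d + 1) * (1510 * 2 ^ d)) E s0"
  proof (rule wpc_whileI[of I, OF I0 step exit])
    have pd: "1 \<le> (2::nat) ^ d" by simp
    have e: "expr_cost (Less (Var ''q'') (Var ''W'')) \<le> 6" by simp
    show "(d + 1) * (1500 * 2 ^ d + 1 + expr_cost (Less (Var ''q'') (Var ''W''))) \<le> (d + 1) * (1510 * 2 ^ d)"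
      by (rule mult_le_mono2) (use pd e in linarith)
  qed
  have copy: "wpc ((Assign ''size'' (Arr ''S'' (Var ''p'')) ;; Assign ''i'' (Const 0)) ;;
     While (Less (Var ''i'') (Var ''size'')) copy_body) (70 * (n + 2)) (\<lambda>s. represents s X) s" if E: "E s" for s
  proof -
    from E obtain D where D: "clist s d 0 D" "set D = greedy X" by (auto simp: E_def)
    have sD: "slist D" and SD: "arrs s ''S'' (d * W) = length D"
      and CD: "\<And>j. j < length D \<Longrightarrow> arrs s ''C'' (d * W + j) = D ! j" using D by (auto simp: clist_def)
    have Dn: "length D \<le> n"
    proof -
      have "length D = card (set D)" using slist_distinct[OF sD] by (simp add: distinct_card)
      also have "\<dots> \<le> card codes" using sD by (intro card_mono) (auto simp: slist_def codes_def)
      finally show ?thesis by (simp add: codes_def)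
    qed
    define J where "J m t \<longleftrightarrow> vars t ''i'' \<le> length D \<and> m = length D - vars t ''i'' \<and> vars t ''size'' = length D \<and>
      vars t ''p'' = d * W \<and> vars t ''W'' = W \<and> created t = created s \<and>
      (\<forall>a. a \<notin> {''basis'', ''L''} \<longrightarrow> arrs t a = arrs s a) \<and>
      (\<forall>j<vars t ''i''. arrs t ''basis'' j = D ! j - 1 \<and> arrs t ''L'' (D ! j) = j)" for m and t :: "'a state"
    have i1: "wpc (Assign ''size'' (Arr ''S'' (Var ''p'')) ;; Assign ''i'' (Const 0)) 20 (J (length D)) s"
      using E SD by (intro wpc_straight) (simp_all add: J_def E_def)
    have st: "wpc copy_body 60 (\<lambda>t'. \<exists>m'<m. J m' t') t"
      if J: "J m t" and g: "aval (Less (Var ''i'') (Var ''size'')) t \<noteq> 0" for m t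
    proof (rule wpc_straight)
      define i where "i = vars t ''i''"
      have J': "vars t ''size'' = length D" "vars t ''p'' = d * W" "vars t ''W'' = W" "created t = created s"
        "\<And>a. a \<noteq> ''basis'' \<Longrightarrow> a \<noteq> ''L'' \<Longrightarrow> arrs t a = arrs s a" "m = length D - i"
        "\<And>j. j < i \<Longrightarrow> arrs t ''basis'' j = D ! j - 1" "\<And>j. j < i \<Longrightarrow> arrs t ''L'' (D ! j) = j"
        using J unfolding J_def i_def by auto
      have iD: "i < length D" using g J' by (simp add: i_def split: if_splits)
      have ne: "D ! j \<noteq> D ! i" if "j < i" for j
        using slist_distinct[OF sD] that iD by (simp add: nth_eq_iff_index_eq)
      have iv: "Suc i \<le> vmax t'" for t' using iD Dn by (intro le_vmax) simp
      have "wpl copy_body (J (length D - Suc i)) t"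
        using J'(1-5) CD[OF iD] iD iv J'(7,8) ne
        by (auto simp: copy_body_def i_def[symmetric] J_def less_Suc_eq)
      then show "wpl copy_body (\<lambda>t'. \<exists>m'<m. J m' t') t"
        by (rule wpl_mono) (use J'(6) iD in \<open>auto intro!: exI[of _ "length D - Suc i"]\<close>)
      show "com_cost copy_body \<le> 60" by (simp add: copy_body_def)
    qed
    have ex: "represents t X" if J: "J m t" and g: "aval (Less (Var ''i'') (Var ''size'')) t = 0" for m t
    proof -
      have ii: "vars t ''i'' = length D" "vars t ''size'' = length D" using J g by (auto simp: J_def split: if_splits)
      have A: "arrs t a = arrs s a" if "a \<notin> {''basis'', ''L''}" for a using J that unfolding J_def by blast
      have cr: "created t = created s" "vars t ''W'' = W" using J by (auto simp: J_def)
      have bas: "arrs t ''basis'' j = D ! j - 1" "arrs t ''L'' (D ! j) = j" if "j < length D" for j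
        using J that ii unfolding J_def by auto
      have Dc: "0 < D ! j" "D ! j \<le> n" "D ! j - 1 + 1 = D ! j" if "j < length D" for j
        using slist_codes[OF sD that] codes_pos codes_le by fastforce+
      have "basis_ok t (greedy X)"
        unfolding basis_ok_def ii
      proof (intro conjI allI impI)
        fix j assume j: "j < length D"
        show "arrs t ''basis'' j < n" using bas(1)[OF j] Dc(1,2)[OF j] by linarith
        show "arrs t ''L'' (arrs t ''basis'' j + 1) = j" unfolding bas(1)[OF j] Dc(3)[OF j] by (rule bas(2)[OF j])
      next
        have "(\<lambda>i. arrs t ''basis'' i + 1) ` {..<length D} = (!) D ` {..<length D}"
          by (rule image_cong) (simp_all only: lessThan_iff bas(1) Dc(3))
        also have "\<dots> = set D" using nth_image[of "length D" D] by (simp add: lessThan_atLeast0)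
        finally show "(\<lambda>i. arrs t ''basis'' i + 1) ` {..<length D} = greedy X" using D(2) by simp
      qed
      moreover have "\<exists>L. node t k p L \<and> set L = cand k p X" if v: "valid k p" for k p
      proof -
        obtain L where "node s k p L" "set L = cand k p X" using E v unfolding E_def by blast
        then show ?thesis using A cr
          by (intro exI[of _ L]) (simp add: node_def chained_def marked_def prefixes_def handle_def)
      qed
      ultimately show ?thesis using X E cr by (simp add: represents_def E_def)
    qed
    have lp: "wpc (While (Less (Var ''i'') (Var ''size'')) copy_body) (70 * (n + 1)) (\<lambda>s. represents s X) t" if "J (length D) t" for t
    proof (rule wpc_whileI[of J, OF that st ex])
      have "(length D + 1) * (60 + 1 + expr_cost (Less (Var ''i'') (Var ''size''))) \<le> (n + 1) * 70"
        using Dn by (intro mult_le_mono) auto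
      then show "(length D + 1) * (60 + 1 + expr_cost (Less (Var ''i'') (Var ''size''))) \<le> 70 * (n + 1)"
        by (simp only: mult.commute)
    qed
    show ?thesis by (rule wpc_seqI[OF i1 lp]) auto
  qed
  have "n + 2 \<le> 2 * 2 ^ d" using n_le d1 power_increasing[of 1 d "2::nat"] by simp
  then have cost: "(d + 1) * (1510 * 2 ^ d) + 70 * (n + 2) \<le> 1700 * (d + 2) * (2::nat) ^ d"
    by (simp add: algebra_simps)
  show ?thesis unfolding build_com_def
    by (rule wpc_seqI[OF loop copy cost])
qed

end

text \<open>\<open>h\<close> collects the whole input for the later rank query. The separate
  singleton test finds loops, whose leaves get the empty basis; the arrays start with 0, so absent
  elements have empty leaves too.\<close>

definition load_body :: com where
  "load_body =
     Assign ''e'' (Arr ''in'' (Var ''i'')) ;;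
     Insert ''h'' (Var ''h'') (Var ''e'') ;;
     Insert ''g'' (Const 0) (Var ''e'') ;;
     Rank ''u'' (Var ''g'') ;;
     Cond (Var ''u'')
       (Store ''C'' (Var ''e'') (Add (Var ''e'') (Const 1)) ;; Store ''S'' (Var ''e'') (Const 1))
       Skip ;;
     Assign ''i'' (Add (Var ''i'') (Const 1))"

text \<open>\<open>K\<close> becomes the least positive number whose square reaches the rank of the
  input; a linear search is affordable here. Later sets are subsets of the input, so
  \<open>K\<close> need not be adapted. \<open>q\<close> is then doubled from 2 until it reaches
  \<open>n\<close>.\<close>

definition init_com :: com where
  "init_com =
     (Assign ''h'' (Const 0) ;; Assign ''i'' (Const 0)) ;;
     While (Less (Var ''i'') (Var ''len'')) load_body ;;
     (Rank ''r'' (Var ''h'') ;; Assign ''K'' (Const 1)) ;;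
     While (Less (Mul (Var ''K'') (Var ''K'')) (Var ''r'')) (Assign ''K'' (Add (Var ''K'') (Const 1))) ;;
     Assign ''q'' (Const 2) ;;
     While (Less (Var ''q'') (Var ''n'')) (Assign ''q'' (Add (Var ''q'') (Var ''q''))) ;;
     (Assign ''W'' (Add (Var ''q'') (Const 1)) ;; Assign ''p'' (Const 0) ;; Assign ''l'' (Var ''W'') ;;
      Assign ''f'' (Const 1) ;; Assign ''q'' (Const 2)) ;;
     build_com"

section \<open>From the input to the represented set\<close>

context numbered_matroid
begin

lemma greedy_min_weight_basis:
  assumes X: "X \<subseteq> codes"
  shows "is_min_weight_basis indep w (elem ` X) (elem ` greedy X)"
proof -
  have g: "greedy X \<subseteq> codes" using X greedy_subset by blast
  have fin: "finite (greedy X)" using g finite_G finite_subset by blast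
  have card: "card (elem ` Y) = card Y" if "Y \<subseteq> codes" for Y
    using that elem_inj by (intro card_image) (rule inj_on_subset)
  have sum: "sum w (elem ` Y) = sum wt Y" if "Y \<subseteq> codes" for Y
    using sum.reindex[OF inj_on_subset[OF elem_inj that], of w] by (simp add: comp_def wt_def)
  have rk: "matroid_rank indep (elem ` greedy X) = card (elem ` greedy X)"
    using r_greedy[OF X] card_greedy[OF X] card[OF g] by (simp add: rnk_def)
  have "is_basis indep (elem ` X) (elem ` greedy X)"
    unfolding is_basis_def
  proof (intro conjI)
    show "elem ` greedy X \<subseteq> elem ` X" using greedy_subset by blast
    show "indep (elem ` greedy X)" using fin rk by (intro indep_if_rank_card) auto
    show "card (elem ` greedy X) = matroid_rank indep (elem ` X)"
      using card[OF g] card_greedy[OF X] by (simp add: rnk_def)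
  qed
  moreover have "sum w (elem ` greedy X) \<le> sum w B'" if B': "is_basis indep (elem ` X) B'" for B'
  proof -
    obtain B where B: "B \<subseteq> X" "B' = elem ` B" using B' subset_imageE unfolding is_basis_def by metis
    have Bc: "B \<subseteq> codes" using B X by blast
    have ind: "indep B'" "card B' = matroid_rank indep (elem ` X)" using B' by (auto simp: is_basis_def)
    have "rnk B = card B" using rank_indep[OF ind(1)] B(2) card[OF Bc] by (simp add: rnk_def)
    moreover have "card B = rnk X" using ind(2) B(2) card[OF Bc] by (simp add: rnk_def)
    ultimately have "sum wt (greedy X) \<le> sum wt B" by (intro greedy_minimal[OF X B(1)])
    then show ?thesis using sum[OF g] sum[OF Bc] B(2) by simp
  qed
  ultimately show ?thesis by (simp add: is_min_weight_basis_def)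
qed

text \<open>The parameters are computed at run time, so the invariant hides them behind quantifiers.
  The strict inequality is what later bounds \<open>K\<close> by the square root of the rank plus
  one.\<close>

definition good :: "nat \<Rightarrow> nat \<Rightarrow> bool" where
  "good K d \<longleftrightarrow> tree U indep n el w d \<and> (K = 1 \<or> (K - 1) * (K - 1) < matroid_rank indep U)"

definition dstate :: "'a state \<Rightarrow> nat set \<Rightarrow> bool" where
  "dstate s X \<longleftrightarrow> (\<exists>K d. good K d \<and> tree.represents indep n el w K d s X)"

lemma depth_le: "2 ^ d \<le> 2 * n + 2 \<Longrightarrow> d \<le> digits (2 * n + 2)"
proof -
  assume "2 ^ d \<le> 2 * n + 2"
  also have "\<dots> < 2 ^ digits (2 * n + 2)" by (rule digits_bound)
  finally show ?thesis by simp
qed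

lemma init_correct:
  assumes dist: "distinct xs" and xs: "set xs \<subseteq> {..<n}"
  shows "wpc init_com (4000 * (n + 1) * (digits (2 * n + 2) + 3)) (\<lambda>s. dstate s (Suc ` set xs)) (initial_state n xs)"
proof -
  let ?c1 = "Assign ''W'' (Add (Var ''q'') (Const 1)) ;; Assign ''p'' (Const 0) ;;
      Assign ''l'' (Var ''W'') ;; Assign ''f'' (Const 1) ;; Assign ''q'' (Const 2)"
  let ?c2 = "Rank ''r'' (Var ''h'') ;; Assign ''K'' (Const 1)"
  let ?b3 = "Less (Mul (Var ''K'') (Var ''K'')) (Var ''r'')"
  let ?c4 = "Assign ''q'' (Add (Var ''q'') (Var ''q''))"
  define s0 where "s0 = (initial_state n xs :: 'a state)"
  define X where "X = Suc ` set xs"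
  have X: "X \<subseteq> codes" using xs by (auto simp: X_def codes_def)
  define N where "N = length xs"
  have Nn: "N \<le> n" using dist xs card_mono[of "{..<n}" "set xs"] by (simp add: N_def distinct_card)
  have s0: "vars s0 ''n'' = n" "vars s0 ''len'' = N" "created s0 = [{}]"
    "\<And>i. i < N \<Longrightarrow> arrs s0 ''in'' i = xs ! i" "\<And>e. arrs s0 ''S'' e = 0"
    by (simp_all add: s0_def initial_state_def N_def)
  define I where "I m s \<longleftrightarrow> (\<exists>i\<le>N. m = N - i \<and> vars s ''i'' = i \<and> vars s ''n'' = n \<and> vars s ''len'' = N \<and>
     arrs s ''in'' = arrs s0 ''in'' \<and> created s \<noteq> [] \<and> created s ! 0 = {} \<and>
     vars s ''h'' < length (created s) \<and> created s ! vars s ''h'' = el ` set (take i xs) \<and>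
     (\<forall>e. arrs s ''S'' e = (if e \<in> set (take i xs) \<and> rnk {Suc e} \<noteq> 0 then 1 else 0)) \<and>
     (\<forall>e. arrs s ''S'' e \<noteq> 0 \<longrightarrow> arrs s ''C'' e = Suc e))" for m and s :: "'a state"
  have i0: "wpc (Assign ''h'' (Const 0) ;; Assign ''i'' (Const 0)) 10 (I N) s0"
    using s0 by (intro wpc_straight) (auto simp: I_def)
  have st: "wpc load_body 90 (\<lambda>s'. \<exists>m'<m. I m' s') s"
    if I: "I m s" and g: "aval (Less (Var ''i'') (Var ''len'')) s \<noteq> 0" for m s
  proof (rule wpc_straight)
    from I obtain i where i: "m = N - i" "vars s ''i'' = i" "vars s ''n'' = n" "vars s ''len'' = N"
     "arrs s ''in'' = arrs s0 ''in''" "created s \<noteq> []" "created s ! 0 = {}"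
     "vars s ''h'' < length (created s)" "created s ! vars s ''h'' = el ` set (take i xs)"
     and S: "\<And>e. arrs s ''S'' e = (if e \<in> set (take i xs) \<and> rnk {Suc e} \<noteq> 0 then 1 else 0)"
     and C: "\<And>e. arrs s ''S'' e \<noteq> 0 \<Longrightarrow> arrs s ''C'' e = Suc e" unfolding I_def by blast
    have iN: "i < N" using g i by (simp split: if_splits)
    define e where "e = xs ! i"
    have "e \<in> set xs" using iN by (simp add: e_def N_def)
    then have e: "arrs s ''in'' i = e" "e < n" using i(5) s0(4)[OF iN] xs by (auto simp: e_def)
    have tS: "set (take (Suc i) xs) = insert e (set (take i xs))"
      using iN by (simp add: e_def N_def take_Suc_conv_app_nth)
    have v: "Suc e \<le> vmax t" "Suc i \<le> vmax t" for t using e iN Nn by (auto intro!: le_vmax)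
    have mr: "matroid_rank indep {el e} = rnk {Suc e}" by (simp add: rnk_def elem_def)
    have Ii: "I (N - Suc i) t" if "vars t ''i'' = Suc i" "vars t ''n'' = n" "vars t ''len'' = N"
      "arrs t ''in'' = arrs s0 ''in''" "created t \<noteq> []" "created t ! 0 = {}"
      "vars t ''h'' < length (created t)" "created t ! vars t ''h'' = el ` set (take (Suc i) xs)"
      "\<And>f. arrs t ''S'' f = (if f = e \<and> rnk {Suc e} \<noteq> 0 then 1 else arrs s ''S'' f)"
      "\<And>f. arrs t ''C'' f = (if f = e \<and> rnk {Suc e} \<noteq> 0 then Suc e else arrs s ''C'' f)" for t
      unfolding I_def
    proof (intro exI[of _ "Suc i"] conjI allI impI)
      fix f show "arrs t ''S'' f = (if f \<in> set (take (Suc i) xs) \<and> rnk {Suc f} \<noteq> 0 then 1 else 0)"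
        unfolding that(9) tS S by auto
    next
      fix f assume "arrs t ''S'' f \<noteq> 0"
      then show "arrs t ''C'' f = Suc f" unfolding that(9,10) using C[of f] by (auto split: if_splits)
    qed (use that iN in auto)
    have "wpl load_body (I (N - Suc i)) s"
    proof (cases "rnk {Suc e} = 0")
      case True
      then show ?thesis using i e
        by (simp add: load_body_def mr v nth_append, intro Ii; simp add: nth_append tS)
    next
      case False
      then show ?thesis using i e
        by (simp add: load_body_def mr v nth_append, intro Ii; simp add: nth_append tS)
    qed
    then show "wpl load_body (\<lambda>s'. \<exists>m'<m. I m' s') s"
    proof (rule wpl_mono)
      fix t assume "I (N - Suc i) t"
      then show "\<exists>m'<m. I m' t" using i(1) iN by (intro exI[of _ "N - Suc i"]) simp
    qed
    show "com_cost load_body \<le> 90" by (simp add: load_body_def)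
  qed
  define A where "A s \<longleftrightarrow> vars s ''n'' = n \<and> created s \<noteq> [] \<and> created s ! 0 = {} \<and>
     (\<forall>e. arrs s ''S'' e = (if e \<in> set xs \<and> rnk {Suc e} \<noteq> 0 then 1 else 0)) \<and>
     (\<forall>e. arrs s ''S'' e \<noteq> 0 \<longrightarrow> arrs s ''C'' e = Suc e)" for s :: "'a state"
  have Av: "A t" if "A s" "vars t ''n'' = n" "arrs t = arrs s" "created t = created s" for s t
    using that by (simp add: A_def)
  have An: "vars s ''n'' = n" if "A s" for s using that unfolding A_def by blast
  define E1 where "E1 s \<longleftrightarrow> A s \<and> vars s ''h'' < length (created s) \<and> created s ! vars s ''h'' = elem ` X" for s
  have ex: "E1 s" if I: "I m s" and g: "aval (Less (Var ''i'') (Var ''len'')) s = 0" for m s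
  proof -
    from I obtain i where i: "i \<le> N" "vars s ''i'' = i" "vars s ''n'' = n" "vars s ''len'' = N"
     "created s \<noteq> []" "created s ! 0 = {}"
     "vars s ''h'' < length (created s)" "created s ! vars s ''h'' = el ` set (take i xs)"
     and S: "\<forall>e. arrs s ''S'' e = (if e \<in> set (take i xs) \<and> rnk {Suc e} \<noteq> 0 then 1 else 0)"
     and C: "\<forall>e. arrs s ''S'' e \<noteq> 0 \<longrightarrow> arrs s ''C'' e = Suc e" unfolding I_def by blast
    have "i = N" using g i by (simp split: if_splits)
    then have t: "take i xs = xs" by (simp add: N_def)
    have "elem ` X = el ` set xs" by (auto simp: X_def elem_def image_iff)
    then show ?thesis using i S C t by (simp add: E1_def A_def)
  qed
  have lp: "wpc (While (Less (Var ''i'') (Var ''len'')) load_body) (100 * (n + 1)) E1 s" if "I N s" for s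
  proof (rule wpc_whileI[of I, OF that st ex])
    have "(N + 1) * (90 + 1 + expr_cost (Less (Var ''i'') (Var ''len''))) \<le> (n + 1) * 100"
      using Nn by (intro mult_le_mono) auto
    then show "(N + 1) * (90 + 1 + expr_cost (Less (Var ''i'') (Var ''len''))) \<le> 100 * (n + 1)"
      by (simp only: mult.commute)
  qed
  define R where "R = rnk X"
  have Rn: "R \<le> n" using rank_le_card_ground[of "elem ` X"] card_U by (simp add: R_def rnk_def)
  define J where "J m s \<longleftrightarrow> A s \<and> vars s ''r'' = R \<and> 1 \<le> vars s ''K'' \<and> vars s ''K'' \<le> R + 1 \<and> m = R + 1 - vars s ''K'' \<and>
     (vars s ''K'' = 1 \<or> (vars s ''K'' - 1) * (vars s ''K'' - 1) < R)" for m s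
  have i2: "wpc ?c2 20 (J R) s" if E: "E1 s" for s
  proof (rule wpc_straight)
    have "A (s\<lparr>vars := (vars s)(''r'' := R, ''K'' := Suc 0)\<rparr>)"
    proof (rule Av)
      show As: "A s" using E unfolding E1_def by blast
      show "vars (s\<lparr>vars := (vars s)(''r'' := R, ''K'' := Suc 0)\<rparr>) ''n'' = n" using An[OF As] by simp
    qed simp_all
    then show "wpl ?c2 (J R) s"
      using E by (simp add: E1_def J_def R_def rnk_def)
  qed simp
  have st2: "wpc (Assign ''K'' (Add (Var ''K'') (Const 1))) 20 (\<lambda>s'. \<exists>m'<m. J m' s') s"
    if J: "J m s" and g: "aval ?b3 s \<noteq> 0" for m s
  proof (rule wpc_straight)
    let ?K = "vars s ''K''"
    have sq: "?K * ?K < R" using g J by (simp add: J_def split: if_splits)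
    have "1 \<le> ?K" using J by (simp add: J_def)
    then have "?K \<le> ?K * ?K" by simp
    then have KR: "?K < R" using sq by linarith
    have v: "Suc ?K \<le> vmax t" for t using KR Rn by (intro le_vmax) simp
    have "A (set_var ''K'' (Suc ?K) s)" by (rule Av[of s]) (use J An[of s] in \<open>simp_all add: J_def\<close>)
    then have "wpl (Assign ''K'' (Add (Var ''K'') (Const 1))) (J (m - 1)) s"
      using J sq KR v by (auto simp: J_def)
    then show "wpl (Assign ''K'' (Add (Var ''K'') (Const 1))) (\<lambda>s'. \<exists>m'<m. J m' s') s"
      by (rule wpl_mono) (use J KR in \<open>auto simp: J_def intro!: exI[of _ "m - 1"]\<close>)
  qed simp
  define E2 where "E2 s \<longleftrightarrow> A s \<and> 1 \<le> vars s ''K'' \<and> R \<le> vars s ''K'' * vars s ''K'' \<and>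
     (vars s ''K'' = 1 \<or> (vars s ''K'' - 1) * (vars s ''K'' - 1) < R)" for s
  have lp2: "wpc (While (Less (Mul (Var ''K'') (Var ''K'')) (Var ''r'')) (Assign ''K'' (Add (Var ''K'') (Const 1))))
      (40 * (n + 1)) E2 s" if "J R s" for s
  proof (rule wpc_whileI[of J, OF that st2])
    have "(R + 1) * (20 + 1 + expr_cost ?b3) \<le> (n + 1) * 40"
      using Rn by (intro mult_le_mono) auto
    then show "(R + 1) * (20 + 1 + expr_cost ?b3) \<le> 40 * (n + 1)"
      by (simp only: mult.commute)
  qed (auto simp: J_def E2_def split: if_splits)
  define Q where "Q m s \<longleftrightarrow> E2 s \<and> m = n - vars s ''q'' \<and> vars s ''q'' \<le> 2 * n + 2 \<and> (\<exists>d\<ge>1. vars s ''q'' = 2 ^ d)" for m s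
  have E2v: "E2 t" if "E2 s" "vars t ''n'' = n" "vars t ''K'' = vars s ''K''" "arrs t = arrs s" "created t = created s" for s t
    using that Av[of s t] by (simp add: E2_def)
  have E2n: "vars s ''n'' = n" if "E2 s" for s using that An[of s] by (simp add: E2_def)
  have i3: "wpc (Assign ''q'' (Const 2)) 10 (\<lambda>t. \<exists>m\<le>n. Q m t) s" if E: "E2 s" for s
  proof (rule wpc_straight)
    have "E2 (set_var ''q'' 2 s)" using E2n[OF E] by (intro E2v[OF E]) auto
    then show "wpl (Assign ''q'' (Const 2)) (\<lambda>t. \<exists>m\<le>n. Q m t) s" by (auto simp: Q_def intro!: exI[of _ 1])
  qed simp
  have st3: "wpc ?c4 20 (\<lambda>s'. \<exists>m'<m. Q m' s') s"
    if q: "Q m s" and g: "aval (Less (Var ''q'') (Var ''n'')) s \<noteq> 0" for m s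
  proof (rule wpc_straight)
    let ?q = "vars s ''q''"
    have E: "E2 s" using q by (simp add: Q_def)
    obtain d where d: "1 \<le> d" "?q = 2 ^ d" and m: "m = n - ?q" using q by (auto simp: Q_def)
    have qn: "?q < n" using g E2n[OF E] by (simp split: if_splits)
    have q0: "0 < ?q" using d by simp
    have v: "?q + ?q \<le> vmax t" for t using qn by (intro le_vmax) simp
    have E': "E2 (set_var ''q'' (?q + ?q) s)" using E2n[OF E] by (intro E2v[OF E]) auto
    have "Q (n - (?q + ?q)) (set_var ''q'' (?q + ?q) s)"
      unfolding Q_def using E' qn d by (auto intro!: exI[of _ "Suc d"])
    moreover have "n - (?q + ?q) < m" using m qn q0 by simp
    ultimately show "wpl ?c4 (\<lambda>s'. \<exists>m'<m. Q m' s') s"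
      using v by (auto intro!: exI[of _ "n - (?q + ?q)"])
  qed simp
  define E3 where "E3 s \<longleftrightarrow> E2 s \<and> (\<exists>d\<ge>1. vars s ''q'' = 2 ^ d \<and> n \<le> 2 ^ d \<and> 2 ^ d \<le> 2 * n + 2)" for s
  have lp3: "wpc (While (Less (Var ''q'') (Var ''n'')) (Assign ''q'' (Add (Var ''q'') (Var ''q''))))
      (40 * (n + 1)) E3 s" if q: "\<exists>m\<le>n. Q m s" for s
  proof -
    from q obtain m where m: "m \<le> n" "Q m s" by blast
    show ?thesis
    proof (rule wpc_whileI[of Q, OF m(2) st3])
      fix m s assume Q: "Q m s" and g: "aval (Less (Var ''q'') (Var ''n'')) s = 0"
      then have "n \<le> vars s ''q''" using E2n[of s] by (simp add: Q_def split: if_splits)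
      with Q show "E3 s" by (auto simp: Q_def E3_def)
    next
      have "(m + 1) * (20 + 1 + expr_cost (Less (Var ''q'') (Var ''n''))) \<le> (n + 1) * 40"
        using m by (intro mult_le_mono) auto
      then show "(m + 1) * (20 + 1 + expr_cost (Less (Var ''q'') (Var ''n''))) \<le> 40 * (n + 1)"
        by (simp only: mult.commute)
    qed
  qed
  define D where "D = digits (2 * n + 2)"
  have fin: "wpc ((Assign ''W'' (Add (Var ''q'') (Const 1)) ;; Assign ''p'' (Const 0) ;; Assign ''l'' (Var ''W'') ;;
      Assign ''f'' (Const 1) ;; Assign ''q'' (Const 2)) ;; build_com) (50 + 1700 * (D + 2) * (2 * n + 2))
      (\<lambda>s. dstate s X) s" if E: "E3 s" for s
  proof -
    from E obtain d where d: "1 \<le> d" "vars s ''q'' = 2 ^ d" "n \<le> 2 ^ d" "2 ^ d \<le> 2 * n + 2" by (auto simp: E3_def)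
    define K where "K = vars s ''K''"
    interpret tree U indep n el w K d using d by unfold_locales
    have E2: "E2 s" using E by (simp add: E3_def)
    have K: "1 \<le> K" "R \<le> K * K" "K = 1 \<or> (K - 1) * (K - 1) < R" using E2 by (auto simp: E2_def K_def)
    have R: "R \<le> matroid_rank indep U"
      unfolding R_def rnk_def using X elem_in_U by (intro rank_mono) auto
    have gd: "good K d" unfolding good_def using K(3) R tree_axioms by auto
    have A: "A s" using E2 by (simp add: E2_def)
    have v: "Suc (2 ^ d) \<le> vmax t" for t using d by (intro le_vmax) simp
    have b1: "wpc ?c1 50 (\<lambda>t. base 1 t \<and> (\<forall>p. clists X 0 p t)) s"
    proof (rule wpc_straight)
      have cl: "clists X 0 p t" if "arrs t = arrs s" for p and t :: "'a state"
        unfolding clists_def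
      proof
        \<comment> \<open>A leaf has the greedy basis \<open>[Suc p]\<close> unless its element is a
          loop or not in the input.\<close>
        define Dp where "Dp = (if p \<in> set xs \<and> rnk {Suc p} \<noteq> 0 then [Suc p] else [])"
        have "p < e \<and> e \<le> p + 2 ^ 0 \<longleftrightarrow> e = Suc p" for e by auto
        then have pt: "part 0 p X = (if p \<in> set xs then {Suc p} else {})"
          by (auto simp: part_def X_def)
        have "below {Suc p} (Suc p) = {}" by (auto simp: below_def)
        moreover have "Suc p \<in> codes" if "p \<in> set xs" using X that by (auto simp: X_def)
        ultimately have gr: "set Dp = greedy (part 0 p X)"
          unfolding pt Dp_def by (auto simp: greedy_def cl_def r_empty)
        have "set Dp \<subseteq> codes" using X by (auto simp: Dp_def X_def)
        then have "slist Dp" by (auto simp: Dp_def slist_def)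
        moreover have "arrs t ''S'' p = length Dp" "\<And>j. j < length Dp \<Longrightarrow> arrs t ''C'' (p + j) = Dp ! j"
          using A that by (auto simp: A_def Dp_def split: if_splits)
        ultimately have "clist t 0 p Dp" by (auto simp: clist_def Dp_def)
        then show "\<exists>D. clist t 0 p D \<and> set D = greedy (part 0 p X)" using gr by blast
      qed
      have "wpl ?c1 (\<lambda>t. base 1 t \<and> arrs t = arrs s) s"
        using d(2) A K_def[symmetric] by (simp add: v base_def W_def A_def)
      then show "wpl ?c1 (\<lambda>t. base 1 t \<and> (\<forall>p. clists X 0 p t)) s"
        by (rule wpl_mono) (use cl in blast)
    qed simp
    have b2: "wpc build_com (1700 * (D + 2) * (2 * n + 2)) (\<lambda>s. dstate s X) t"
      if t: "base 1 t \<and> (\<forall>p. clists X 0 p t)" for t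
    proof (rule wpc_weaken)
      show "wpc build_com (1700 * (d + 2) * 2 ^ d) (\<lambda>s. represents s X) t"
        using t K R_def by (intro build_correct[OF X]) auto
      show "1700 * (d + 2) * 2 ^ d \<le> 1700 * (D + 2) * (2 * n + 2)"
        using depth_le[OF d(4)] d(4) by (intro mult_le_mono) (auto simp: D_def)
      show "dstate s X" if "represents s X" for s using that gd by (auto simp: dstate_def)
    qed
    show ?thesis by (rule wpc_seqI[OF b1 b2 order_refl])
  qed
  have cost: "10 + (100 * (n + 1) + (20 + (40 * (n + 1) + (10 + (40 * (n + 1) + (50 + 1700 * (D + 2) * (2 * n + 2))))))) \<le>
     4000 * (n + 1) * (D + 3)" by (simp add: algebra_simps)
  show ?thesis unfolding init_com_def s0_def[symmetric] X_def[symmetric] D_def[symmetric]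
    by (rule wpc_seqI[OF i0 wpc_seqI[OF lp wpc_seqI[OF i2 wpc_seqI[OF lp2 wpc_seqI[OF i3 wpc_seqI[OF lp3 fin
       order_refl] order_refl] order_refl] order_refl] order_refl] cost])
qed

definition init_units :: nat where
  "init_units = 4000 * (n + 1) * (digits (2 * n + 2) + 3)"

text \<open>\<open>K + 2\<close> is estimated by \<open>n + 3\<close>. This crude bound only limits
  the number of created sets, not the running time of a deletion.\<close>

definition delete_units :: nat where
  "delete_units = 2100 * (digits (2 * n + 2) + 2) * (n + 3)"

text \<open>A potential argument: every element still present reserves \<open>delete_units\<close>
  created sets for its own deletion. Thus the number of handles stays polynomial in \<open>n\<close>
  over any sequence of deletions.\<close>

definition invar :: "'a set \<Rightarrow> 'a state \<Rightarrow> bool" where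
  "invar X s \<longleftrightarrow> (\<exists>Y\<subseteq>codes. X = elem ` Y \<and> dstate s Y) \<and> bnd s \<and>
     length (created s) + card X * delete_units \<le> 1 + init_units + n * delete_units"

definition log_factor :: real where
  "log_factor = ln (real n + 2)"

lemma ln_2_ge_half: "1 / 2 \<le> ln (2 :: real)"
  using ln_le_minus_one[of "1 / 2 :: real"] by (simp add: ln_div)

text \<open>Allows additive constants to be absorbed into multiples of \<open>log_factor\<close>;
  the argument \<open>n + 2\<close> keeps the logarithm away from 0.\<close>

lemma log_factor_ge: "1 / 2 \<le> log_factor"
proof -
  have "1 / 2 \<le> ln (2 :: real)" using ln_2_ge_half by simp
  also have "\<dots> \<le> log_factor" unfolding log_factor_def by (subst ln_le_cancel_iff) auto
  finally show ?thesis .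
qed

lemma digits_le_log: "real (digits (n + 2)) \<le> 4 * log_factor"
proof -
  have "2 ^ (digits (n + 2) - 1) \<le> n + 2"
    using floorlog_bounds[of "n + 2" 2] by simp
  then have "real (2 ^ (digits (n + 2) - 1)) \<le> real (n + 2)" by (rule of_nat_mono)
  then have "ln (2 ^ (digits (n + 2) - 1) :: real) \<le> log_factor"
    unfolding log_factor_def by (subst ln_le_cancel_iff) auto
  then have "real (digits (n + 2) - 1) * ln 2 \<le> log_factor" by (simp add: ln_realpow)
  moreover have "real (digits (n + 2) - 1) * (1 / 2) \<le> real (digits (n + 2) - 1) * ln 2"
    using ln_2_ge_half by (intro mult_left_mono) auto
  ultimately have "real (digits (n + 2) - 1) \<le> 2 * log_factor" by linarith
  then have "real (digits (n + 2)) \<le> 2 * log_factor + 1" by linarith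
  then show ?thesis using log_factor_ge by linarith
qed

lemma digits_double_le_log: "real (digits (2 * n + 2)) \<le> 8 * log_factor"
proof -
  have "digits (2 * n + 2) \<le> digits (2 * (n + 2))" by (rule digits_mono) simp
  also have "\<dots> \<le> digits 2 + digits (n + 2)" by (rule digits_mult)
  also have "digits 2 \<le> 2" by (rule digits_le_self)
  finally have "real (digits (2 * n + 2)) \<le> 2 + real (digits (n + 2))" by simp
  then show ?thesis using digits_le_log log_factor_ge by linarith
qed

lemma unit_cost_le_log:
  assumes "length (created s) \<le> 1 + init_units + n * delete_units"
  shows "real (unit_cost s) \<le> 46 * log_factor"
proof -
  define m where "m = n + 2"
  have D: "digits (2 * n + 2) + 3 \<le> 4 * m" "digits (2 * n + 2) + 2 \<le> 2 * m"
    using digits_le_self[of "2 * n + 2"] by (auto simp: m_def)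
  have i: "init_units \<le> 4000 * m * (4 * m)" unfolding init_units_def
    using D by (intro mult_le_mono) (auto simp: m_def)
  have "delete_units \<le> 2100 * (2 * m) * (2 * m)" unfolding delete_units_def
    using D by (intro mult_le_mono) (auto simp: m_def)
  then have dl: "n * delete_units \<le> m * (2100 * (2 * m) * (2 * m))" by (intro mult_le_mono) (auto simp: m_def)
  have m1: "1 \<le> m" "m * m \<le> m * m * m" by (auto simp: m_def)
  have mm: "1 \<le> m * m" using m1 by simp
  have "value_bound n = 4 * (m * m)" by (simp add: value_bound_def m_def power2_eq_square algebra_simps)
  then have "vmax s \<le> 4 * (m * m) + (1 + init_units + n * delete_units)" unfolding vmax_def using assms by simp
  moreover have "init_units \<le> 16000 * (m * m)" using i by simp
  moreover have "n * delete_units \<le> 8400 * (m * m * m)" using dl by simp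
  \<comment> \<open>Everything is below \<open>24405 * (m * m * m)\<close>, where
    \<open>24405 = 4 + 1 + 16000 + 8400\<close>, and this is rounded up to the power
    \<open>2 ^ 15\<close>.\<close>
  ultimately have "vmax s \<le> 32768 * (m * m * m)" using mm m1(2) by linarith
  then have v: "vmax s \<le> 2 ^ 15 * (m * m * m)" by simp
  have "digits (vmax s) \<le> digits (2 ^ 15 * (m * m * m))" by (rule digits_mono[OF v])
  also have "\<dots> \<le> digits (2 ^ 15) + digits (m * m * m)" by (rule digits_mult)
  also have "digits (m * m * m) \<le> digits (m * m) + digits m" by (rule digits_mult)
  also have "digits (m * m) \<le> digits m + digits m" by (rule digits_mult)
  also have "digits (2 ^ 15) \<le> 16" by (rule digits_leI) simp
  finally have "digits (vmax s) \<le> 16 + 3 * digits (n + 2)" by (simp add: m_def)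
  then have "real (unit_cost s) \<le> real (17 + 3 * digits (n + 2))" unfolding unit_cost_def by (intro of_nat_mono) simp
  \<comment> \<open>\<open>17 \<le> 34 * log_factor\<close>, and \<open>3 * 4 = 12\<close> comes
    from the digits, giving 46.\<close>
  then show ?thesis using digits_le_log log_factor_ge by simp
qed

text \<open>The equivalence says that the state determines the listed set, which is needed because
  the old basis in the final statement is an arbitrary set held by the state.\<close>

lemma holds_basis_dstate:
  assumes Y: "Y \<subseteq> codes" and ds: "dstate s Y"
  shows "holds_basis n el s S \<longleftrightarrow> S = elem ` greedy Y"
proof -
  from ds obtain K d where g: "good K d" and dd: "tree.represents indep n el w K d s Y" by (auto simp: dstate_def)
  interpret tree U indep n el w K d using g by (simp add: good_def)
  have b: "\<And>i. i < vars s ''size'' \<Longrightarrow> arrs s ''basis'' i < n"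
    "\<And>i. i < vars s ''size'' \<Longrightarrow> arrs s ''L'' (arrs s ''basis'' i + 1) = i"
    "(\<lambda>i. arrs s ''basis'' i + 1) ` {..<vars s ''size''} = greedy Y"
    using dd by (simp_all add: represents_def basis_ok_def)
  have inj: "inj_on (arrs s ''basis'') {..<vars s ''size''}"
    by (rule inj_on_inverseI[where g = "\<lambda>e. arrs s ''L'' (e + 1)"]) (simp add: b(2)[simplified])
  have st: "set (map (arrs s ''basis'') [0..<vars s ''size'']) = arrs s ''basis'' ` {..<vars s ''size''}"
    by (simp add: lessThan_atLeast0)
  have "el ` (arrs s ''basis'' ` {..<vars s ''size''}) = elem ` greedy Y"
    unfolding b(3)[symmetric] by (simp add: image_image elem_def)
  moreover have "distinct (map (arrs s ''basis'') [0..<vars s ''size''])"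
    using inj by (simp add: distinct_map lessThan_atLeast0)
  moreover have "arrs s ''basis'' ` {..<vars s ''size''} \<subseteq> {..<n}" using b(1) by auto
  ultimately show ?thesis unfolding holds_basis_def Let_def st by auto
qed

lemma init_theorem:
  assumes dist: "distinct xs" and xs: "set xs \<subseteq> {..<n}"
  obtains t s where "exec n el (matroid_rank indep) w init_com (initial_state n xs) t s"
    "real t \<le> 4000000 * (real n + 1) * log_factor ^ 2" "invar (el ` set xs) s"
proof -
  let ?s0 = "initial_state n xs :: 'a state"
  have X: "Suc ` set xs \<subseteq> codes" using xs by (auto simp: codes_def)
  have len: "length xs \<le> n" using dist xs card_mono[of "{..<n}" "set xs"] by (simp add: distinct_card)
  have "bnd ?s0"
  proof -
    have le: "m \<le> vmax ?s0" if "m \<le> n" for m using that by (intro le_vmax) simp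
    have "xs ! i \<le> n" if "i < length xs" for i using xs nth_mem[OF that] by (meson lessThan_iff less_imp_le subsetD)
    then show ?thesis using len by (auto simp: bnd_def initial_state_def intro!: le[unfolded initial_state_def])
  qed
  with init_correct[OF dist xs, folded init_units_def] obtain t s ys where
    e: "exec n el (matroid_rank indep) w init_com ?s0 t s" and t: "t \<le> init_units * unit_cost s"
    and cr: "created s = created ?s0 @ ys" "length ys \<le> init_units" and b: "bnd s" and ds: "dstate s (Suc ` set xs)"
    unfolding wpc_def by blast
  have lc: "length (created s) \<le> 1 + init_units" using cr by (simp add: initial_state_def)
  have img: "el ` set xs = elem ` Suc ` set xs" by (simp add: image_image elem_def)
  have "el ` set xs \<subseteq> U" using xs bij_betw_apply[OF el_bij] by auto
  then have "card (el ` set xs) \<le> n" using card_mono[OF finite_ground] card_U by auto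
  then have "card (el ` set xs) * delete_units \<le> n * delete_units" by (rule mult_le_mono1)
  then have "length (created s) + card (el ` set xs) * delete_units \<le> 1 + init_units + n * delete_units"
    using lc by linarith
  then have inv: "invar (el ` set xs) s" unfolding invar_def using X img ds b by blast
  have u: "real (unit_cost s) \<le> 46 * log_factor" using lc by (intro unit_cost_le_log) simp
  have "real init_units = 4000 * (real n + 1) * (real (digits (2 * n + 2)) + 3)" by (simp add: init_units_def)
  \<comment> \<open>8 from the digits, and 6 because \<open>3 \<le> 6 * log_factor\<close>.\<close>
  also have "\<dots> \<le> 4000 * (real n + 1) * (14 * log_factor)"
    using digits_double_le_log log_factor_ge by (intro mult_left_mono) auto
  finally have i: "real init_units \<le> 4000 * (real n + 1) * (14 * log_factor)" .
  have "real t \<le> real init_units * real (unit_cost s)" using t by (metis of_nat_le_iff of_nat_mult)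
  also have "\<dots> \<le> (4000 * (real n + 1) * (14 * log_factor)) * (46 * log_factor)"
    using i u log_factor_ge by (intro mult_mono) auto
  also have "\<dots> = 2576000 * ((real n + 1) * log_factor ^ 2)" by (simp add: power2_eq_square)
  also have "\<dots> \<le> 4000000 * ((real n + 1) * log_factor ^ 2)" by (intro mult_right_mono) auto
  finally have "real t \<le> 4000000 * (real n + 1) * log_factor ^ 2" by (simp only: mult.assoc)
  from that[OF e this inv] show thesis .
qed

lemma delete_theorem:
  assumes inv: "invar X s" and i: "i < n" "el i \<in> X"
  obtains t s' y where "exec n el (matroid_rank indep) w delete_com (set_var ''arg'' i s) t s'"
    "real t \<le> 4000000 * (sqrt (real (matroid_rank indep U)) + 1) * log_factor ^ 2"
    "invar (X - {el i}) s'" "returned n el s' y"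
    "\<And>S S'. holds_basis n el s S \<Longrightarrow> holds_basis n el s' S' \<Longrightarrow> S' - S = set_option y"
proof -
  from inv obtain Y where Y: "Y \<subseteq> codes" "X = elem ` Y" "dstate s Y" and b: "bnd s"
    and lc: "length (created s) + card X * delete_units \<le> 1 + init_units + n * delete_units"
    by (auto simp: invar_def)
  define x where "x = Suc i"
  have xc: "x \<in> codes" and ex: "elem x = el i" using i by (auto simp: x_def codes_def elem_def)
  have xY: "x \<in> Y" using i(2) Y(1,2) xc ex inj_onD[OF elem_inj] by (metis imageE subsetD)
  from Y(3) obtain K d where g: "good K d" and dd: "tree.represents indep n el w K d s Y" by (auto simp: dstate_def)
  interpret tree U indep n el w K d using g by (simp add: good_def)
  define r where "r = matroid_rank indep U"
  have KK: "K = 1 \<or> (K - 1) * (K - 1) < r" using g by (simp add: good_def r_def)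
  let ?s = "set_var ''arg'' i s"
  have ds': "represents ?s Y"
    using dd by (simp add: represents_def basis_ok_def node_def chained_def marked_def prefixes_def handle_def)
  have "i \<le> vmax s" using i by (intro le_vmax) simp
  then have b': "bnd ?s" using b by (simp add: bnd_def vmax_def)
  define N where "N = 2100 * (d + 2) * (K + 2)"
  have "vars ?s ''arg'' = x - 1" by (simp add: x_def)
  from delete_correct[OF ds' xY this, folded N_def] b' obtain t s' ys where
    e: "exec n el (matroid_rank indep) w delete_com ?s t s'" and t: "t \<le> N * unit_cost s'"
    and cr: "created s' = created ?s @ ys" "length ys \<le> N" and b2: "bnd s'" and d2: "represents s' (Y - {x})"
    and ret: "vars s' ''ret'' = 0 \<or> vars s' ''ret'' \<in> codes"
    and df: "greedy (Y - {x}) - greedy Y = set_option (opt (vars s' ''ret''))"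
    unfolding wpc_def by blast
  have dle: "d \<le> digits (2 * n + 2)" by (rule depth_le[OF pow_le])
  have rn: "r \<le> n" using rank_le_card_ground card_U by (simp add: r_def)
  have Kn: "K \<le> n + 1"
  proof (cases "K \<le> 1")
    case False
    then have "(K - 1) * 1 \<le> (K - 1) * (K - 1)" by (intro mult_le_mono2) simp
    then have "K - 1 \<le> (K - 1) * (K - 1)" by simp
    moreover have "(K - 1) * (K - 1) < r" using KK False by auto
    ultimately show ?thesis using rn by linarith
  qed simp
  have Nd: "N \<le> delete_units" unfolding N_def delete_units_def using dle Kn by (intro mult_le_mono) auto
  have X': "X - {el i} = elem ` (Y - {x})"
    using elem_minus[OF Y(1) xc] Y(2) ex by simp
  have Y': "Y - {x} \<subseteq> codes" using Y by blast
  have ds2: "dstate s' (Y - {x})" using g d2 by (auto simp: dstate_def)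
  have finX: "finite X" unfolding Y(2) using finite_subset[OF Y(1) finite_G] by simp
  have "card X = Suc (card (X - {el i}))" by (rule card.remove[OF finX i(2)])
  then have "card X * delete_units = delete_units + card (X - {el i}) * delete_units" by simp
  moreover have "length (created s') \<le> length (created s) + N" using cr by simp
  ultimately have lc': "length (created s') + card (X - {el i}) * delete_units \<le> 1 + init_units + n * delete_units"
    using lc Nd by linarith
  then have inv': "invar (X - {el i}) s'" unfolding invar_def using X' Y' ds2 b2 by auto
  have u: "real (unit_cost s') \<le> 46 * log_factor" using lc' by (intro unit_cost_le_log) simp
  have Ks: "real K \<le> sqrt (real r) + 1"
  proof (cases "K \<le> 1")
    case False
    then have "(K - 1) * (K - 1) \<le> r" using KK by auto
    then have "real (K - 1) * real (K - 1) \<le> real r" by (metis of_nat_le_iff of_nat_mult)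
    then have "real (K - 1) \<le> sqrt (real r)" by (simp add: real_le_rsqrt power2_eq_square)
    then show ?thesis using False by simp
  next
    case True
    then have "real K \<le> 1" by simp
    moreover have "0 \<le> sqrt (real r)" by simp
    ultimately show ?thesis by linarith
  qed
  have "real N = 2100 * (real d + 2) * (real K + 2)" by (simp add: N_def algebra_simps)
  \<comment> \<open>The depth is at most \<open>8 * log_factor\<close> and
    \<open>2 \<le> 4 * log_factor\<close>, which gives 12. The factor 3 turns
    \<open>sqrt (real r) + 3\<close> into a multiple of \<open>sqrt (real r) + 1\<close>.\<close>
  also have "\<dots> \<le> 2100 * (12 * log_factor) * (3 * (sqrt (real r) + 1))"
  proof (intro mult_mono)
    have "real d \<le> real (digits (2 * n + 2))" using dle by simp
    then show "real d + 2 \<le> 12 * log_factor" using digits_double_le_log log_factor_ge by linarith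
    have "0 \<le> sqrt (real r)" by simp
    then show "real K + 2 \<le> 3 * (sqrt (real r) + 1)" using Ks by argo
  qed (use log_factor_ge in auto)
  finally have N: "real N \<le> 75600 * log_factor * (sqrt (real r) + 1)" by (simp add: algebra_simps)
  have "real t \<le> real N * real (unit_cost s')" using t by (metis of_nat_le_iff of_nat_mult)
  also have "\<dots> \<le> (75600 * log_factor * (sqrt (real r) + 1)) * (46 * log_factor)"
    using N u log_factor_ge by (intro mult_mono) auto
  also have "\<dots> = 3477600 * ((sqrt (real r) + 1) * log_factor ^ 2)" by (simp add: power2_eq_square)
  also have "\<dots> \<le> 4000000 * ((sqrt (real r) + 1) * log_factor ^ 2)" by (intro mult_right_mono) auto
  finally have tt: "real t \<le> 4000000 * (sqrt (real r) + 1) * log_factor ^ 2" by (simp only: mult.assoc)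
  define y where "y = map_option elem (opt (vars s' ''ret''))"
  have "returned n el s' y"
  proof (cases "vars s' ''ret'' = 0")
    case True
    then show ?thesis by (simp add: returned_def y_def opt_def)
  next
    case False
    then have "vars s' ''ret'' \<in> codes" using ret by simp
    then have "vars s' ''ret'' - 1 < n" "vars s' ''ret'' = vars s' ''ret'' - 1 + 1" by (auto simp: codes_def)
    then show ?thesis using False
      by (auto simp: returned_def y_def opt_def elem_def intro!: exI[of _ "vars s' ''ret'' - 1"])
  qed
  moreover have "S' - S = set_option y" if "holds_basis n el s S" "holds_basis n el s' S'" for S S'
  proof -
    have S: "S = elem ` greedy Y" "S' = elem ` greedy (Y - {x})"
      using holds_basis_dstate[OF Y(1,3)] holds_basis_dstate[OF Y' ds2] that by auto
    have gc: "greedy (Y - {x}) \<subseteq> codes" "greedy Y \<subseteq> codes" using Y(1) greedy_subset by blast+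
    have "S' - S = elem ` (greedy (Y - {x}) - greedy Y)"
      unfolding S using gc by (intro inj_on_image_set_diff[OF elem_inj, symmetric]) auto
    then show ?thesis unfolding df y_def by (simp add: option.set_map)
  qed
  ultimately show thesis using that[OF e tt[unfolded r_def] inv'] by blast
qed

lemma invar_basis:
  assumes "invar X s"
  obtains S where "holds_basis n el s S" "is_min_weight_basis indep w X S"
  using assms greedy_min_weight_basis holds_basis_dstate by (auto simp: invar_def)

text \<open>The correctness theorems provide some run that preserves the invariant; since execution
  is deterministic, it is the run that led to the reachable state.\<close>

lemma reachable_invar:
  assumes xs: "distinct xs" "set xs \<subseteq> {..<n}"
    and "reachable n el (matroid_rank indep) w init_com delete_com xs X s"
  shows "invar X s"
  using assms(3)
proof induction
  case (initialized t s)
  obtain t' s' where e: "exec n el (matroid_rank indep) w init_com (initial_state n xs) t' s'"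
    and inv: "invar (el ` set xs) s'" using init_theorem[OF xs] .
  have "s' = s" using exec_deterministic[OF initialized e] by simp
  with inv show ?case by simp
next
  case (deleted X s i t s')
  obtain t1 s1 where e: "exec n el (matroid_rank indep) w delete_com (set_var ''arg'' i s) t1 s1"
    and inv: "invar (X - {el i}) s1" using delete_theorem[OF deleted.IH deleted.hyps(2,3)] .
  have "s1 = s'" using exec_deterministic[OF deleted.hyps(4) e] by simp
  with inv show ?case by simp
qed

end

section \<open>The data structure\<close>

theorem theorem6p1:
  "\<exists>(ini :: com) (del :: com) (C :: real) (k :: nat).
    \<forall>(U :: 'a set) (indep :: 'a set \<Rightarrow> bool) (w :: 'a \<Rightarrow> real) (n :: nat) (r :: nat)
      (el :: nat \<Rightarrow> 'a) (xs :: nat list).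
      matroid U indep \<and> card U = n \<and> matroid_rank indep U = r \<and> inj_on w U \<and>
      bij_betw el {..<n} U \<and> distinct xs \<and> set xs \<subseteq> {..<n} \<longrightarrow>
      (\<exists>t s S. exec n el (matroid_rank indep) w ini (initial_state n xs) t s \<and>
          real t \<le> C * (real n + 1) * ln (real n + 2) ^ k \<and>
          holds_basis n el s S \<and> is_min_weight_basis indep w (el ` set xs) S) \<and>
      (\<forall>X s S i. reachable n el (matroid_rank indep) w ini del xs X s \<and> holds_basis n el s S \<and>
          i < n \<and> el i \<in> X \<longrightarrow>
          (\<exists>t s' S'. exec n el (matroid_rank indep) w del (set_var ''arg'' i s) t s' \<and>
              real t \<le> C * (sqrt (real r) + 1) * ln (real n + 2) ^ k \<and>
              holds_basis n el s' S' \<and> is_min_weight_basis indep w (X - {el i}) S' \<and>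
              card (S' - S) \<le> 1 \<and>
              (\<exists>y. returned n el s' y \<and> S' - S = set_option y)))"
\<comment> \<open>4000000 exceeds both 2576000 (initialization) and 3477600 (deletion).\<close>
proof (rule exI[of _ init_com], rule exI[of _ delete_com], rule exI[of _ 4000000], rule exI[of _ 2],
    intro allI impI, elim conjE)
  fix U :: "'a set" and indep and w :: "'a \<Rightarrow> real" and n r and el :: "nat \<Rightarrow> 'a" and xs
  assume "matroid U indep" "card U = n" and r: "matroid_rank indep U = r" and "inj_on w U"
    "bij_betw el {..<n} U" and xs: "distinct xs" "set xs \<subseteq> {..<n}"
  then interpret numbered_matroid U indep n el w by (simp add: numbered_matroid_def numbered_matroid_axioms_def)
  obtain t0 s0 where e0: "exec n el (matroid_rank indep) w init_com (initial_state n xs) t0 s0"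
    and t0: "real t0 \<le> 4000000 * (real n + 1) * log_factor ^ 2" and inv0: "invar (el ` set xs) s0"
    using init_theorem[OF xs] .
  obtain S0 where S0: "holds_basis n el s0 S0" "is_min_weight_basis indep w (el ` set xs) S0"
    using invar_basis[OF inv0] .
  show "(\<exists>t s S. exec n el (matroid_rank indep) w init_com (initial_state n xs) t s \<and>
          real t \<le> 4000000 * (real n + 1) * ln (real n + 2) ^ 2 \<and>
          holds_basis n el s S \<and> is_min_weight_basis indep w (el ` set xs) S) \<and>
      (\<forall>X s S i. reachable n el (matroid_rank indep) w init_com delete_com xs X s \<and> holds_basis n el s S \<and>
          i < n \<and> el i \<in> X \<longrightarrow>
          (\<exists>t s' S'. exec n el (matroid_rank indep) w delete_com (set_var ''arg'' i s) t s' \<and>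
              real t \<le> 4000000 * (sqrt (real r) + 1) * ln (real n + 2) ^ 2 \<and>
              holds_basis n el s' S' \<and> is_min_weight_basis indep w (X - {el i}) S' \<and>
              card (S' - S) \<le> 1 \<and>
              (\<exists>y. returned n el s' y \<and> S' - S = set_option y)))"
  proof (intro conjI allI impI, goal_cases)
    case 1
    show ?case using e0 t0 S0 by (auto simp: log_factor_def)
  next
    case (2 X s S i)
    then have re: "reachable n el (matroid_rank indep) w init_com delete_com xs X s"
      and hb: "holds_basis n el s S" and i: "i < n" "el i \<in> X" by auto
    have inv: "invar X s" by (rule reachable_invar[OF xs re])
    obtain t s' y where e: "exec n el (matroid_rank indep) w delete_com (set_var ''arg'' i s) t s'"
      and t: "real t \<le> 4000000 * (sqrt (real r) + 1) * log_factor ^ 2"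
      and inv': "invar (X - {el i}) s'" and y: "returned n el s' y"
      and df: "\<And>S S'. holds_basis n el s S \<Longrightarrow> holds_basis n el s' S' \<Longrightarrow> S' - S = set_option y"
      using delete_theorem[OF inv i] unfolding r by metis
    obtain S' where S': "holds_basis n el s' S'" "is_min_weight_basis indep w (X - {el i}) S'"
      using invar_basis[OF inv'] .
    have d: "S' - S = set_option y" by (rule df[OF hb S'(1)])
    have "card (S' - S) \<le> 1" unfolding d by (cases y) auto
    then show ?case using e t S' y d unfolding log_factor_def by blast
  qed
qed

end
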